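(* The functional $$\mathcal{J}_0(u,d)=\int_{\Omega,h}\psi(\varepsilon(u),d)\,dV+\int_\Omega g_c\,\gamma(d,\nabla d)\,dV+P_{\mathrm{ext}}(u)$$ has the following properties: 1. $\mathcal{J}_0(\cdot,d)\in C^{1,1}$ and $\mathcal{J}_0(u,\cdot)\in C^2$ (on $\mathcal{K}_d$) for any $d\in\mathcal{K}_d$ and $u\in\mathbb{R}^{M,m}$. 2. The gradient $\nabla\mathcal{J}_0(\cdot,d)$ is semismooth for any $d\in\mathcal{K}_d$. 3. The gradient $\nabla\mathcal{J}_0(\cdot,d)$ is globally Lipschitz continuous uniformly in $d\in\mathcal{K}_d$. 4. $\mathcal{J}_0(\cdot,d)$ is strongly convex on $H^{\mathrm{alg}}_{u_0}$ uniformly in $d\in\mathcal{K}_d$ (i.e. with a modulus independent of $d$). 5. $\mathcal{J}_0(u,\cdot)$ is convex on $\mathcal{K}_d$ for any $u\in\mathbb{R}^{M,m}$.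
   Context: **Energy density.** $\mathbb{S}^m$ is the space of real symmetric $m\times m$ matrices with Frobenius norm $|\cdot|_F$. Fix $\mu>0$, $\lambda>-\tfrac23\mu$ and $\psi_0(\varepsilon)=\frac{\lambda}{2}(\operatorname{tr}\varepsilon)^2+\mu\operatorname{tr}(\varepsilon^2)$, assumed strongly convex on $\mathbb{S}^m$ (automatic for $m\le 3$). Let $g:[0,1]\to[0,1]$ be convex, $C^2$ (one-sided derivatives at endpoints), monotone decreasing, $g(0)=1$, $g(1)=0$; let $k>0$. Put $\psi(\varepsilon,d)=[g(d)+k]\psi_0^+(\varepsilon)+(1+k)\psi_0^-(\varepsilon)$ for $\varepsilon\in\mathbb{S}^m$, $d\in[0,1]$. With $\langle x\rangle_+=\max\{0,x\}$, $\langle x\rangle_-=\min\{0,x\}$, $\operatorname{dev}\varepsilon=\varepsilon-\frac{\operatorname{tr}\varepsilon}{m}I$, the pair $(\psi_0^+,\psi_0^-)$ is one of: (a) $\psi_0^+=\psi_0$, $\psi_0^-=0$; (b) $\psi_0^+=(\frac{\mu}{m}+\frac{\lambda}{2})(\operatorname{tr}\varepsilon)^2$, $\psi_0^-=\mu\operatorname{dev}\varepsilon:\operatorname{dev}\varepsilon$; (c) $\psi_0^+=(\frac{\mu}{m}+\frac{\lambda}{2})\langle\operatorname{tr}\varepsilon\rangle_+^2$, $\psi_0^-=(\frac{\mu}{m}+\frac{\lambda}{2})\langle\operatorname{tr}\varepsilon\rangle_-^2+\mu\operatorname{dev}\varepsilon:\operatorname{dev}\varepsilon$; (d) (only if $\lambda\ge0$)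 $\psi_0^\pm=\frac{\lambda}{2}\langle\sum_i\lambda_i(\varepsilon)\rangle_\pm^2+\mu\sum_i\langle\lambda_i(\varepsilon)\rangle_\pm^2$, where $\lambda_i(\varepsilon)$ are the eigenvalues of $\varepsilon$. **Crack surface density.** $\gamma(d,\nabla d)=\frac{1}{4c_w}\big(\frac{w(d)}{l}+l|\nabla d|^2\big)$ with $l>0$, $w(d)=(1+\beta(1-d))d$, $\beta\in[-1,0]$, $c_w=\int_0^1\sqrt{w(s)}\,ds$; $g_c>0$ is a constant. **Discretization.** $\Omega\subset\mathbb{R}^m$ is a bounded polyhedral domain with a conforming finite element grid $\mathcal{G}$, with nodes $\mathcal{N}=\{p_1,\dots,p_M\}$ and first-order Lagrange nodal basis $\theta_1,\dots,\theta_M$. Finite element functions $u:\Omega\to\mathbb{R}^m$, $d:\Omega\to\mathbb{R}$ are identified with their nodal coefficients $u\in\mathbb{R}^{M,m}$, $d\in\mathbb{R}^M$, and $\varepsilon(u)=\frac12(\nabla u+\nabla u^T)$. For $f$ on $\Omega$, $\int_{\Omega,h}f\,dV=\sum_{e\in\mathcal{G}}\sum_{\alpha=1}^{\alpha_{\max}}f(q_{e,\alpha})\omega_{e,\alpha}$ is a quadrature rule with points $q_{e,\alpha}\in e$ and positive weights, which on each element integrates $|\varepsilon(u)|_F^2$ exactly for every finite element function $u$. $P_{\mathrm{ext}}$ is a linear functional of $u$. The previous damage $d_n$ has nodal values $d_n(p_i)\in[0,1]$, and $\mathcal{K}_d=\prod_{i=1}^M[d_n(p_i),1]$. $\Gamma_{D,u}\subset\partial\Omega$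 is given, $H^{\mathrm{alg}}_{u_0}=\{u\in\mathbb{R}^{M,m}: u(p)=u_0(p)\ \forall p\in\mathcal{N}\cap\Gamma_{D,u}\}$ for given boundary values $u_0$, and $\mathcal{N}\cap\Gamma_{D,u}$ is assumed to contain all vertices of at least one boundary grid face. **Terminology.** $C^{1,1}$ means differentiable with locally Lipschitz continuous derivative; $\nabla\mathcal{J}_0(\cdot,d)$ is the gradient with respect to $u$. A locally Lipschitz map $F:\mathbb{R}^N\to\mathbb{R}^N$ is semismooth if for every $x,v\in\mathbb{R}^N$ the limit $\lim_{n\to\infty}G_nv_n$ exists and is the same for all sequences $v_n\to v$, $t_n\searrow0$, $G_n\in\partial F(x+t_nv_n)$, where $\partial F$ is Clarke's generalized Jacobian. *)

theory Defs
  imports "HOL-Analysis.Analysis" "HOL-Computational_Algebra.Polynomial"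
begin

section \<open>Smoothness and convexity notions\<close>

definition grad :: "('a::real_inner \<Rightarrow> real) \<Rightarrow> 'a \<Rightarrow> 'a" where
  "grad f x = (THE D. GDERIV f x :> D)"

definition locally_lipschitz :: "('a::metric_space \<Rightarrow> 'b::metric_space) \<Rightarrow> bool" where
  "locally_lipschitz F \<longleftrightarrow> (\<forall>x. \<exists>r>0. \<exists>L. L-lipschitz_on (ball x r) F)"

definition C11 :: "('a::euclidean_space \<Rightarrow> real) \<Rightarrow> bool" where
  "C11 f \<longleftrightarrow> (\<forall>x. f differentiable (at x)) \<and> locally_lipschitz (grad f)"

text \<open>Derivatives are taken within \<^term>\<open>S\<close>, hence are one-sided at boundary points.\<close>

definition C2_on :: "'a::real_normed_vector set \<Rightarrow> ('a \<Rightarrow> real) \<Rightarrow> bool" where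
  "C2_on S f \<longleftrightarrow>
     (\<exists>(f' :: 'a \<Rightarrow> 'a \<Rightarrow>\<^sub>L real) (f'' :: 'a \<Rightarrow> 'a \<Rightarrow>\<^sub>L 'a \<Rightarrow>\<^sub>L real).
        (\<forall>x\<in>S. (f has_derivative blinfun_apply (f' x)) (at x within S)) \<and>
        (\<forall>x\<in>S. (f' has_derivative blinfun_apply (f'' x)) (at x within S)) \<and>
        continuous_on S f'')"

definition strongly_convex_on :: "real \<Rightarrow> 'a::real_normed_vector set \<Rightarrow> ('a \<Rightarrow> real) \<Rightarrow> bool" where
  "strongly_convex_on c S f \<longleftrightarrow> convex S \<and>
     (\<forall>x\<in>S. \<forall>y\<in>S. \<forall>t\<in>{0..1}.
        f ((1 - t) *\<^sub>R x + t *\<^sub>R y)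
          \<le> (1 - t) * f x + t * f y - c / 2 * t * (1 - t) * (norm (x - y))\<^sup>2)"

definition clarke_jacobian ::
  "('a::euclidean_space \<Rightarrow> 'b::euclidean_space) \<Rightarrow> 'a \<Rightarrow> ('a \<Rightarrow>\<^sub>L 'b) set" where
  "clarke_jacobian F x = convex hull
     {A. \<exists>(s :: nat \<Rightarrow> 'a) D. s \<longlonglongrightarrow> x \<and>
           (\<forall>n. (F has_derivative blinfun_apply (D n)) (at (s n))) \<and> D \<longlonglongrightarrow> A}"

definition semismooth :: "('a::euclidean_space \<Rightarrow> 'a) \<Rightarrow> bool" where
  "semismooth F \<longleftrightarrow> locally_lipschitz F \<and>
     (\<forall>x v. \<exists>L. \<forall>vs ts (G :: nat \<Rightarrow> 'a \<Rightarrow>\<^sub>L 'a).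
        vs \<longlonglongrightarrow> v \<and> (\<forall>n. ts n > 0) \<and> ts \<longlonglongrightarrow> 0 \<and>
        (\<forall>n. G n \<in> clarke_jacobian F (x + ts n *\<^sub>R vs n))
        \<longrightarrow> (\<lambda>n. blinfun_apply (G n) (vs n)) \<longlonglongrightarrow> L)"

section \<open>Energy densities\<close>

text \<open>
  On \<^typ>\<open>real^'m^'m\<close> the norm and the inner product are the Frobenius norm and the
  Frobenius product.
\<close>

definition sym_matrices :: "(real^'m^'m) set" where
  "sym_matrices = {A. transpose A = A}"

definition dev :: "real^'m^'m \<Rightarrow> real^'m^'m" where
  "dev A = A - mat (trace A / real CARD('m))"

text \<open>Eigenvalues with multiplicity, as the roots of the characteristic polynomial.\<close>

definition eigenvalues :: "real^'m^'m \<Rightarrow> real multiset" where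
  "eigenvalues A = proots (det (mat [:0, 1:] - (\<chi> i j. [:A $ i $ j:])))"

definition psi0 :: "real \<Rightarrow> real \<Rightarrow> real^'m^'m \<Rightarrow> real" where
  "psi0 lam mu A = lam / 2 * (trace A)\<^sup>2 + mu * trace (A ** A)"

datatype energy_split = Isotropic | Volumetric | Volumetric_Deviatoric | Spectral

primrec psi_plus :: "energy_split \<Rightarrow> real \<Rightarrow> real \<Rightarrow> real^'m^'m \<Rightarrow> real" where
  "psi_plus Isotropic lam mu A = psi0 lam mu A"
| "psi_plus Volumetric lam mu A = (mu / real CARD('m) + lam / 2) * (trace A)\<^sup>2"
| "psi_plus Volumetric_Deviatoric lam mu A =
     (mu / real CARD('m) + lam / 2) * (max 0 (trace A))\<^sup>2"
| "psi_plus Spectral lam mu A =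
     lam / 2 * (max 0 (\<Sum>x\<in>#eigenvalues A. x))\<^sup>2 + mu * (\<Sum>x\<in>#eigenvalues A. (max 0 x)\<^sup>2)"

primrec psi_minus :: "energy_split \<Rightarrow> real \<Rightarrow> real \<Rightarrow> real^'m^'m \<Rightarrow> real" where
  "psi_minus Isotropic lam mu A = 0"
| "psi_minus Volumetric lam mu A = mu * (dev A \<bullet> dev A)"
| "psi_minus Volumetric_Deviatoric lam mu A =
     (mu / real CARD('m) + lam / 2) * (min 0 (trace A))\<^sup>2 + mu * (dev A \<bullet> dev A)"
| "psi_minus Spectral lam mu A =
     lam / 2 * (min 0 (\<Sum>x\<in>#eigenvalues A. x))\<^sup>2 + mu * (\<Sum>x\<in>#eigenvalues A. (min 0 x)\<^sup>2)"

definition psi ::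
  "energy_split \<Rightarrow> real \<Rightarrow> real \<Rightarrow> real \<Rightarrow> (real \<Rightarrow> real) \<Rightarrow> real^'m^'m \<Rightarrow> real \<Rightarrow> real" where
  "psi split lam mu k g A d =
     (g d + k) * psi_plus split lam mu A + (1 + k) * psi_minus split lam mu A"

definition crack_w :: "real \<Rightarrow> real \<Rightarrow> real" where
  "crack_w \<beta> d = (1 + \<beta> * (1 - d)) * d"

definition crack_c :: "real \<Rightarrow> real" where
  "crack_c \<beta> = integral {0..1} (\<lambda>s. sqrt (crack_w \<beta> s))"

definition crack_density :: "real \<Rightarrow> real \<Rightarrow> real \<Rightarrow> real^'m \<Rightarrow> real" where
  "crack_density \<beta> l d z = 1 / (4 * crack_c \<beta>) * (crack_w \<beta> d / l + l * (norm z)\<^sup>2)"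

section \<open>Grids and first-order Lagrange finite elements\<close>

definition polyhedral_domain :: "(real^'m) set \<Rightarrow> bool" where
  "polyhedral_domain \<Omega> \<longleftrightarrow> open \<Omega> \<and> connected \<Omega> \<and> \<Omega> \<noteq> {} \<and> bounded \<Omega> \<and>
     (\<exists>P. finite P \<and> (\<forall>F\<in>P. polytope F \<and> aff_dim F = int CARD('m) - 1) \<and> frontier \<Omega> = \<Union>P)"

text \<open>Polynomials of degree at most one in each variable (the space Q1).\<close>

definition multilinear_poly :: "(real^'m \<Rightarrow> 'b::real_vector) \<Rightarrow> bool" where
  "multilinear_poly q \<longleftrightarrow> (\<exists>c. \<forall>x. q x = (\<Sum>I\<in>UNIV. (\<Prod>i\<in>I. x $ i) *\<^sub>R c I))"

text \<open>
  A first-order Lagrange element is a cell \<^term>\<open>e\<close> with its space \<^term>\<open>V\<close> of shape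
  functions: a simplex with the affine functions, or a flat-faced image of the unit cube
  under a regular multilinear map with the mapped multilinear polynomials. In
  both cases the degrees of freedom are the values at the vertices of the cell. Membership in
  \<^term>\<open>V\<close> only constrains values on \<^term>\<open>e\<close>.
\<close>

definition lagrange_element :: "(real^'m) set \<Rightarrow> (real^'m \<Rightarrow> real) set \<Rightarrow> bool" where
  "lagrange_element e V \<longleftrightarrow>
     (int CARD('m) simplex e \<and> V = {v. \<exists>a b. \<forall>x\<in>e. v x = a \<bullet> x + b}) \<or>
     (\<exists>F :: real^'m \<Rightarrow> real^'m.
        multilinear_poly F \<and> inj_on F (cbox 0 1) \<and>
        (\<forall>x\<in>cbox 0 1. \<exists>F'. (F has_derivative F') (at x) \<and> bij F') \<and>
        e = F ` cbox 0 1 \<and> polytope e \<and>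
        V = {v. \<exists>q. multilinear_poly q \<and> (\<forall>x\<in>cbox 0 1. v (F x) = q x)})"

definition conforming_grid ::
  "(real^'m) set \<Rightarrow> (real^'m) set set \<Rightarrow> ((real^'m) set \<Rightarrow> (real^'m \<Rightarrow> real) set) \<Rightarrow> bool" where
  "conforming_grid \<Omega> \<G> V \<longleftrightarrow> finite \<G> \<and> closure \<Omega> = \<Union>\<G> \<and>
     (\<forall>e\<in>\<G>. lagrange_element e (V e)) \<and>
     (\<forall>e\<in>\<G>. \<forall>e'\<in>\<G>. (e \<inter> e') face_of e)"

definition nodal_basis ::
  "(real^'m) set set \<Rightarrow> ((real^'m) set \<Rightarrow> (real^'m \<Rightarrow> real) set) \<Rightarrow>
   ('n \<Rightarrow> real^'m) \<Rightarrow> ('n \<Rightarrow> real^'m \<Rightarrow> real) \<Rightarrow> bool" where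
  "nodal_basis \<G> V p \<theta> \<longleftrightarrow>
     inj p \<and> range p = {x. \<exists>e\<in>\<G>. x extreme_point_of e} \<and>
     (\<forall>i. continuous_on (\<Union>\<G>) (\<theta> i) \<and> (\<forall>e\<in>\<G>. \<theta> i \<in> V e) \<and>
          (\<forall>j. \<theta> i (p j) = (if i = j then 1 else 0)))"

definition fe_fun ::
  "('n::finite \<Rightarrow> real^'m \<Rightarrow> real) \<Rightarrow> 'b::real_vector^'n \<Rightarrow> real^'m \<Rightarrow> 'b" where
  "fe_fun \<theta> c x = (\<Sum>i\<in>UNIV. \<theta> i x *\<^sub>R c $ i)"

text \<open>
  The gradient is taken from inside the element \<^term>\<open>e\<close>, because it jumps across element
  boundaries and quadrature points may lie there.
\<close>

definition strain :: "(real^'m) set \<Rightarrow> (real^'m \<Rightarrow> real^'m) \<Rightarrow> real^'m \<Rightarrow> real^'m^'m" where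
  "strain e u x = (let J = matrix (frechet_derivative u (at x within e))
                   in (1 / 2) *\<^sub>R (J + transpose J))"

definition quadrature ::
  "'e set \<Rightarrow> nat \<Rightarrow> ('e \<Rightarrow> nat \<Rightarrow> 'x) \<Rightarrow> ('e \<Rightarrow> nat \<Rightarrow> real) \<Rightarrow> ('e \<Rightarrow> 'x \<Rightarrow> real) \<Rightarrow> real" where
  "quadrature \<G> N q \<omega> f = (\<Sum>e\<in>\<G>. \<Sum>\<alpha>=1..N. f e (q e \<alpha>) * \<omega> e \<alpha>)"

definition admissible_damage :: "real^'n \<Rightarrow> (real^'n) set" where
  "admissible_damage dn = {d. \<forall>i. d $ i \<in> {dn $ i..1}}"

definition dirichlet_space ::
  "('n \<Rightarrow> real^'m) \<Rightarrow> (real^'m) set \<Rightarrow> (real^'m \<Rightarrow> real^'m) \<Rightarrow> (real^'m^'n) set" where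
  "dirichlet_space p \<Gamma> u0 = {u. \<forall>i. p i \<in> \<Gamma> \<longrightarrow> u $ i = u0 (p i)}"

end

theory Submission
  imports Defs
begin

text \<open>
  The energy is a finite sum over quadrature points of densities
  \<open>(g(d) + k) \<psi>\<^sup>+(\<epsilon>(u)) + (1 + k) \<psi>\<^sup>-(\<epsilon>(u))\<close>, plus a crack term that depends on \<open>d\<close> only and a
  linear term in \<open>u\<close>. At a fixed quadrature point the strain \<open>\<epsilon>(u)\<close> is a linear function of the nodal
  vector \<open>u\<close> with symmetric values, and \<open>d\<close> is a linear function of its nodal values with values in
  \<open>[0, 1]\<close>; the latter holds because finite element functions are bounded by their vertex values.

  In the displacement, all claims but strong convexity follow from properties of \<open>\<psi>\<^sup>+\<close> and \<open>\<psi>\<^sup>-\<close> that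
  survive sums with nonnegative coefficients and linear substitutions: convexity, a Lipschitz
  gradient, and a chord condition for the gradient on rays that implies semismoothness
  (\<open>ray_quadratic_imp_semismooth\<close>). The coefficients are at most \<open>1 + k\<close>, so the constants do not
  depend on the damage. The spectral split is the hard case. There the gradients contain
  the positive and the negative part of a symmetric matrix, and the chord condition reduces to the
  absolute value of a matrix. In the eigenbases of the two matrices that are compared, this is an estimate for each
  entry (\<open>abs_ray_entry_bound\<close>), which separates eigenvalues close to the kernel of the base point
  from the others. Convexity and the Lipschitz bound for spectral functions follow in the same
  bases from inequalities for functions of one variable.

  For strong convexity, \<open>\<psi>\<^sup>+ + \<psi>\<^sup>- = \<psi>\<^sub>0\<close> shows that the density is \<open>k \<psi>\<^sub>0\<close> plus a convex function.
  It remains to bound \<open>\<Sum>\<omega> \<bar>\<epsilon>(u)\<bar>\<^sup>2\<close> from below for displacements that vanish on the Dirichlet part.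
  By finite dimension it suffices that zero strain implies zero displacement. Exactness of the
  quadrature makes the strain vanish on all elements. The displacement component along a segment
  is then a continuous function with finitely many values on the segment, hence constant; this makes
  the displacement a rigid motion on every ball, and on the connected domain
  (\<open>zero_strain_rigid\<close>). It vanishes at the vertices of a boundary facet, and hence everywhere.

  In the damage, each quadrature term is a nonnegative multiple of \<open>g\<close> composed with a linear
  function, plus a constant, and the crack term is a linear plus a positive semidefinite quadratic
  form (\<open>crack_energy_quadratic\<close>), which gives both \<open>C\<^sup>2\<close> and convexity.
\<close>

section \<open>Semismoothness from chord conditions on rays\<close>

text \<open>
  Used to move from a point in an arbitrary direction without leaving a ball, also for \<open>h = 0\<close>.
\<close>
lemma small_scaling:
  fixes h :: "'a::real_normed_vector"
  assumes "r > 0"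
  obtains s where "s > 0" "s * norm h < r"
proof
  have N: "norm h + 1 > 0" by (rule add_nonneg_pos) auto
  then show "r / (norm h + 1) > 0" using assms by simp
  have "norm h * r < (norm h + 1) * r" using assms by (intro mult_strict_right_mono) auto
  then show "r / (norm h + 1) * norm h < r" using N by (simp add: field_simps)
qed

text \<open>
  Semismoothness at \<open>x\<close> compares \<open>DF(z)(z - x)\<close> with \<open>F z - F x\<close>. On the ray from \<open>x\<close>
  through \<open>z\<close> these are an end-point derivative and a chord, so it suffices to bound how far \<open>F\<close>
  leaves its chords on segments that start at \<open>x\<close>; the factor \<open>r * (1 - r)\<close> makes the bound vanish
  to first order at both ends. This chord condition does not mention generalized Jacobians, and
  therefore passes to sums and linear substitutions, where the calculus of Clarke's Jacobian has
  only inclusions and would need almost everywhere differentiability.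
\<close>
definition ray_quadratic :: "('a::real_normed_vector \<Rightarrow> 'b::real_normed_vector) \<Rightarrow> bool" where
  "ray_quadratic F \<longleftrightarrow> (\<forall>x. \<exists>C\<ge>0. \<forall>h. \<forall>r\<in>{0..1}.
     norm (F (x + r *\<^sub>R h) - F x - r *\<^sub>R (F (x + h) - F x)) \<le> C * (r * (1 - r)) * (norm h)\<^sup>2)"

lemma ray_quadraticE:
  assumes "ray_quadratic F"
  obtains C where "C \<ge> 0" "\<And>h r. 0 \<le> r \<Longrightarrow> r \<le> 1 \<Longrightarrow>
     norm (F (x + r *\<^sub>R h) - F x - r *\<^sub>R (F (x + h) - F x)) \<le> C * (r * (1 - r)) * (norm h)\<^sup>2"
  using assms unfolding ray_quadratic_def by (metis atLeastAtMost_iff)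

lemma ray_quadratic_affine:
  assumes "linear F"
  shows "ray_quadratic (\<lambda>x. F x + c)"
  unfolding ray_quadratic_def
  by (intro allI exI[of _ 0]) (auto simp: linear_add[OF assms] linear_scale[OF assms])

lemma ray_quadratic_add:
  assumes "ray_quadratic F" "ray_quadratic G"
  shows "ray_quadratic (\<lambda>x. F x + G x)"
  unfolding ray_quadratic_def
proof (rule allI)
  fix x
  obtain C where C: "C \<ge> 0" "\<And>h r. 0 \<le> r \<Longrightarrow> r \<le> 1 \<Longrightarrow>
     norm (F (x + r *\<^sub>R h) - F x - r *\<^sub>R (F (x + h) - F x)) \<le> C * (r * (1 - r)) * (norm h)\<^sup>2"
    using ray_quadraticE[OF assms(1), of x] by metis
  obtain D where D: "D \<ge> 0" "\<And>h r. 0 \<le> r \<Longrightarrow> r \<le> 1 \<Longrightarrow>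
     norm (G (x + r *\<^sub>R h) - G x - r *\<^sub>R (G (x + h) - G x)) \<le> D * (r * (1 - r)) * (norm h)\<^sup>2"
    using ray_quadraticE[OF assms(2), of x] by metis
  show "\<exists>C\<ge>0. \<forall>h. \<forall>r\<in>{0..1}.
     norm (F (x + r *\<^sub>R h) + G (x + r *\<^sub>R h) - (F x + G x)
        - r *\<^sub>R (F (x + h) + G (x + h) - (F x + G x))) \<le> C * (r * (1 - r)) * (norm h)\<^sup>2"
  proof (intro exI[of _ "C + D"] conjI allI ballI)
    fix h and r :: real
    assume r: "r \<in> {0..1}"
    have "F (x + r *\<^sub>R h) + G (x + r *\<^sub>R h) - (F x + G x)
        - r *\<^sub>R (F (x + h) + G (x + h) - (F x + G x))
      = (F (x + r *\<^sub>R h) - F x - r *\<^sub>R (F (x + h) - F x))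
        + (G (x + r *\<^sub>R h) - G x - r *\<^sub>R (G (x + h) - G x))"
      by (simp add: algebra_simps)
    also have "norm \<dots> \<le> C * (r * (1 - r)) * (norm h)\<^sup>2 + D * (r * (1 - r)) * (norm h)\<^sup>2"
      using C(2)[of r h] D(2)[of r h] r by (intro norm_triangle_mono) auto
    finally show "norm (F (x + r *\<^sub>R h) + G (x + r *\<^sub>R h) - (F x + G x)
        - r *\<^sub>R (F (x + h) + G (x + h) - (F x + G x))) \<le> (C + D) * (r * (1 - r)) * (norm h)\<^sup>2"
      by (simp add: distrib_right)
  qed (use C D in simp)
qed

lemma ray_quadratic_linear_comp:
  assumes F: "ray_quadratic F" and A: "bounded_linear A" and B: "bounded_linear B"
  shows "ray_quadratic (\<lambda>x. A (F (B x)))"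
  unfolding ray_quadratic_def
proof (rule allI)
  fix x
  interpret A: bounded_linear A by fact
  interpret B: bounded_linear B by fact
  obtain C where C: "C \<ge> 0" "\<And>h r. 0 \<le> r \<Longrightarrow> r \<le> 1 \<Longrightarrow>
     norm (F (B x + r *\<^sub>R h) - F (B x) - r *\<^sub>R (F (B x + h) - F (B x))) \<le> C * (r * (1 - r)) * (norm h)\<^sup>2"
    using ray_quadraticE[OF F, of "B x"] by metis
  obtain a where a: "a \<ge> 0" "\<And>y. norm (A y) \<le> norm y * a"
    using A.nonneg_bounded by auto
  obtain b where b: "b \<ge> 0" "\<And>y. norm (B y) \<le> norm y * b"
    using B.nonneg_bounded by auto
  show "\<exists>C\<ge>0. \<forall>h. \<forall>r\<in>{0..1}.
     norm (A (F (B (x + r *\<^sub>R h))) - A (F (B x)) - r *\<^sub>R (A (F (B (x + h))) - A (F (B x))))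
       \<le> C * (r * (1 - r)) * (norm h)\<^sup>2"
  proof (intro exI[of _ "C * b\<^sup>2 * a"] conjI allI ballI)
    fix h and r :: real
    assume r: "r \<in> {0..1}"
    have "A (F (B (x + r *\<^sub>R h))) - A (F (B x)) - r *\<^sub>R (A (F (B (x + h))) - A (F (B x)))
        = A (F (B x + r *\<^sub>R B h) - F (B x) - r *\<^sub>R (F (B x + B h) - F (B x)))"
      by (simp add: A.diff A.scaleR B.add B.scaleR)
    also have "norm \<dots> \<le> norm (F (B x + r *\<^sub>R B h) - F (B x) - r *\<^sub>R (F (B x + B h) - F (B x))) * a"
      by (rule a)
    also have "\<dots> \<le> (C * (r * (1 - r)) * (norm (B h))\<^sup>2) * a"
      using C(2)[of r "B h"] r a(1) by (intro mult_right_mono) auto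
    also have "\<dots> \<le> (C * (r * (1 - r)) * (norm h * b)\<^sup>2) * a"
      using r a C(1) b by (intro mult_right_mono mult_left_mono power_mono) auto
    finally show "norm (A (F (B (x + r *\<^sub>R h))) - A (F (B x)) - r *\<^sub>R (A (F (B (x + h))) - A (F (B x))))
       \<le> C * b\<^sup>2 * a * (r * (1 - r)) * (norm h)\<^sup>2"
      by (simp add: power_mult_distrib algebra_simps)
  qed (use C a in simp)
qed

text \<open>
  The derivative at \<open>z\<close> in direction \<open>z - x\<close> is the limit of the difference quotients taken
  backwards along the segment, and the chord condition with \<open>r = 1 - \<sigma>\<close>, divided by \<open>\<sigma>\<close>, bounds
  their distance from \<open>F z - F x\<close>.
\<close>
lemma ray_quadratic_jacobian:
  fixes F :: "'a::euclidean_space \<Rightarrow> 'b::euclidean_space"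
  assumes C: "\<And>h r. 0 \<le> r \<Longrightarrow> r \<le> 1 \<Longrightarrow>
     norm (F (x + r *\<^sub>R h) - F x - r *\<^sub>R (F (x + h) - F x)) \<le> C * (r * (1 - r)) * (norm h)\<^sup>2"
    and C0: "C \<ge> 0"
    and D: "(F has_derivative D) (at z)"
  shows "norm (D (z - x) - (F z - F x)) \<le> C * (norm (z - x))\<^sup>2"
proof -
  define h where "h = z - x"
  have lin: "linear D" using D by (simp add: has_derivative_linear)
  have bound: "norm (D h - (F z - F x)) \<le> C * (norm h)\<^sup>2 + \<epsilon> * norm h" if "\<epsilon> > 0" for \<epsilon>
  proof -
    obtain \<delta> where \<delta>: "\<delta> > 0" "\<And>y. norm (y - z) < \<delta> \<Longrightarrow> norm (F y - F z - D (y - z)) \<le> \<epsilon> * norm (y - z)"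
      using D \<open>\<epsilon> > 0\<close> unfolding has_derivative_at_alt by metis
    obtain s where s: "s > 0" "s * norm h < \<delta>" using small_scaling[OF \<delta>(1)] by metis
    define \<sigma> where "\<sigma> = min 1 s"
    have \<sigma>: "0 < \<sigma>" "\<sigma> \<le> 1" using s by (auto simp: \<sigma>_def)
    have "\<sigma> * norm h \<le> s * norm h" by (intro mult_right_mono) (auto simp: \<sigma>_def)
    then have "\<sigma> * norm h < \<delta>" using s by linarith
    then have "norm (F (z - \<sigma> *\<^sub>R h) - F z - D (- (\<sigma> *\<^sub>R h))) \<le> \<epsilon> * norm (\<sigma> *\<^sub>R h)"
      using \<delta>(2)[of "z - \<sigma> *\<^sub>R h"] \<sigma> by simp
    then have 1: "norm (F (z - \<sigma> *\<^sub>R h) - F z + \<sigma> *\<^sub>R D h) \<le> \<epsilon> * \<sigma> * norm h"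
      using \<sigma> by (simp add: linear_neg[OF lin] linear_scale[OF lin])
    \<comment> \<open>The point \<open>z - \<sigma> *\<^sub>R h\<close>, just before \<open>z\<close> on the segment, corresponds to \<open>r = 1 - \<sigma>\<close>.\<close>
    have xz: "x + (1 - \<sigma>) *\<^sub>R h = z - \<sigma> *\<^sub>R h" "x + h = z"
      by (auto simp: h_def algebra_simps)
    have "norm (F (z - \<sigma> *\<^sub>R h) - F x - (1 - \<sigma>) *\<^sub>R (F z - F x)) \<le> C * ((1 - \<sigma>) * \<sigma>) * (norm h)\<^sup>2"
      using C[of "1 - \<sigma>" h] \<sigma> unfolding xz by simp
    also have "\<dots> \<le> C * \<sigma> * (norm h)\<^sup>2"
      using \<sigma> C0 by (intro mult_right_mono mult_left_mono) (auto simp: mult_le_cancel_right1)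
    finally have 2: "norm (F (z - \<sigma> *\<^sub>R h) - F x - (1 - \<sigma>) *\<^sub>R (F z - F x)) \<le> C * \<sigma> * (norm h)\<^sup>2" .
    have "\<sigma> *\<^sub>R (D h - (F z - F x)) = (F (z - \<sigma> *\<^sub>R h) - F z + \<sigma> *\<^sub>R D h)
        - (F (z - \<sigma> *\<^sub>R h) - F x - (1 - \<sigma>) *\<^sub>R (F z - F x))"
      by (simp add: algebra_simps)
    then have "norm (\<sigma> *\<^sub>R (D h - (F z - F x))) \<le> \<epsilon> * \<sigma> * norm h + C * \<sigma> * (norm h)\<^sup>2"
      using norm_triangle_ineq4[of "F (z - \<sigma> *\<^sub>R h) - F z + \<sigma> *\<^sub>R D h"] 1 2
      by (smt (verit))
    then have "\<sigma> * norm (D h - (F z - F x)) \<le> \<sigma> * (C * (norm h)\<^sup>2 + \<epsilon> * norm h)"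
      using \<sigma> unfolding norm_scaleR by (simp add: mult_ac distrib_left add.commute)
    then show ?thesis using \<sigma> by simp
  qed
  show ?thesis unfolding h_def[symmetric]
  proof (rule field_le_epsilon)
    fix e :: real assume "e > 0"
    obtain s where s: "s > 0" "s * norm h < e" using small_scaling[OF \<open>e > 0\<close>] by metis
    then show "norm (D h - (F z - F x)) \<le> C * (norm h)\<^sup>2 + e" using bound[OF s(1)] by linarith
  qed
qed

text \<open>
  The estimate for derivatives describes a closed convex set of linear maps, so it survives the
  limits and convex combinations from which the generalized Jacobian is built.
\<close>
lemma ray_quadratic_clarke:
  fixes F :: "'a::euclidean_space \<Rightarrow> 'b::euclidean_space"
  assumes C: "\<And>h r. 0 \<le> r \<Longrightarrow> r \<le> 1 \<Longrightarrow>
     norm (F (x + r *\<^sub>R h) - F x - r *\<^sub>R (F (x + h) - F x)) \<le> C * (r * (1 - r)) * (norm h)\<^sup>2"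
    and C0: "C \<ge> 0" and cont: "continuous_on UNIV F"
    and G: "G \<in> clarke_jacobian F y"
  shows "norm (blinfun_apply G (y - x) - (F y - F x)) \<le> C * (norm (y - x))\<^sup>2"
proof -
  define S where "S = {A :: 'a \<Rightarrow>\<^sub>L 'b. norm (blinfun_apply A (y - x) - (F y - F x)) \<le> C * (norm (y - x))\<^sup>2}"
  have "S = (\<lambda>A. blinfun_apply A (y - x)) -` cball (F y - F x) (C * (norm (y - x))\<^sup>2)"
    by (auto simp: S_def dist_norm norm_minus_commute)
  then have "convex S"
    using convex_linear_vimage[of "\<lambda>A. blinfun_apply A (y - x)" "cball (F y - F x) (C * (norm (y - x))\<^sup>2)"]
    by (simp add: bounded_linear.linear bounded_linear_intros)
  moreover have "A \<in> S" if "s \<longlonglongrightarrow> y" "\<And>n. (F has_derivative blinfun_apply (D n)) (at (s n))" "D \<longlonglongrightarrow> A" for A s D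
  proof -
    have "(\<lambda>n. F (s n)) \<longlonglongrightarrow> F y"
      using continuous_on_tendsto_compose[OF cont that(1)] by simp
    then have "(\<lambda>n. norm (blinfun_apply (D n) (s n - x) - (F (s n) - F x))) \<longlonglongrightarrow> norm (blinfun_apply A (y - x) - (F y - F x))"
      using that by (intro tendsto_intros)
    moreover have "(\<lambda>n. C * (norm (s n - x))\<^sup>2) \<longlonglongrightarrow> C * (norm (y - x))\<^sup>2"
      using that by (intro tendsto_intros)
    moreover have "norm (blinfun_apply (D n) (s n - x) - (F (s n) - F x)) \<le> C * (norm (s n - x))\<^sup>2" for n
      by (rule ray_quadratic_jacobian[OF C C0 that(2)])
    ultimately show ?thesis unfolding S_def by (auto intro: LIMSEQ_le)
  qed
  ultimately have "clarke_jacobian F y \<subseteq> S"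
    unfolding clarke_jacobian_def by (intro hull_minimal) auto
  with G show ?thesis by (auto simp: S_def)
qed

text \<open>
  The difference quotients in direction \<open>v\<close> are Lipschitz continuous functions of the step length
  with constant \<open>C * (norm v)\<^sup>2\<close>, hence have a limit at \<open>0\<close>.
\<close>
lemma ray_quadratic_directional_derivative:
  fixes F :: "'a::euclidean_space \<Rightarrow> 'b::euclidean_space"
  assumes C: "\<And>h r. 0 \<le> r \<Longrightarrow> r \<le> 1 \<Longrightarrow>
     norm (F (x + r *\<^sub>R h) - F x - r *\<^sub>R (F (x + h) - F x)) \<le> C * (r * (1 - r)) * (norm h)\<^sup>2"
    and C0: "C \<ge> 0"
  shows "\<exists>L. ((\<lambda>t. (1 / t) *\<^sub>R (F (x + t *\<^sub>R v) - F x)) \<longlongrightarrow> L) (at_right 0)"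
proof -
  define \<psi> where "\<psi> t = (1 / t) *\<^sub>R (F (x + t *\<^sub>R v) - F x)" for t
  define K where "K = C * (norm v)\<^sup>2"
  have "K \<ge> 0" using C0 by (simp add: K_def)
  have main: "norm (\<psi> a - \<psi> b) \<le> K * (b - a)" if "0 < a" "a \<le> b" for a b
  proof -
    \<comment> \<open>The two quotients belong to points on one ray: the smaller step is the fraction \<open>r\<close> of the larger.\<close>
    define r where "r = a / b"
    have r: "0 < r" "r \<le> 1" "a = r * b" and b: "b > 0" using that by (auto simp: r_def)
    have "norm (F (x + r *\<^sub>R (b *\<^sub>R v)) - F x - r *\<^sub>R (F (x + b *\<^sub>R v) - F x)) \<le> C * (r * (1 - r)) * (norm (b *\<^sub>R v))\<^sup>2"
      using C[of r "b *\<^sub>R v"] r by simp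
    moreover have "F (x + r *\<^sub>R (b *\<^sub>R v)) - F x - r *\<^sub>R (F (x + b *\<^sub>R v) - F x) = a *\<^sub>R (\<psi> a - \<psi> b)"
      using r b by (simp add: \<psi>_def scaleR_diff_right)
    moreover have "C * (r * (1 - r)) * (norm (b *\<^sub>R v))\<^sup>2 = a * (K * (b - a))"
      using r(3) b by (simp add: K_def power_mult_distrib power2_eq_square algebra_simps)
    ultimately have "a * norm (\<psi> a - \<psi> b) \<le> a * (K * (b - a))"
      using that by simp
    then show ?thesis using that by simp
  qed
  have "Cauchy (\<lambda>n. \<psi> (1 / Suc n))"
  proof (rule CauchyI)
    fix e :: real assume "e > 0"
    obtain M where M: "K / e < real M" using reals_Archimedean2 by blast
    have small: "norm (\<psi> (1 / Suc m) - \<psi> (1 / Suc n)) < e" if "M \<le> n" "n \<le> m" for m n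
    proof -
      have "norm (\<psi> (1 / Suc m) - \<psi> (1 / Suc n)) \<le> K * (1 / Suc n - 1 / Suc m)"
        using that by (intro main) (auto simp: frac_le)
      also have "\<dots> \<le> K * (1 / Suc n)" using \<open>K \<ge> 0\<close> by (intro mult_left_mono) auto
      also have "\<dots> < e"
      proof -
        have "K < e * real M" using M \<open>e > 0\<close> by (simp add: field_simps)
        also have "\<dots> \<le> e * real (Suc n)" using that \<open>e > 0\<close> by (intro mult_left_mono) auto
        finally show ?thesis by (simp add: field_simps)
      qed
      finally show ?thesis .
    qed
    show "\<exists>M. \<forall>m\<ge>M. \<forall>n\<ge>M. norm (\<psi> (1 / Suc m) - \<psi> (1 / Suc n)) < e"
      using small by (intro exI[of _ M]) (metis nle_le norm_minus_commute)
  qed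
  then obtain L where L: "(\<lambda>n. \<psi> (1 / Suc n)) \<longlonglongrightarrow> L"
    using Cauchy_convergent convergent_def by blast
  have bd: "norm (\<psi> t - L) \<le> K * t" if "t > 0" for t
  proof (rule tendsto_upperbound)
    show "(\<lambda>n. norm (\<psi> t - \<psi> (1 / Suc n))) \<longlonglongrightarrow> norm (\<psi> t - L)"
      using L by (intro tendsto_intros)
    have "(\<lambda>n. 1 / real (Suc n)) \<longlonglongrightarrow> 0"
      using LIMSEQ_inverse_real_of_nat by (simp add: inverse_eq_divide)
    then have "\<forall>\<^sub>F n in sequentially. 1 / real (Suc n) < t"
      using order_tendstoD(2) that by blast
    then show "\<forall>\<^sub>F n in sequentially. norm (\<psi> t - \<psi> (1 / Suc n)) \<le> K * t"
    proof eventually_elim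
      case (elim n)
      have "norm (\<psi> (1 / Suc n) - \<psi> t) \<le> K * (t - 1 / Suc n)" using elim by (intro main) auto
      also have "\<dots> \<le> K * t" using \<open>K \<ge> 0\<close> by (intro mult_left_mono) auto
      finally show ?case by (simp add: norm_minus_commute)
    qed
  qed simp
  have "((\<lambda>t. K * t) \<longlongrightarrow> K * 0) (at_right 0)" by (intro tendsto_intros)
  then have "((\<lambda>t. K * t) \<longlongrightarrow> 0) (at_right 0)" by simp
  moreover have "\<forall>\<^sub>F t in at_right 0. norm (\<psi> t - L) \<le> K * t"
    using bd by (auto simp: eventually_at_filter)
  ultimately have "((\<lambda>t. \<psi> t - L) \<longlongrightarrow> 0) (at_right 0)"
    by (rule Lim_null_comparison[rotated])
  then have "(\<psi> \<longlongrightarrow> L) (at_right 0)" by (simp add: LIM_zero_iff)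
  then show ?thesis unfolding \<psi>_def by blast
qed

text \<open>
  With \<open>z = x + t\<^sub>n v\<^sub>n\<close> the estimate for generalized Jacobians, divided by \<open>t\<^sub>n\<close>, says that \<open>G\<^sub>n v\<^sub>n\<close>
  differs from a difference quotient of \<open>F\<close> at \<open>x\<close> by \<open>O(t\<^sub>n)\<close>. The Lipschitz bound replaces \<open>v\<^sub>n\<close>
  by \<open>v\<close>, so the limit is the directional derivative, whatever the sequences are.
\<close>
lemma ray_quadratic_imp_semismooth:
  fixes F :: "'a::euclidean_space \<Rightarrow> 'a"
  assumes lip: "K-lipschitz_on UNIV F" and ray: "ray_quadratic F"
  shows "semismooth F"
  unfolding semismooth_def
proof (intro conjI allI)
  show "locally_lipschitz F"
    unfolding locally_lipschitz_def using lip lipschitz_on_subset zero_less_one by blast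
  fix x v
  have cont: "continuous_on UNIV F" using lip by (rule lipschitz_on_continuous_on)
  obtain C where C0: "C \<ge> 0" and C: "\<And>h r. 0 \<le> r \<Longrightarrow> r \<le> 1 \<Longrightarrow>
     norm (F (x + r *\<^sub>R h) - F x - r *\<^sub>R (F (x + h) - F x)) \<le> C * (r * (1 - r)) * (norm h)\<^sup>2"
    using ray_quadraticE[OF ray, of x] by metis
  obtain L where L: "((\<lambda>t. (1 / t) *\<^sub>R (F (x + t *\<^sub>R v) - F x)) \<longlongrightarrow> L) (at_right 0)"
    using ray_quadratic_directional_derivative[OF C C0] by blast
  show "\<exists>L. \<forall>vs ts (G :: nat \<Rightarrow> 'a \<Rightarrow>\<^sub>L 'a).
        vs \<longlonglongrightarrow> v \<and> (\<forall>n. ts n > 0) \<and> ts \<longlonglongrightarrow> 0 \<and>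
        (\<forall>n. G n \<in> clarke_jacobian F (x + ts n *\<^sub>R vs n))
        \<longrightarrow> (\<lambda>n. blinfun_apply (G n) (vs n)) \<longlonglongrightarrow> L"
  proof (intro exI[of _ L] allI impI, elim conjE)
    fix vs ts and G :: "nat \<Rightarrow> 'a \<Rightarrow>\<^sub>L 'a"
    assume vs: "vs \<longlonglongrightarrow> v" and pos: "\<forall>n. ts n > 0" and ts: "ts \<longlonglongrightarrow> 0"
      and G: "\<forall>n. G n \<in> clarke_jacobian F (x + ts n *\<^sub>R vs n)"
    define \<psi> where "\<psi> n = (1 / ts n) *\<^sub>R (F (x + ts n *\<^sub>R v) - F x)" for n
    have "filterlim ts (at_right 0) sequentially"
      using ts pos by (intro filterlim_at_withinI always_eventually) auto
    then have \<psi>: "\<psi> \<longlonglongrightarrow> L"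
      unfolding \<psi>_def by (rule filterlim_compose[OF L])
    have bound: "norm (blinfun_apply (G n) (vs n) - \<psi> n) \<le> C * ts n * (norm (vs n))\<^sup>2 + K * norm (vs n - v)" for n
    proof -
      have t: "ts n > 0" using pos by simp
      have "norm (blinfun_apply (G n) (ts n *\<^sub>R vs n) - (F (x + ts n *\<^sub>R vs n) - F x)) \<le> C * (norm (ts n *\<^sub>R vs n))\<^sup>2"
        using ray_quadratic_clarke[OF C C0 cont, of "G n" "x + ts n *\<^sub>R vs n"] G by simp
      moreover have "norm (F (x + ts n *\<^sub>R vs n) - F (x + ts n *\<^sub>R v)) \<le> K * norm (ts n *\<^sub>R vs n - ts n *\<^sub>R v)"
        using lipschitz_onD[OF lip, of "x + ts n *\<^sub>R vs n" "x + ts n *\<^sub>R v"] by (simp add: dist_norm)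
      ultimately have "norm (blinfun_apply (G n) (ts n *\<^sub>R vs n) - (F (x + ts n *\<^sub>R v) - F x))
          \<le> C * (norm (ts n *\<^sub>R vs n))\<^sup>2 + K * norm (ts n *\<^sub>R vs n - ts n *\<^sub>R v)"
        using norm_triangle_ineq[of "blinfun_apply (G n) (ts n *\<^sub>R vs n) - (F (x + ts n *\<^sub>R vs n) - F x)"
          "F (x + ts n *\<^sub>R vs n) - F (x + ts n *\<^sub>R v)"] by (simp add: algebra_simps)
      moreover have "blinfun_apply (G n) (ts n *\<^sub>R vs n) - (F (x + ts n *\<^sub>R v) - F x)
          = ts n *\<^sub>R (blinfun_apply (G n) (vs n) - \<psi> n)"
        using t by (simp add: \<psi>_def blinfun.scaleR_right scaleR_diff_right)
      moreover have "norm (ts n *\<^sub>R vs n - ts n *\<^sub>R v) = ts n * norm (vs n - v)"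
        using t by (simp flip: scaleR_diff_right)
      ultimately have "ts n * norm (blinfun_apply (G n) (vs n) - \<psi> n)
          \<le> ts n * (C * ts n * (norm (vs n))\<^sup>2 + K * norm (vs n - v))"
        using t unfolding norm_scaleR by (simp add: power_mult_distrib power2_eq_square distrib_left mult_ac)
      then show ?thesis using t by simp
    qed
    have "(\<lambda>n. C * ts n * (norm (vs n))\<^sup>2 + K * norm (vs n - v)) \<longlonglongrightarrow> C * 0 * (norm v)\<^sup>2 + K * norm (v - v)"
      using vs ts by (intro tendsto_intros)
    then have "(\<lambda>n. C * ts n * (norm (vs n))\<^sup>2 + K * norm (vs n - v)) \<longlonglongrightarrow> 0" by simp
    then have "(\<lambda>n. blinfun_apply (G n) (vs n) - \<psi> n) \<longlonglongrightarrow> 0"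
      by (rule Lim_null_comparison[OF always_eventually[OF allI[OF bound]]])
    from tendsto_add[OF this \<psi>] show "(\<lambda>n. blinfun_apply (G n) (vs n)) \<longlonglongrightarrow> L" by simp
  qed
qed

text \<open>
  Between points of equal sign the function is linear. If \<open>x\<close> and \<open>y = x + h\<close> have opposite
  signs, the deviation from the chord is at most \<open>(1 - r) * \<bar>x\<bar>\<close> and at most \<open>r * \<bar>y\<bar>\<close>; averaging
  these with the weights \<open>r\<close> and \<open>1 - r\<close> gives \<open>r * (1 - r) * \<bar>h\<bar>\<close>, and \<open>\<bar>x\<bar> \<le> \<bar>h\<bar>\<close> supplies the
  second factor \<open>\<bar>h\<bar>\<close>. At \<open>x = 0\<close> the constant \<open>1 / \<bar>x\<bar>\<close> is \<open>0\<close>, which is right because the function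
  is positively homogeneous.
\<close>
lemma ray_quadratic_max: "ray_quadratic (\<lambda>x::real. max 0 x)"
  unfolding ray_quadratic_def
proof
  fix x :: real
  let ?T = "\<lambda>h r. max 0 (x + r * h) - max 0 x - r * (max 0 (x + h) - max 0 x)"
  have T: "\<bar>?T h r\<bar> \<le> 1 / \<bar>x\<bar> * (r * (1 - r)) * \<bar>h\<bar>\<^sup>2" if r: "0 \<le> r" "r \<le> 1" for h r
  proof -
    define y where "y = x + h"
    define a where "a = (1 - r) * \<bar>x\<bar>"
    define b where "b = r * \<bar>y\<bar>"
    have ab: "a \<ge> 0" "b \<ge> 0" using r by (auto simp: a_def b_def)
    have eq: "?T h r = max 0 ((1 - r) * x + r * y) - ((1 - r) * max 0 x + r * max 0 y)"
      by (simp add: y_def algebra_simps)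
    have bound: "t \<le> r * (1 - r) * (\<bar>x\<bar> + \<bar>y\<bar>)" if "t \<le> a" "t \<le> b" for t
    proof -
      have "r * t + (1 - r) * t \<le> r * a + (1 - r) * b" using that r by (intro add_mono mult_left_mono) auto
      then show ?thesis by (simp add: a_def b_def algebra_simps)
    qed
    have scale: "r * (1 - r) * \<bar>h\<bar> \<le> 1 / \<bar>x\<bar> * (r * (1 - r)) * \<bar>h\<bar>\<^sup>2" if "x \<noteq> 0" "\<bar>x\<bar> \<le> \<bar>h\<bar>"
    proof -
      have "1 \<le> \<bar>h\<bar> / \<bar>x\<bar>" using that by simp
      then have "(r * (1 - r) * \<bar>h\<bar>) * 1 \<le> (r * (1 - r) * \<bar>h\<bar>) * (\<bar>h\<bar> / \<bar>x\<bar>)"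
        using r by (intro mult_left_mono) auto
      moreover have "(r * (1 - r) * t) * (t / b) = 1 / b * (r * (1 - r)) * t\<^sup>2" for t b :: real
        by (simp add: power2_eq_square)
      ultimately show ?thesis by (simp only: mult_1_right)
    qed
    consider "x \<ge> 0" "y \<ge> 0" | "x \<le> 0" "y \<le> 0" | "x > 0" "y < 0" | "x < 0" "y > 0" by linarith
    then show ?thesis
    proof cases
      case 1
      then have "?T h r = 0" unfolding eq using r by simp
      then show ?thesis using r by simp
    next
      case 2
      have "(1 - r) * x + r * y \<le> 0" using 2 r by (intro add_nonpos_nonpos mult_nonneg_nonpos) auto
      then have "?T h r = 0" unfolding eq using 2 by simp
      then show ?thesis using r by simp
    next
      case 3
      have "?T h r = max 0 (a - b) - a" unfolding eq using 3 by (simp add: a_def b_def)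
      moreover have "\<bar>h\<bar> = \<bar>x\<bar> + \<bar>y\<bar>" using 3 by (simp add: y_def)
      ultimately have Th: "?T h r = max 0 (a - b) - a" "\<bar>h\<bar> = \<bar>x\<bar> + \<bar>y\<bar>" by auto
      from Th(1) have "\<bar>?T h r\<bar> \<le> a" "\<bar>?T h r\<bar> \<le> b" using ab by auto
      then have "\<bar>?T h r\<bar> \<le> r * (1 - r) * \<bar>h\<bar>" using bound[of "\<bar>?T h r\<bar>"] Th(2) by simp
      also have "\<dots> \<le> 1 / \<bar>x\<bar> * (r * (1 - r)) * \<bar>h\<bar>\<^sup>2" using scale Th(2) 3 by simp
      finally show ?thesis .
    next
      case 4
      have "?T h r = max 0 (b - a) - b" unfolding eq using 4 by (simp add: a_def b_def)
      moreover have "\<bar>h\<bar> = \<bar>x\<bar> + \<bar>y\<bar>" using 4 by (simp add: y_def)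
      ultimately have Th: "?T h r = max 0 (b - a) - b" "\<bar>h\<bar> = \<bar>x\<bar> + \<bar>y\<bar>" by auto
      from Th(1) have "\<bar>?T h r\<bar> \<le> a" "\<bar>?T h r\<bar> \<le> b" using ab by auto
      then have "\<bar>?T h r\<bar> \<le> r * (1 - r) * \<bar>h\<bar>" using bound[of "\<bar>?T h r\<bar>"] Th(2) by simp
      also have "\<dots> \<le> 1 / \<bar>x\<bar> * (r * (1 - r)) * \<bar>h\<bar>\<^sup>2" using scale Th(2) 4 by simp
      finally show ?thesis .
    qed
  qed
  show "\<exists>C\<ge>0. \<forall>h. \<forall>r\<in>{0..1}.
     norm (max 0 (x + r *\<^sub>R h) - max 0 x - r *\<^sub>R (max 0 (x + h) - max 0 x)) \<le> C * (r * (1 - r)) * (norm h)\<^sup>2"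
  proof (intro exI[of _ "1 / \<bar>x\<bar>"] conjI allI ballI)
    fix h r :: real assume "r \<in> {0..1}"
    then show "norm (max 0 (x + r *\<^sub>R h) - max 0 x - r *\<^sub>R (max 0 (x + h) - max 0 x)) \<le> 1 / \<bar>x\<bar> * (r * (1 - r)) * (norm h)\<^sup>2"
      using T[of r h] unfolding real_scaleR_def real_norm_def by simp
  qed simp
qed

section \<open>Convex functions with tame gradients\<close>

text \<open>
  The regularity that the energy has in the displacement, in a form that is stable under the
  operations that build it: the gradient field \<open>F\<close> is Lipschitz and ray-quadratic, and the first
  order Taylor remainder lies between \<open>0\<close> (convexity) and a quadratic function. The constant is
  explicit because it has to be uniform in the damage variable.
\<close>
definition tame_convex :: "real \<Rightarrow> ('a::euclidean_space \<Rightarrow> real) \<Rightarrow> ('a \<Rightarrow> 'a) \<Rightarrow> bool" where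
  "tame_convex L f F \<longleftrightarrow> L-lipschitz_on UNIV F \<and> ray_quadratic F \<and>
     (\<forall>x y. 0 \<le> f y - f x - F x \<bullet> (y - x) \<and> f y - f x - F x \<bullet> (y - x) \<le> L * (norm (y - x))\<^sup>2)"

lemma tame_convexI:
  assumes "L-lipschitz_on UNIV F" "ray_quadratic F"
    "\<And>x y. 0 \<le> f y - f x - F x \<bullet> (y - x)"
    "\<And>x y. f y - f x - F x \<bullet> (y - x) \<le> L * (norm (y - x))\<^sup>2"
  shows "tame_convex L f F"
  using assms by (auto simp: tame_convex_def)

lemma tame_convex_nonneg: "tame_convex L f F \<Longrightarrow> 0 \<le> L"
  unfolding tame_convex_def using lipschitz_on_nonneg by blast

lemma tame_convex_mono:
  assumes "tame_convex L f F" "L \<le> M"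
  shows "tame_convex M f F"
proof (rule tame_convexI)
  show "M-lipschitz_on UNIV F" using assms by (auto simp: tame_convex_def intro: lipschitz_on_le)
  show "ray_quadratic F" using assms by (simp add: tame_convex_def)
  fix x y
  show "0 \<le> f y - f x - F x \<bullet> (y - x)" using assms by (simp add: tame_convex_def)
  have "f y - f x - F x \<bullet> (y - x) \<le> L * (norm (y - x))\<^sup>2" using assms by (simp add: tame_convex_def)
  also have "\<dots> \<le> M * (norm (y - x))\<^sup>2" using assms by (intro mult_right_mono) auto
  finally show "f y - f x - F x \<bullet> (y - x) \<le> M * (norm (y - x))\<^sup>2" .
qed

lemma tame_convex_affine:
  fixes a :: "'a::euclidean_space"
  shows "tame_convex 0 (\<lambda>x. a \<bullet> x + c) (\<lambda>_. a)"
proof -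
  have "ray_quadratic (\<lambda>x. (\<lambda>_::'a. 0::'a) x + a)" by (rule ray_quadratic_affine) (rule linear_zero)
  then show ?thesis
    unfolding tame_convex_def by (auto simp: lipschitz_on_def inner_diff_right)
qed

lemma tame_convex_add:
  assumes "tame_convex L f F" "tame_convex M g G"
  shows "tame_convex (L + M) (\<lambda>x. f x + g x) (\<lambda>x. F x + G x)"
proof (rule tame_convexI)
  show "(L + M)-lipschitz_on UNIV (\<lambda>x. F x + G x)"
    using assms by (intro lipschitz_on_add) (auto simp: tame_convex_def)
  show "ray_quadratic (\<lambda>x. F x + G x)"
    using assms by (intro ray_quadratic_add) (auto simp: tame_convex_def)
next
  fix x y
  have "0 \<le> f y - f x - F x \<bullet> (y - x)" "0 \<le> g y - g x - G x \<bullet> (y - x)"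
    "f y - f x - F x \<bullet> (y - x) \<le> L * (norm (y - x))\<^sup>2" "g y - g x - G x \<bullet> (y - x) \<le> M * (norm (y - x))\<^sup>2"
    using assms by (auto simp: tame_convex_def)
  then show "0 \<le> f y + g y - (f x + g x) - (F x + G x) \<bullet> (y - x)"
    "f y + g y - (f x + g x) - (F x + G x) \<bullet> (y - x) \<le> (L + M) * (norm (y - x))\<^sup>2"
    by (auto simp: algebra_simps inner_add_left)
qed

lemma tame_convex_scale:
  assumes "tame_convex L f F" "0 \<le> a"
  shows "tame_convex (a * L) (\<lambda>x. a * f x) (\<lambda>x. a *\<^sub>R F x)"
proof (rule tame_convexI)
  show "(a * L)-lipschitz_on UNIV (\<lambda>x. a *\<^sub>R F x)"
    using assms lipschitz_on_cmult[of L UNIV F a] by (auto simp: tame_convex_def)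
  show "ray_quadratic (\<lambda>x. a *\<^sub>R F x)"
    using assms ray_quadratic_linear_comp[of F "\<lambda>x. a *\<^sub>R x" "\<lambda>x. x"]
    by (auto simp: tame_convex_def bounded_linear_scaleR_right bounded_linear_ident)
next
  fix x y
  have *: "a * f y - a * f x - (a *\<^sub>R F x) \<bullet> (y - x) = a * (f y - f x - F x \<bullet> (y - x))"
    by (simp add: algebra_simps)
  have "0 \<le> f y - f x - F x \<bullet> (y - x)" "f y - f x - F x \<bullet> (y - x) \<le> L * (norm (y - x))\<^sup>2"
    using assms by (auto simp: tame_convex_def)
  with assms(2) show "0 \<le> a * f y - a * f x - (a *\<^sub>R F x) \<bullet> (y - x)"
    "a * f y - a * f x - (a *\<^sub>R F x) \<bullet> (y - x) \<le> a * L * (norm (y - x))\<^sup>2"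
    unfolding * mult.assoc by (auto intro!: mult_left_mono)
qed

lemma tame_convex_sum:
  fixes f :: "'i \<Rightarrow> 'a::euclidean_space \<Rightarrow> real"
  assumes "finite I" "\<And>i. i \<in> I \<Longrightarrow> tame_convex (L i) (f i) (F i)"
  shows "tame_convex (\<Sum>i\<in>I. L i) (\<lambda>x. \<Sum>i\<in>I. f i x) (\<lambda>x. \<Sum>i\<in>I. F i x)"
  using assms
proof (induction I rule: finite_induct)
  case empty
  then show ?case using tame_convex_affine[of "0::'a" 0] by simp
next
  case (insert i I)
  then show ?case using tame_convex_add[of "L i" "f i" "F i" "sum L I" "\<lambda>x. \<Sum>i\<in>I. f i x" "\<lambda>x. \<Sum>i\<in>I. F i x"] by simp
qed

lemma tame_convex_linear_comp:
  fixes B :: "'a::euclidean_space \<Rightarrow> 'b::euclidean_space"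
  assumes f: "tame_convex L f F" and B: "linear B"
  shows "tame_convex ((onorm B)\<^sup>2 * L) (\<lambda>x. f (B x)) (\<lambda>x. adjoint B (F (B x)))"
proof (rule tame_convexI)
  have bl: "bounded_linear B" using B by (simp add: linear_conv_bounded_linear)
  have L: "L \<ge> 0" using f by (rule tame_convex_nonneg)
  have adj: "norm (adjoint B z) \<le> onorm B * norm z" for z
  proof -
    have "(norm (adjoint B z))\<^sup>2 = z \<bullet> B (adjoint B z)"
      by (metis B adjoint_clauses(2) dot_square_norm inner_commute)
    also have "\<dots> \<le> norm z * norm (B (adjoint B z))" by (rule norm_cauchy_schwarz)
    also have "\<dots> \<le> norm z * (onorm B * norm (adjoint B z))" using onorm[OF bl] by (intro mult_left_mono) auto
    finally have "norm (adjoint B z) * norm (adjoint B z) \<le> (onorm B * norm z) * norm (adjoint B z)"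
      by (simp add: power2_eq_square mult_ac)
    then show ?thesis
      using onorm_pos_le[OF bl] by (cases "adjoint B z = 0") auto
  qed
  have linadj: "linear (adjoint B)" using B by (rule adjoint_linear)
  show "((onorm B)\<^sup>2 * L)-lipschitz_on UNIV (\<lambda>x. adjoint B (F (B x)))"
  proof (rule lipschitz_onI)
    fix x y
    have "dist (adjoint B (F (B x))) (adjoint B (F (B y))) = norm (adjoint B (F (B x) - F (B y)))"
      by (simp add: dist_norm linear_diff[OF linadj])
    also have "\<dots> \<le> onorm B * norm (F (B x) - F (B y))" by (rule adj)
    also have "\<dots> \<le> onorm B * (L * norm (B x - B y))"
      using f onorm_pos_le[OF bl] unfolding tame_convex_def lipschitz_on_def dist_norm by (intro mult_left_mono) auto
    also have "\<dots> = onorm B * (L * norm (B (x - y)))" by (simp add: linear_diff[OF B])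
    also have "\<dots> \<le> onorm B * (L * (onorm B * norm (x - y)))"
      using L onorm_pos_le[OF bl] onorm[OF bl] by (intro mult_left_mono) auto
    finally show "dist (adjoint B (F (B x))) (adjoint B (F (B y))) \<le> (onorm B)\<^sup>2 * L * dist x y"
      by (simp add: power2_eq_square dist_norm algebra_simps)
  qed (use L in simp)
  show "ray_quadratic (\<lambda>x. adjoint B (F (B x)))"
    using ray_quadratic_linear_comp[of F "adjoint B" B] f linadj bl
    by (simp add: tame_convex_def linear_conv_bounded_linear[symmetric])
next
  fix x y
  have bl: "bounded_linear B" using B by (simp add: linear_conv_bounded_linear)
  have *: "f (B y) - f (B x) - adjoint B (F (B x)) \<bullet> (y - x) = f (B y) - f (B x) - F (B x) \<bullet> (B y - B x)"
    by (metis B adjoint_clauses(2) linear_diff)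
  have "norm (B y - B x) \<le> onorm B * norm (y - x)"
    using onorm[OF bl, of "y - x"] by (simp add: linear_diff[OF B])
  then have "(norm (B y - B x))\<^sup>2 \<le> (onorm B * norm (y - x))\<^sup>2" by (intro power_mono) auto
  then have "L * (norm (B y - B x))\<^sup>2 \<le> L * (onorm B * norm (y - x))\<^sup>2"
    using tame_convex_nonneg[OF f] by (intro mult_left_mono)
  moreover have "0 \<le> f (B y) - f (B x) - F (B x) \<bullet> (B y - B x)"
      "f (B y) - f (B x) - F (B x) \<bullet> (B y - B x) \<le> L * (norm (B y - B x))\<^sup>2"
    using f by (auto simp: tame_convex_def)
  ultimately show "0 \<le> f (B y) - f (B x) - adjoint B (F (B x)) \<bullet> (y - x)"
    "f (B y) - f (B x) - adjoint B (F (B x)) \<bullet> (y - x) \<le> (onorm B)\<^sup>2 * L * (norm (y - x))\<^sup>2"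
    unfolding * by (auto simp: power_mult_distrib algebra_simps)
qed

lemma tame_convex_GDERIV:
  assumes "tame_convex L f F"
  shows "GDERIV f x :> F x"
  unfolding gderiv_def has_derivative_at_alt
proof (intro conjI allI impI)
  show "bounded_linear (\<lambda>h. h \<bullet> F x)" by (rule bounded_linear_inner_left)
  fix e :: real assume "e > 0"
  have L: "L \<ge> 0" using assms by (rule tame_convex_nonneg)
  have bound: "0 \<le> f y - f x - F x \<bullet> (y - x)" "f y - f x - F x \<bullet> (y - x) \<le> L * (norm (y - x))\<^sup>2" for y
    using assms by (simp_all add: tame_convex_def)
  show "\<exists>d>0. \<forall>y. norm (y - x) < d \<longrightarrow> norm (f y - f x - (y - x) \<bullet> F x) \<le> e * norm (y - x)"
  proof (intro exI[of _ "e / (L + 1)"] conjI allI impI)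
    show "e / (L + 1) > 0" using L \<open>e > 0\<close> by simp
    fix y assume "norm (y - x) < e / (L + 1)"
    then have "(L + 1) * norm (y - x) \<le> e" using L by (simp add: field_simps)
    then have "L * norm (y - x) \<le> e" using norm_ge_zero[of "y - x"] unfolding distrib_right mult_1 by linarith
    then have "L * (norm (y - x))\<^sup>2 \<le> e * norm (y - x)"
      unfolding power2_eq_square mult.assoc[symmetric] by (rule mult_right_mono) simp
    then show "norm (f y - f x - (y - x) \<bullet> F x) \<le> e * norm (y - x)"
      using bound[of y] by (simp add: inner_commute[of "y - x"])
  qed
qed

lemma grad_eqI: "GDERIV f x :> D \<Longrightarrow> grad f x = D"
  unfolding grad_def
proof (rule the_equality)
  fix E assume "GDERIV f x :> D" "GDERIV f x :> E"
  then have "(\<lambda>h. h \<bullet> D) = (\<lambda>h. h \<bullet> E)" unfolding gderiv_def by (rule has_derivative_unique)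
  then show "E = D" by (metis vector_eq_ldot)
qed

lemma tame_convex_grad: "tame_convex L f F \<Longrightarrow> grad f = F"
  using grad_eqI[OF tame_convex_GDERIV] by blast

lemma tame_convex_C11: "tame_convex L f F \<Longrightarrow> C11 f"
  unfolding C11_def
proof (intro conjI allI)
  assume t: "tame_convex L f F"
  show "f differentiable at x" for x
    using tame_convex_GDERIV[OF t, of x] unfolding gderiv_def differentiable_def by blast
  show "locally_lipschitz (grad f)"
    using t unfolding tame_convex_grad[OF t] locally_lipschitz_def tame_convex_def
    by (meson lipschitz_on_subset subset_UNIV zero_less_one)
qed

lemma tame_convex_semismooth: "tame_convex L f F \<Longrightarrow> semismooth (grad f)"
  using ray_quadratic_imp_semismooth tame_convex_grad unfolding tame_convex_def by metis

lemma tame_convex_convex: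
  fixes f :: "'a::euclidean_space \<Rightarrow> real"
  shows "tame_convex L f F \<Longrightarrow> convex_on UNIV f"
proof (rule convex_onI)
  fix t :: real and x y :: 'a
  assume t: "tame_convex L f F" "0 < t" "t < 1"
  define z where "z = (1 - t) *\<^sub>R x + t *\<^sub>R y"
  have "0 \<le> f w - f z - F z \<bullet> (w - z)" for w
    using t(1) by (simp add: tame_convex_def)
  from this[of x] this[of y] have "f z + F z \<bullet> (x - z) \<le> f x" "f z + F z \<bullet> (y - z) \<le> f y"
    by simp_all
  then have "(1 - t) * (f z + F z \<bullet> (x - z)) + t * (f z + F z \<bullet> (y - z)) \<le> (1 - t) * f x + t * f y"
    using t by (intro add_mono mult_left_mono) auto
  moreover have "(1 - t) * (f z + F z \<bullet> (x - z)) + t * (f z + F z \<bullet> (y - z))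
      = f z + F z \<bullet> ((1 - t) *\<^sub>R (x - z) + t *\<^sub>R (y - z))"
    by (simp add: algebra_simps inner_add_right)
  moreover have "(1 - t) *\<^sub>R (x - z) + t *\<^sub>R (y - z) = 0" by (simp add: z_def algebra_simps)
  ultimately show "f ((1 - t) *\<^sub>R x + t *\<^sub>R y) \<le> (1 - t) * f x + t * f y" by (simp add: z_def)
qed simp

section \<open>Spectral functions of symmetric matrices\<close>

definition orthonormal_family :: "('i \<Rightarrow> 'a::real_inner) \<Rightarrow> bool" where
  "orthonormal_family u \<longleftrightarrow> (\<forall>i j. u i \<bullet> u j = (if i = j then 1 else 0))"

definition eigenbasis :: "real^'m^'m \<Rightarrow> ('m \<Rightarrow> real) \<Rightarrow> ('m \<Rightarrow> real^'m) \<Rightarrow> bool" where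
  "eigenbasis A lam u \<longleftrightarrow> orthonormal_family u \<and> (\<forall>i. A *v u i = lam i *\<^sub>R u i)"

lemma orthonormal_family_orthogonal_matrix:
  fixes u :: "'m::finite \<Rightarrow> real^'m"
  assumes "orthonormal_family u"
  shows "orthogonal_matrix (\<chi> i. u i)"
  using assms unfolding orthogonal_matrix_orthonormal_rows orthonormal_family_def
  by (auto simp: row_def orthogonal_def norm_eq_1 vec_lambda_eta)

lemma parseval:
  fixes u :: "'m::finite \<Rightarrow> real^'m"
  assumes "orthonormal_family u"
  shows "x \<bullet> y = (\<Sum>i\<in>UNIV. (u i \<bullet> x) * (u i \<bullet> y))"
proof -
  define Q where "Q = (\<chi> i. u i)"
  have "orthogonal_transformation ((*v) Q)"
    using orthonormal_family_orthogonal_matrix[OF assms]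
    by (simp add: orthogonal_transformation_matrix Q_def)
  then have "x \<bullet> y = (Q *v x) \<bullet> (Q *v y)" by (simp add: orthogonal_transformation_def)
  also have "\<dots> = (\<Sum>i\<in>UNIV. (u i \<bullet> x) * (u i \<bullet> y))"
    by (subst inner_vec_def) (simp add: matrix_vector_mul_component Q_def)
  finally show ?thesis .
qed

lemma inner_symmetric_matrix:
  fixes A :: "real^'m^'m"
  assumes "transpose A = A"
  shows "(A *v x) \<bullet> y = x \<bullet> (A *v y)"
  using dot_lmul_matrix[of x A y] assms by (simp add: vector_transpose_matrix[symmetric])

text \<open>
  A maximizer \<open>x\<close> of the Rayleigh quotient on the unit sphere of \<open>S\<close> satisfies
  \<open>y \<bullet> (A *v x) = l * (y \<bullet> x)\<close> for every \<open>y\<close> in \<open>S\<close>, because the first variation vanishes. As \<open>S\<close>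
  is invariant, \<open>A *v x - l *\<^sub>R x\<close> itself is such a \<open>y\<close>, so \<open>x\<close> is an eigenvector; the induction
  continues on its orthogonal complement in \<open>S\<close>.
\<close>
lemma orthonormal_eigenvectors:
  fixes A :: "real^'m^'m"
  assumes sym: "transpose A = A"
  shows "subspace S \<Longrightarrow> (\<And>x. x \<in> S \<Longrightarrow> A *v x \<in> S) \<Longrightarrow> dim S = n \<Longrightarrow>
    \<exists>B\<subseteq>S. finite B \<and> card B = n \<and> (\<forall>x\<in>B. norm x = 1 \<and> (\<exists>l. A *v x = l *\<^sub>R x)) \<and>
      pairwise orthogonal B"
proof (induction n arbitrary: S)
  case 0
  then show ?case by (intro exI[of _ "{}"]) auto
next
  case (Suc n)
  define K where "K = S \<inter> sphere 0 1"
  have "\<exists>z\<in>S. z \<noteq> 0"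
    using Suc.prems(3) dim_subset[of S "{0}"] by (auto simp: dim_eq_0)
  then obtain z where z: "z \<in> S" "z \<noteq> 0" by blast
  then have "(1 / norm z) *\<^sub>R z \<in> K" using Suc.prems(1) by (auto simp: K_def subspace_scale)
  moreover have "compact K"
    unfolding K_def by (rule closed_Int_compact[OF closed_subspace[OF Suc.prems(1)] compact_sphere])
  moreover have "continuous_on K (\<lambda>x. x \<bullet> (A *v x))" by (intro continuous_intros)
  ultimately obtain x where x: "x \<in> K" and max: "\<And>y. y \<in> K \<Longrightarrow> y \<bullet> (A *v y) \<le> x \<bullet> (A *v x)"
    using continuous_attains_sup[of K "\<lambda>x. x \<bullet> (A *v x)"] by auto
  define l where "l = x \<bullet> (A *v x)"
  have xS: "x \<in> S" and nx: "norm x = 1" and xx: "x \<bullet> x = 1" using x by (auto simp: K_def norm_eq_1)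
  have rayleigh: "y \<bullet> (A *v y) \<le> l * (y \<bullet> y)" if "y \<in> S" for y
  proof (cases "y = 0")
    case False
    then have "(1 / norm y) *\<^sub>R y \<in> K" using that Suc.prems(1) by (auto simp: K_def subspace_scale)
    from max[OF this] have "(1 / norm y)\<^sup>2 * (y \<bullet> (A *v y)) \<le> l"
      by (simp add: l_def matrix_vector_mult_scaleR power2_eq_square)
    then show ?thesis using False by (simp add: field_simps power2_norm_eq_inner)
  qed simp
  have orth: "y \<bullet> (A *v x) = l * (y \<bullet> x)" if y: "y \<in> S" for y
  proof -
    have q: "2 * t * (y \<bullet> (A *v x) - l * (y \<bullet> x)) \<le> t\<^sup>2 * (l * (y \<bullet> y) - y \<bullet> (A *v y))" for t
    proof -
      have "x + t *\<^sub>R y \<in> S" using xS y Suc.prems(1) by (simp add: subspace_add subspace_scale)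
      from rayleigh[OF this] show ?thesis
        using inner_symmetric_matrix[OF sym, of x y]
        by (simp add: matrix_vector_right_distrib matrix_vector_mult_scaleR inner_add_left inner_add_right
            l_def[symmetric] xx inner_commute power2_eq_square algebra_simps)
    qed
    define b where "b = y \<bullet> (A *v x) - l * (y \<bullet> x)"
    define c where "c = l * (y \<bullet> y) - y \<bullet> (A *v y)"
    have "c \<ge> 0" using rayleigh[OF y] by (simp add: c_def)
    \<comment> \<open>Inserting this \<open>t\<close> in \<open>2 t b \<le> t\<^sup>2 c\<close> forces \<open>b = 0\<close>; adding \<open>1\<close> avoids division by zero.\<close>
    define t where "t = b / (c + 1)"
    have bt: "b = t * (c + 1)" using \<open>c \<ge> 0\<close> by (simp add: t_def)
    have "2 * t * b \<le> t\<^sup>2 * c" using q[of t] by (simp add: b_def c_def)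
    then have "(2 * t * b) * (c + 1)\<^sup>2 \<le> (t\<^sup>2 * c) * (c + 1)\<^sup>2" by (rule mult_right_mono) simp
    also have "(t\<^sup>2 * c) * (c + 1)\<^sup>2 = b\<^sup>2 * c" by (simp add: bt power2_eq_square)
    also have "(2 * t * b) * (c + 1)\<^sup>2 = 2 * b\<^sup>2 * (c + 1)" by (simp add: bt power2_eq_square)
    finally have "2 * b\<^sup>2 * (c + 1) \<le> b\<^sup>2 * c" .
    then have "b\<^sup>2 * (c + 2) \<le> 0" by (simp add: algebra_simps)
    then have "b = 0" using \<open>c \<ge> 0\<close> by (simp add: mult_le_0_iff)
    then show ?thesis by (simp add: b_def)
  qed
  have "A *v x - l *\<^sub>R x \<in> S" using xS Suc.prems(1,2) by (simp add: subspace_diff subspace_scale)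
  from orth[OF this] have "(A *v x - l *\<^sub>R x) \<bullet> (A *v x - l *\<^sub>R x) = 0"
    by (simp add: inner_diff_right)
  then have eig: "A *v x = l *\<^sub>R x" by simp
  define T where "T = S \<inter> {y. orthogonal x y}"
  have T: "subspace T" unfolding T_def
    using Suc.prems(1) by (intro subspace_inter) (auto simp: subspace_orthogonal_to_vector)
  have invT: "A *v y \<in> T" if "y \<in> T" for y
    using that Suc.prems(2) inner_symmetric_matrix[OF sym, of x y]
    by (auto simp: T_def orthogonal_def eig)
  have "dim T = n"
  proof -
    have sp: "span {x} \<subseteq> S" using xS Suc.prems(1) by (simp add: span_minimal)
    have "T = {y \<in> S. \<forall>z \<in> span {x}. orthogonal z y}"
      unfolding T_def by (auto simp: span_singleton orthogonal_def)
    then show ?thesis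
      using dim_subspace_orthogonal_to_vectors[of "span {x}" S] sp Suc.prems nx
      by (auto simp: dim_singleton split: if_splits)
  qed
  from Suc.IH[OF T invT this] obtain B where B: "B \<subseteq> T" "finite B" "card B = n"
     "\<forall>x\<in>B. norm x = 1 \<and> (\<exists>l. A *v x = l *\<^sub>R x)" "pairwise orthogonal B" by blast
  have "x \<notin> B" using B(1) nx by (auto simp: T_def orthogonal_def)
  show ?case
  proof (intro exI[of _ "insert x B"] conjI)
    show "pairwise orthogonal (insert x B)"
      using B(1,5) by (auto simp: pairwise_insert T_def orthogonal_commute)
  qed (use B xS nx eig \<open>x \<notin> B\<close> in \<open>auto simp: T_def\<close>)
qed

theorem spectral_theorem:
  fixes A :: "real^'m^'m"
  assumes sym: "transpose A = A"
  obtains lam u where "eigenbasis A lam u"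
proof -
  obtain B where B: "finite B" "card B = CARD('m)" "\<And>x. x \<in> B \<Longrightarrow> norm x = 1"
    "\<And>x. x \<in> B \<Longrightarrow> \<exists>l. A *v x = l *\<^sub>R x" "pairwise orthogonal B"
    using orthonormal_eigenvectors[OF sym, of UNIV "CARD('m)"] by auto
  obtain u where u: "bij_betw u (UNIV :: 'm set) B"
    using finite_same_card_bij[of "UNIV :: 'm set" B] B by auto
  have uB: "u i \<in> B" for i using u by (auto simp: bij_betw_def)
  have "\<forall>i. \<exists>l. A *v u i = l *\<^sub>R u i" using B(4) uB by blast
  then obtain lam where lam: "\<And>i. A *v u i = lam i *\<^sub>R u i" by metis
  have "u i \<bullet> u j = (if i = j then 1 else 0)" for i j
  proof (cases "i = j")
    case True
    then show ?thesis using B(3)[OF uB[of i]] by (simp add: norm_eq_1)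
  next
    case False
    then have "u i \<noteq> u j" using u by (auto simp: bij_betw_def inj_on_def)
    then show ?thesis using B(5) uB False by (auto simp: pairwise_def orthogonal_def)
  qed
  then have "eigenbasis A lam u" using lam by (auto simp: eigenbasis_def orthonormal_family_def)
  then show ?thesis by (rule that)
qed

lemma eigenbasis_symmetric:
  fixes A :: "real^'m^'m"
  assumes "eigenbasis A lam u"
  shows "transpose A = A"
proof -
  have exp: "(A *v x) \<bullet> y = (\<Sum>i\<in>UNIV. lam i * (u i \<bullet> x) * (u i \<bullet> y))" for x y
  proof -
    have on: "orthonormal_family u" using assms by (simp add: eigenbasis_def)
    have "x = (\<Sum>i\<in>UNIV. (u i \<bullet> x) *\<^sub>R u i)"
    proof (rule vector_eq_rdot[THEN iffD1, rule_format])
      fix z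
      show "x \<bullet> z = (\<Sum>i\<in>UNIV. (u i \<bullet> x) *\<^sub>R u i) \<bullet> z"
        by (simp add: inner_sum_left parseval[OF on, of x z])
    qed
    then have "A *v x = A *v (\<Sum>i\<in>UNIV. (u i \<bullet> x) *\<^sub>R u i)" by simp
    also have "\<dots> = (\<Sum>i\<in>UNIV. ((u i \<bullet> x) * lam i) *\<^sub>R u i)"
      using assms by (simp add: linear_sum[OF matrix_vector_mul_linear] o_def matrix_vector_mult_scaleR eigenbasis_def)
    finally show ?thesis by (simp add: inner_sum_left mult_ac)
  qed
  have "(A *v x) \<bullet> y = x \<bullet> (A *v y)" for x y
    unfolding inner_commute[of x] exp[of x y] exp[of y x] by (simp add: mult_ac)
  moreover have "(transpose A *v x) \<bullet> y = x \<bullet> (A *v y)" for x y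
    by (simp only: transpose_matrix_vector dot_lmul_matrix)
  ultimately have "(transpose A *v x) \<bullet> y = (A *v x) \<bullet> y" for x y by simp
  then have "transpose A *v x = A *v x" for x by (metis vector_eq_rdot)
  then show ?thesis by (simp add: matrix_eq)
qed

lemma eigenbasis_inner:
  fixes A :: "real^'m^'m"
  assumes "eigenbasis A lam u"
  shows "u i \<bullet> (A *v x) = lam i * (u i \<bullet> x)" "(A *v x) \<bullet> u i = lam i * (x \<bullet> u i)"
proof -
  have "u i \<bullet> (A *v x) = (A *v u i) \<bullet> x"
    using inner_symmetric_matrix[OF eigenbasis_symmetric[OF assms]] by simp
  then show "u i \<bullet> (A *v x) = lam i * (u i \<bullet> x)" using assms by (simp add: eigenbasis_def)
  then show "(A *v x) \<bullet> u i = lam i * (x \<bullet> u i)" by (simp add: inner_commute)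
qed

lemma matrix_inner_orthonormal:
  fixes M :: "real^'m^'m" and w :: "'m \<Rightarrow> real^'m"
  assumes w: "orthonormal_family w"
  shows "M \<bullet> M' = (\<Sum>j\<in>UNIV. (M *v w j) \<bullet> (M' *v w j))"
proof -
  have "M \<bullet> M' = (\<Sum>k\<in>UNIV. \<Sum>j\<in>UNIV. (w j \<bullet> M $ k) * (w j \<bullet> M' $ k))"
    unfolding inner_vec_def[of M] by (intro sum.cong refl parseval w)
  also have "\<dots> = (\<Sum>j\<in>UNIV. \<Sum>k\<in>UNIV. (w j \<bullet> M $ k) * (w j \<bullet> M' $ k))" by (rule sum.swap)
  also have "\<dots> = (\<Sum>j\<in>UNIV. (M *v w j) \<bullet> (M' *v w j))"
    unfolding inner_vec_def[of "M *v _"] by (simp add: matrix_vector_mul_component inner_commute)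
  finally show ?thesis .
qed

text \<open>
  The Frobenius product may be evaluated in two different orthonormal bases, one on each side of
  the matrices. With eigenbases of two matrices this makes both of them diagonal at once, which
  takes the place of a perturbation theory for eigenvectors.
\<close>
lemma matrix_inner_orthonormal2:
  fixes M :: "real^'m^'m" and u w :: "'m \<Rightarrow> real^'m"
  assumes u: "orthonormal_family u" and w: "orthonormal_family w"
  shows "M \<bullet> M' = (\<Sum>j\<in>UNIV. \<Sum>i\<in>UNIV. (u i \<bullet> (M *v w j)) * (u i \<bullet> (M' *v w j)))"
  unfolding matrix_inner_orthonormal[OF w] parseval[OF u, of "M *v _"] ..

lemma matrix_norm_orthonormal2:
  fixes M :: "real^'m^'m" and u w :: "'m \<Rightarrow> real^'m"
  assumes u: "orthonormal_family u" and w: "orthonormal_family w"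
  shows "(norm M)\<^sup>2 = (\<Sum>j\<in>UNIV. \<Sum>i\<in>UNIV. (u i \<bullet> (M *v w j))\<^sup>2)"
  unfolding power2_norm_eq_inner matrix_inner_orthonormal2[OF u w] by (simp add: power2_eq_square)

lemma norm_matrix_orthonormal_le:
  fixes M :: "real^'m^'m" and w :: "'m \<Rightarrow> real^'m"
  assumes w: "orthonormal_family w"
  shows "norm (M *v w j) \<le> norm M"
proof -
  have "(norm (M *v w j))\<^sup>2 \<le> (\<Sum>j\<in>UNIV. (norm (M *v w j))\<^sup>2)"
    by (rule member_le_sum) auto
  also have "\<dots> = (norm M)\<^sup>2"
    by (simp add: power2_norm_eq_inner matrix_inner_orthonormal[OF w])
  finally show ?thesis by (simp add: power2_le_iff_abs_le)
qed

text \<open>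
  The eigenbasis is chosen before \<open>f\<close> enters, so one and the same basis diagonalizes
  \<open>spectral_map f A\<close> for all \<open>f\<close>. The value is meaningful for symmetric \<open>A\<close>.
\<close>
definition spectral_map :: "(real \<Rightarrow> real) \<Rightarrow> real^'m^'m \<Rightarrow> real^'m^'m" where
  "spectral_map f A =
     (case (SOME (lam, u). eigenbasis A lam u) of (lam, u) \<Rightarrow>
        matrix (\<lambda>x. \<Sum>i\<in>UNIV. (f (lam i) * (u i \<bullet> x)) *\<^sub>R u i))"

lemma spectral_map_eigenbasis:
  fixes A :: "real^'m^'m"
  assumes "transpose A = A"
  obtains lam u where "eigenbasis A lam u" "\<And>f. eigenbasis (spectral_map f A) (f \<circ> lam) u"
proof -
  obtain lam u where lu: "(lam, u) = (SOME (lam, u). eigenbasis A lam u)" by (metis surj_pair)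
  have eb: "eigenbasis A lam u"
    using spectral_theorem[OF assms] someI[of "\<lambda>(lam, u). eigenbasis A lam u"] unfolding lu[symmetric]
    by (metis (mono_tags, lifting) case_prod_conv lu)
  then have on: "u i \<bullet> u j = (if i = j then 1 else 0)" for i j
    by (simp add: eigenbasis_def orthonormal_family_def)
  have "eigenbasis (spectral_map f A) (f \<circ> lam) u" for f
  proof -
    define g where "g x = (\<Sum>i\<in>UNIV. (f (lam i) * (u i \<bullet> x)) *\<^sub>R u i)" for x
    have "linear g" unfolding g_def
      by (intro linearI) (simp_all add: inner_add_right algebra_simps sum.distrib scaleR_sum_right)
    moreover have "spectral_map f A = matrix g" unfolding spectral_map_def lu[symmetric] g_def by simp
    ultimately have "spectral_map f A *v x = g x" for x by (simp add: matrix_works)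
    moreover have "g (u j) = f (lam j) *\<^sub>R u j" for j
      by (simp add: g_def on if_distrib[of "\<lambda>x. _ * x"] if_distrib[of "\<lambda>x. x *\<^sub>R _"] sum.delta cong: if_cong)
    ultimately show ?thesis using eb by (simp add: eigenbasis_def)
  qed
  with eb show ?thesis by (rule that)
qed

text \<open>
  In mixed eigenbases the difference of two matrices is an entrywise product with scalar
  differences of eigenvalues. Since \<open>spectral_map f\<close> keeps the eigenbases, inequalities between
  spectral functions reduce to inequalities between functions of one real variable.
\<close>
lemma spectral_map_mixed:
  fixes A B :: "real^'m^'m"
  assumes "eigenbasis A lam u" "eigenbasis B nu w"
  shows "u i \<bullet> ((B - A) *v w j) = (nu j - lam i) * (u i \<bullet> w j)"
proof -
  have "u i \<bullet> ((B - A) *v w j) = u i \<bullet> (B *v w j) - u i \<bullet> (A *v w j)"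
    by (simp add: matrix_vector_mult_diff_rdistrib inner_diff_right)
  also have "\<dots> = (nu j - lam i) * (u i \<bullet> w j)"
    using assms(2) by (simp add: eigenbasis_inner(1)[OF assms(1)] eigenbasis_def left_diff_distrib)
  finally show ?thesis .
qed

lemma spectral_map_lipschitz:
  fixes A B :: "real^'m^'m"
  assumes f: "\<And>x y. \<bar>f x - f y\<bar> \<le> \<bar>x - y\<bar>" and "transpose A = A" "transpose B = B"
  shows "norm (spectral_map f B - spectral_map f A) \<le> norm (B - A)"
proof -
  obtain lam u where A: "eigenbasis A lam u" "\<And>f. eigenbasis (spectral_map f A) (f \<circ> lam) u"
    using spectral_map_eigenbasis[OF assms(2)] by metis
  obtain nu w where B: "eigenbasis B nu w" "\<And>f. eigenbasis (spectral_map f B) (f \<circ> nu) w"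
    using spectral_map_eigenbasis[OF assms(3)] by metis
  have on: "orthonormal_family u" "orthonormal_family w" using A(1) B(1) by (auto simp: eigenbasis_def)
  have "(norm (spectral_map f B - spectral_map f A))\<^sup>2 \<le> (norm (B - A))\<^sup>2"
    unfolding matrix_norm_orthonormal2[OF on] spectral_map_mixed[OF A(2) B(2)] spectral_map_mixed[OF A(1) B(1)]
    using f by (intro sum_mono) (auto simp: power_mult_distrib intro!: mult_right_mono simp flip: abs_le_square_iff)
  then show ?thesis by (simp add: power2_le_iff_abs_le)
qed

text \<open>
  The squared products \<open>(u i \<bullet> w j)\<^sup>2\<close> form a doubly stochastic matrix. This turns the Taylor
  remainder of \<open>A \<mapsto> \<Sum>h(\<lambda>\<^sub>i)\<close> into the average of scalar Taylor remainders with the same weights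
  that express \<open>(norm (B - A))\<^sup>2\<close> as an average of squared eigenvalue differences.
\<close>
lemma spectral_sum_expansion:
  fixes A B :: "real^'m^'m"
  assumes A: "eigenbasis A lam u" "eigenbasis FA (f \<circ> lam) u" and B: "eigenbasis B nu w"
  shows "(\<Sum>j\<in>UNIV. h (nu j)) - (\<Sum>i\<in>UNIV. h (lam i)) - FA \<bullet> (B - A)
    = (\<Sum>j\<in>UNIV. \<Sum>i\<in>UNIV. (u i \<bullet> w j)\<^sup>2 * (h (nu j) - h (lam i) - f (lam i) * (nu j - lam i)))"
    "(norm (B - A))\<^sup>2 = (\<Sum>j\<in>UNIV. \<Sum>i\<in>UNIV. (u i \<bullet> w j)\<^sup>2 * (nu j - lam i)\<^sup>2)"
proof -
  have on: "orthonormal_family u" "orthonormal_family w" using A(1) B(1) by (auto simp: eigenbasis_def)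
  have 1: "(\<Sum>i\<in>UNIV. (u i \<bullet> w j)\<^sup>2) = 1" for j
    using parseval[OF on(1), of "w j" "w j"] on(2) by (simp add: orthonormal_family_def power2_eq_square)
  have 2: "(\<Sum>j\<in>UNIV. (u i \<bullet> w j)\<^sup>2) = 1" for i
    using parseval[OF on(2), of "u i" "u i"] on(1) by (simp add: orthonormal_family_def power2_eq_square inner_commute)
  have "(\<Sum>j\<in>UNIV. h (nu j)) = (\<Sum>j\<in>UNIV. \<Sum>i\<in>UNIV. (u i \<bullet> w j)\<^sup>2 * h (nu j))"
    by (simp add: 1 flip: sum_distrib_right)
  moreover have "(\<Sum>i\<in>UNIV. h (lam i)) = (\<Sum>j\<in>UNIV. \<Sum>i\<in>UNIV. (u i \<bullet> w j)\<^sup>2 * h (lam i))"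
    by (subst sum.swap) (simp add: 2 flip: sum_distrib_right)
  moreover have "FA \<bullet> (B - A) = (\<Sum>j\<in>UNIV. \<Sum>i\<in>UNIV. (u i \<bullet> w j)\<^sup>2 * (f (lam i) * (nu j - lam i)))"
    unfolding matrix_inner_orthonormal2[OF on] spectral_map_mixed[OF A(1) B]
    by (simp add: eigenbasis_inner(1)[OF A(2)] power2_eq_square mult_ac)
  ultimately show "(\<Sum>j\<in>UNIV. h (nu j)) - (\<Sum>i\<in>UNIV. h (lam i)) - FA \<bullet> (B - A)
    = (\<Sum>j\<in>UNIV. \<Sum>i\<in>UNIV. (u i \<bullet> w j)\<^sup>2 * (h (nu j) - h (lam i) - f (lam i) * (nu j - lam i)))"
    by (simp add: sum_subtractf right_diff_distrib)
  show "(norm (B - A))\<^sup>2 = (\<Sum>j\<in>UNIV. \<Sum>i\<in>UNIV. (u i \<bullet> w j)\<^sup>2 * (nu j - lam i)\<^sup>2)"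
    unfolding matrix_norm_orthonormal2[OF on] spectral_map_mixed[OF A(1) B]
    by (simp add: power_mult_distrib mult.commute)
qed

text \<open>
  If the columns of \<open>Q\<close> are the eigenvectors, then \<open>(x I - A) Q = Q diag(x - \<lambda>\<^sub>i)\<close> over the
  polynomial ring, and the determinant of \<open>Q\<close> is a nonzero constant that cancels.
\<close>
lemma eigenvalues_eigenbasis:
  fixes A :: "real^'m^'m"
  assumes A: "eigenbasis A lam u"
  shows "eigenvalues A = image_mset lam (mset_set UNIV)"
proof -
  define Q where "Q = (\<chi> i j. u j $ i)"
  define c where "c M = (\<chi> i j. [:M $ i $ j:])" for M :: "real^'m^'m"
  have sum_const: "(\<Sum>i\<in>S. [:f i:]) = [:\<Sum>i\<in>S. f i:]" for f :: "'b \<Rightarrow> real" and S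
    by (induction S rule: infinite_finite_induct) auto
  have prod_const: "(\<Prod>i\<in>S. [:f i:]) = [:\<Prod>i\<in>S. f i:]" for f :: "'b \<Rightarrow> real" and S
    by (induction S rule: infinite_finite_induct) (auto simp: one_pCons)
  have det_c: "det (c M) = [:det M:]" for M
  proof -
    have "of_int (sign p) * [:x:] = [:of_int (sign p) * x:]" for p :: "'m \<Rightarrow> 'm" and x :: real
      by (simp add: of_int_poly)
    then show ?thesis by (simp add: det_def c_def prod_const sum_const)
  qed
  have "orthogonal_matrix Q"
    using orthonormal_family_orthogonal_matrix[of u] A orthogonal_matrix_transpose[of "\<chi> i. u i"]
    by (simp add: eigenbasis_def Q_def transpose_def)
  then have "det Q \<noteq> 0" using det_orthogonal_matrix[of Q] by fastforce
  then have dQ: "det (c Q) \<noteq> 0" by (simp add: det_c)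
  define D where "D = (\<chi> i j. if i = j then [:- lam i, 1:] else 0)"
  have "(mat [:0, 1:] - c A) ** c Q = c Q ** D"
  proof -
    have "((mat [:0, 1:] - c A) ** c Q) $ i $ j = (c Q ** D) $ i $ j" for i j
    proof -
      have "(\<Sum>k\<in>UNIV. A $ i $ k * u j $ k) = lam j * u j $ i"
        using A by (simp add: eigenbasis_def matrix_vector_mult_def vec_eq_iff)
      moreover have "((mat [:0, 1:] - c A) ** c Q) $ i $ j
          = [:0, 1:] * [:u j $ i:] - (\<Sum>k\<in>UNIV. [:A $ i $ k * u j $ k:])"
      proof -
        have "(mat [:0, 1:] - c A) $ i $ k * c Q $ k $ j
            = (if i = k then [:0, 1:] * [:u j $ k:] else 0) - [:A $ i $ k * u j $ k:]" for k
          by (simp add: mat_def c_def Q_def left_diff_distrib)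
        then show ?thesis by (simp add: matrix_matrix_mult_def sum_subtractf sum.delta)
      qed
      moreover have "(c Q ** D) $ i $ j = [:u j $ i:] * [:- lam j, 1:]"
        by (simp add: matrix_matrix_mult_def c_def Q_def D_def if_distrib[of "\<lambda>x. _ * x"] sum.delta cong: if_cong)
      ultimately show ?thesis by (simp add: sum_const)
    qed
    then show ?thesis by (simp add: vec_eq_iff)
  qed
  then have "det (mat [:0, 1:] - c A) * det (c Q) = det (c Q) * det D" by (metis det_mul)
  then have "det (mat [:0, 1:] - c A) = det D" using dQ by (simp add: mult.commute)
  also have "\<dots> = (\<Prod>i\<in>UNIV. [:- lam i, 1:])"
    by (subst det_diagonal) (auto simp: D_def)
  finally have "eigenvalues A = proots (\<Prod>i\<in>UNIV. [:- lam i, 1:])"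
    by (simp add: eigenvalues_def c_def)
  also have "\<dots> = (\<Sum>i\<in>UNIV. {#lam i#})"
    by (subst proots_prod) auto
  also have "\<dots> = image_mset lam (mset_set UNIV)" by (simp add: sum_unfold_sum_mset image_mset.compositionality o_def)
  finally show ?thesis .
qed

corollary sum_eigenvalues:
  fixes A :: "real^'m^'m"
  assumes A: "eigenbasis A lam u"
  shows "(\<Sum>x\<in>#eigenvalues A. h x) = (\<Sum>i\<in>UNIV. h (lam i))"
  by (simp add: eigenvalues_eigenbasis[OF A] image_mset.compositionality o_def sum_unfold_sum_mset)

section \<open>The absolute value of a symmetric matrix\<close>

text \<open>
  Symmetrizing first extends a function of symmetric matrices to the whole matrix space, where
  gradients and generalized Jacobians can be taken without leaving the domain.
\<close>
definition sym_part :: "real^'m^'m \<Rightarrow> real^'m^'m" where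
  "sym_part A = (1 / 2) *\<^sub>R (A + transpose A)"

lemma transpose_linear: "transpose (A + B) = transpose A + transpose B"
  "transpose (r *\<^sub>R A) = r *\<^sub>R transpose A" for A B :: "real^'m^'n"
  by (simp_all add: transpose_def vec_eq_iff)

lemma transpose_sym_part [simp]: "transpose (sym_part A) = sym_part A"
  by (simp add: sym_part_def transpose_linear add.commute)

lemma sym_part_id: "transpose A = A \<Longrightarrow> sym_part A = A"
  by (simp add: sym_part_def flip: scaleR_2)

lemma linear_sym_part: "linear sym_part"
  by (intro linearI) (simp_all add: sym_part_def transpose_linear algebra_simps)

lemma inner_transpose: "transpose A \<bullet> transpose B = A \<bullet> B" for A B :: "real^'m^'n"
  by (simp add: inner_vec_def transpose_def) (rule sum.swap)

lemma inner_sym_part: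
  fixes F :: "real^'m^'m"
  assumes "transpose F = F"
  shows "F \<bullet> sym_part A = F \<bullet> A"
  using inner_transpose[of F A] assms by (simp add: sym_part_def inner_add_right)

lemma norm_sym_part_le: "norm (sym_part A) \<le> norm A"
proof -
  have "norm (transpose A) = norm A" by (simp add: norm_eq_sqrt_inner inner_transpose)
  then show ?thesis using norm_triangle_ineq[of A "transpose A"] by (simp add: sym_part_def)
qed

lemma matrix_eq_orthonormal:
  fixes M N :: "real^'m^'m" and w :: "'m \<Rightarrow> real^'m"
  assumes "orthonormal_family w" "\<And>j. M *v w j = N *v w j"
  shows "M = N"
proof -
  have "(M - N) *v w j = 0" for j using assms(2) by (simp add: matrix_vector_mult_diff_rdistrib)
  then have "(M - N) \<bullet> (M - N) = 0" unfolding matrix_inner_orthonormal[OF assms(1)] by simp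
  then show ?thesis by simp
qed

lemma norm_L2_set_orthonormal:
  fixes u :: "'m::finite \<Rightarrow> real^'m"
  assumes "orthonormal_family u"
  shows "norm x = L2_set (\<lambda>i. u i \<bullet> x) UNIV"
  unfolding norm_eq_sqrt_inner L2_set_def by (subst parseval[OF assms]) (simp add: power2_eq_square)

text \<open>
  An eigenvector \<open>w\<close> of \<open>W\<close> with a small eigenvalue \<open>\<nu>\<close> lies almost in the kernel of \<open>X\<close>:
  \<open>(X - \<nu>) w = (X - W) w\<close> has norm at most \<open>norm (W - X)\<close>, and every nonzero eigenvalue \<open>\<mu>\<close> of \<open>X\<close>
  satisfies \<open>\<bar>\<mu>\<bar> \<le> 2 * \<bar>\<mu> - \<nu>\<bar>\<close> by the spectral gap.
\<close>
lemma near_kernel_bound: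
  fixes X W :: "real^'m^'m"
  assumes X: "eigenbasis X mu v" and W: "eigenbasis W nu w"
    and gap: "\<And>k. mu k = 0 \<or> \<delta> \<le> \<bar>mu k\<bar>" and small: "\<bar>nu j\<bar> < \<delta> / 2"
  shows "norm (X *v w j) \<le> 2 * norm (W - X)"
proof -
  have on: "orthonormal_family v" "orthonormal_family w" using X W by (auto simp: eigenbasis_def)
  have "\<bar>mu k\<bar> \<le> 2 * \<bar>mu k - nu j\<bar>" for k
    using gap[of k] small abs_triangle_ineq[of "mu k - nu j" "nu j"] by auto
  then have mono: "\<bar>v k \<bullet> (X *v w j)\<bar> \<le> \<bar>2 * (v k \<bullet> ((W - X) *v w j))\<bar>" for k
  proof -
    have "\<bar>mu k\<bar> * \<bar>v k \<bullet> w j\<bar> \<le> 2 * \<bar>nu j - mu k\<bar> * \<bar>v k \<bullet> w j\<bar>"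
      using \<open>\<And>k. \<bar>mu k\<bar> \<le> _\<close>[of k] by (intro mult_right_mono) (auto simp: abs_minus_commute)
    then show ?thesis
      unfolding spectral_map_mixed[OF X W] eigenbasis_inner(1)[OF X] abs_mult by simp
  qed
  have "norm (X *v w j) = L2_set (\<lambda>k. \<bar>v k \<bullet> (X *v w j)\<bar>) UNIV"
    unfolding norm_L2_set_orthonormal[OF on(1)] by (simp add: L2_set_def)
  also have "\<dots> \<le> L2_set (\<lambda>k. \<bar>2 * (v k \<bullet> ((W - X) *v w j))\<bar>) UNIV"
    using mono by (intro L2_set_mono) auto
  also have "\<dots> = norm (2 *\<^sub>R ((W - X) *v w j))"
    unfolding norm_L2_set_orthonormal[OF on(1)] by (simp add: L2_set_def)
  also have "\<dots> \<le> 2 * norm (W - X)" using norm_matrix_orthonormal_le[OF on(2), of "W - X" j] by simp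
  finally show ?thesis .
qed

text \<open>
  On the spectrum of \<open>X\<close> one has \<open>\<bar>f \<mu>\<bar> \<le> \<bar>\<mu>\<bar> \<le> \<mu>\<^sup>2 / \<delta>\<close>, so the bilinear form of \<open>f X\<close> is of
  second order on vectors that \<open>X\<close> nearly annihilates.
\<close>
lemma spectral_gap_inner_bound:
  fixes X FX :: "real^'m^'m"
  assumes X: "eigenbasis X mu v" and FX: "eigenbasis FX (f \<circ> mu) v"
    and f: "\<And>x. \<bar>f x\<bar> \<le> \<bar>x\<bar>"
    and gap: "\<And>k. mu k = 0 \<or> \<delta> \<le> \<bar>mu k\<bar>" and \<delta>: "\<delta> > 0"
  shows "\<bar>a \<bullet> (FX *v b)\<bar> \<le> norm (X *v a) * norm (X *v b) / \<delta>"
proof -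
  have on: "orthonormal_family v" using X by (auto simp: eigenbasis_def)
  have summand: "\<bar>(v k \<bullet> a) * (v k \<bullet> (FX *v b))\<bar> \<le> (1 / \<delta>) * (\<bar>v k \<bullet> (X *v a)\<bar> * \<bar>v k \<bullet> (X *v b)\<bar>)" for k
  proof -
    have "\<bar>f (mu k)\<bar> \<le> (1 / \<delta>) * (\<bar>mu k\<bar> * \<bar>mu k\<bar>)"
    proof (cases "mu k = 0")
      case False
      then have "\<bar>mu k\<bar> * \<delta> \<le> \<bar>mu k\<bar> * \<bar>mu k\<bar>" using gap[of k] by (intro mult_left_mono) auto
      then have "\<bar>mu k\<bar> \<le> (1 / \<delta>) * (\<bar>mu k\<bar> * \<bar>mu k\<bar>)" using \<delta> by (simp add: field_simps)
      then show ?thesis using f[of "mu k"] by linarith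
    qed (use f[of 0] in simp)
    then have "\<bar>f (mu k)\<bar> * (\<bar>v k \<bullet> a\<bar> * \<bar>v k \<bullet> b\<bar>) \<le> (1 / \<delta>) * (\<bar>mu k\<bar> * \<bar>mu k\<bar>) * (\<bar>v k \<bullet> a\<bar> * \<bar>v k \<bullet> b\<bar>)"
      by (rule mult_right_mono) simp
    then show ?thesis
      unfolding eigenbasis_inner(1)[OF X] eigenbasis_inner(1)[OF FX] abs_mult o_apply by (simp only: mult_ac)
  qed
  have "\<bar>a \<bullet> (FX *v b)\<bar> \<le> (\<Sum>k\<in>UNIV. \<bar>(v k \<bullet> a) * (v k \<bullet> (FX *v b))\<bar>)"
    unfolding parseval[OF on, of a] by (rule sum_abs)
  also have "\<dots> \<le> (\<Sum>k\<in>UNIV. (1 / \<delta>) * (\<bar>v k \<bullet> (X *v a)\<bar> * \<bar>v k \<bullet> (X *v b)\<bar>))"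
    by (rule sum_mono) (rule summand)
  also have "\<dots> = (1 / \<delta>) * (\<Sum>k\<in>UNIV. \<bar>v k \<bullet> (X *v a)\<bar> * \<bar>v k \<bullet> (X *v b)\<bar>)"
    by (simp add: sum_distrib_left)
  also have "\<dots> \<le> (1 / \<delta>) * (norm (X *v a) * norm (X *v b))"
    unfolding norm_L2_set_orthonormal[OF on] using \<delta> by (intro mult_left_mono L2_set_mult_ineq) auto
  finally show ?thesis by simp
qed

lemma inner_matrix_orthonormal_le:
  fixes M M' :: "real^'m^'m" and u w :: "'m \<Rightarrow> real^'m"
  assumes u: "orthonormal_family u" and w: "orthonormal_family w"
    and ab: "norm M \<le> a" "norm M' \<le> b"
  shows "\<bar>(M *v u i) \<bullet> (M' *v w j)\<bar> \<le> a * b"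
proof -
  have "\<bar>(M *v u i) \<bullet> (M' *v w j)\<bar> \<le> norm (M *v u i) * norm (M' *v w j)" by (rule Cauchy_Schwarz_ineq2)
  also have "\<dots> \<le> a * b"
    using norm_matrix_orthonormal_le[OF u, of M i] norm_matrix_orthonormal_le[OF w, of M' j] ab order_trans[OF norm_ge_zero ab(1)]
    by (intro mult_mono) auto
  finally show ?thesis .
qed

text \<open>
  The heart of the semismoothness proof. In the eigenbasis \<open>u\<close> of \<open>Z\<close> and the eigenbasis \<open>w\<close> of the
  intermediate matrix \<open>W = X + r (Z - X)\<close>, the deviation of the absolute value from its chord has
  entries \<open>(1 - r) T\<close> with
  \<open>T = u \<bullet> (\<bar>Z\<bar> - \<bar>X\<bar>) w - c * (u \<bullet> (Z - X) w)\<close>, where for the eigenvalues \<open>l\<close> and \<open>n\<close> the factor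
  \<open>c = (l + n) / (\<bar>l\<bar> + \<bar>n\<bar>)\<close> is the divided difference of the absolute value.

  If \<open>\<bar>l\<bar>\<close> or \<open>\<bar>n\<bar>\<close> is at least \<open>\<delta> / 2\<close>, the identity
  \<open>(\<bar>l\<bar> + \<bar>n\<bar>) T = (\<bar>Z\<bar> - \<bar>X\<bar>) u \<bullet> (\<bar>W\<bar> - \<bar>X\<bar>) w - (Z - X) u \<bullet> (W - X) w\<close>
  bounds \<open>T\<close>, because squares of \<open>\<bar>X\<bar>\<close> and \<open>X\<close> agree. If both are smaller, \<open>u\<close> and \<open>w\<close> are nearly in
  the kernel of \<open>X\<close>, so \<open>u \<bullet> X w\<close> and \<open>u \<bullet> \<bar>X\<bar> w\<close> are of second order. What remains is
  \<open>(\<bar>l\<bar> - c l) (u \<bullet> w)\<close>. It vanishes unless \<open>l\<close> and \<open>n\<close> have opposite signs, and then it is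
  controlled by \<open>u \<bullet> X w\<close>, because \<open>W\<close> lies on the segment from \<open>X\<close> to \<open>Z\<close>.
\<close>
lemma abs_ray_entry_bound:
  fixes X Z W AX AZ AW :: "real^'m^'m"
  assumes X: "eigenbasis X mu v" "eigenbasis AX (abs \<circ> mu) v"
    and Z: "eigenbasis Z lam u" "eigenbasis AZ (abs \<circ> lam) u"
    and W: "eigenbasis W nu w" "eigenbasis AW (abs \<circ> nu) w"
    and WX: "W = X + r *\<^sub>R (Z - X)" and r: "0 \<le> r" "r \<le> 1"
    and lip: "norm (AZ - AX) \<le> norm (Z - X)" "norm (AW - AX) \<le> norm (W - X)"
    and gap: "\<And>k. mu k = 0 \<or> \<delta> \<le> \<bar>mu k\<bar>" and \<delta>: "\<delta> > 0"
  shows "\<bar>u i \<bullet> ((AW - AX - r *\<^sub>R (AZ - AX)) *v w j)\<bar> \<le> 16 / \<delta> * (r * (1 - r)) * (norm (Z - X))\<^sup>2"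
proof -
  define l where "l = lam i"
  define n where "n = nu j"
  define H where "H = norm (Z - X)"
  define p where "p = u i \<bullet> w j"
  define x where "x = u i \<bullet> (X *v w j)"
  define x' where "x' = u i \<bullet> (AX *v w j)"
  \<comment> \<open>For \<open>l = n = 0\<close> this is \<open>0\<close>, which is consistent with all uses below.\<close>
  define c where "c = (l + n) / (\<bar>l\<bar> + \<bar>n\<bar>)"
  have on: "orthonormal_family u" "orthonormal_family w" using Z W by (auto simp: eigenbasis_def)
  have H0: "H \<ge> 0" by (simp add: H_def)
  have WH: "norm (W - X) = r * H" using WX r by (simp add: H_def)
  have c1: "\<bar>c\<bar> \<le> 1" unfolding c_def abs_divide
    using abs_triangle_ineq[of l n] by (cases "\<bar>l\<bar> + \<bar>n\<bar> = 0") (auto simp: divide_le_eq_1)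
  have eig: "Z *v u i = l *\<^sub>R u i" "AZ *v u i = \<bar>l\<bar> *\<^sub>R u i" "W *v w j = n *\<^sub>R w j" "AW *v w j = \<bar>n\<bar> *\<^sub>R w j"
    using Z W by (auto simp: eigenbasis_def l_def n_def)
  have uZ: "u i \<bullet> (Z *v y) = l * (u i \<bullet> y)" "u i \<bullet> (AZ *v y) = \<bar>l\<bar> * (u i \<bullet> y)" for y
    using eigenbasis_inner(1)[OF Z(1)] eigenbasis_inner(1)[OF Z(2)] by (auto simp: l_def)
  \<comment> \<open>Since \<open>W\<close> lies on the segment from \<open>X\<close> to \<open>Z\<close>, the product \<open>p\<close> is tied to \<open>x\<close>.\<close>
  have np: "n * p = x + r * (l * p - x)"
  proof -
    have "n * p = u i \<bullet> (W *v w j)" by (simp add: eig p_def)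
    also have "\<dots> = x + r * (l * p - x)"
      by (simp add: WX matrix_vector_mult_add_rdistrib matrix_vector_mult_diff_rdistrib
          scaleR_matrix_vector_assoc[symmetric] inner_add_right inner_diff_right uZ x_def p_def)
    finally show ?thesis .
  qed
  define T where "T = (\<bar>l\<bar> * p - x') - c * (l * p - x)"
  have cn: "c * (n - l) = \<bar>n\<bar> - \<bar>l\<bar>"
  proof (cases "\<bar>l\<bar> + \<bar>n\<bar> = 0")
    case False
    have "(l + n) * (n - l) = (\<bar>n\<bar> - \<bar>l\<bar>) * (\<bar>l\<bar> + \<bar>n\<bar>)" by (simp add: algebra_simps)
    then show ?thesis using False by (simp add: c_def field_simps)
  qed auto
  have entry: "u i \<bullet> ((AW - AX - r *\<^sub>R (AZ - AX)) *v w j) = (1 - r) * T"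
  proof -
    have "u i \<bullet> ((AW - AX - r *\<^sub>R (AZ - AX)) *v w j) = \<bar>n\<bar> * p - x' - r * (\<bar>l\<bar> * p - x')"
      by (simp add: matrix_vector_mult_add_rdistrib matrix_vector_mult_diff_rdistrib
          scaleR_matrix_vector_assoc[symmetric] inner_add_right inner_diff_right uZ eig x'_def p_def)
    also have "\<dots> = (\<bar>n\<bar> - \<bar>l\<bar>) * p + (1 - r) * (\<bar>l\<bar> * p - x')" by (simp add: algebra_simps)
    also have "(\<bar>n\<bar> - \<bar>l\<bar>) * p = c * (n * p - l * p)" by (simp add: cn[symmetric] algebra_simps)
    also have "n * p - l * p = - (1 - r) * (l * p - x)" using np by (simp add: algebra_simps)
    finally show ?thesis by (simp add: T_def algebra_simps)
  qed
  have "\<bar>T\<bar> \<le> 16 / \<delta> * (r * H\<^sup>2)"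
  proof (cases "\<bar>l\<bar> < \<delta> / 2 \<and> \<bar>n\<bar> < \<delta> / 2")
    case True
    have Xu: "norm (X *v u i) \<le> 2 * H"
      using near_kernel_bound[OF X(1) Z(1) gap, of i] True by (simp add: H_def l_def)
    have Xw: "norm (X *v w j) \<le> 2 * (r * H)"
      using near_kernel_bound[OF X(1) W(1) gap, of j] True WH by (simp add: n_def)
    have "norm (X *v u i) * norm (X *v w j) \<le> (2 * H) * (2 * (r * H))"
      using Xu Xw H0 by (intro mult_mono) auto
    then have prod: "norm (X *v u i) * norm (X *v w j) / \<delta> \<le> 4 / \<delta> * (r * H\<^sup>2)"
      using \<delta> by (simp add: field_simps power2_eq_square)
    have "eigenbasis X (id \<circ> mu) v" using X(1) by simp
    from spectral_gap_inner_bound[OF X(1) this _ gap \<delta>, of "u i" "w j"] prod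
    have bx: "\<bar>x\<bar> \<le> 4 / \<delta> * (r * H\<^sup>2)" by (simp add: x_def)
    from spectral_gap_inner_bound[OF X(1) X(2) _ gap \<delta>, of "u i" "w j"] prod
    have bx': "\<bar>x'\<bar> \<le> 4 / \<delta> * (r * H\<^sup>2)" by (simp add: x'_def)
    have first: "\<bar>(\<bar>l\<bar> - c * l) * p\<bar> \<le> 2 * \<bar>x\<bar>"
    proof (cases "l * n < 0")
      case False
      then have "\<bar>l\<bar> - c * l = 0"
        unfolding c_def by (cases "l = 0"; cases "n = 0"; cases "l > 0"; cases "n > 0")
          (auto simp: field_simps mult_neg_pos mult_pos_neg not_less)
      then show ?thesis by simp
    next
      case True
      then have ln: "\<bar>l\<bar> + \<bar>n\<bar> > 0" by (auto simp: mult_less_0_iff)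
      have "\<bar>n - r * l\<bar> = \<bar>n\<bar> + r * \<bar>l\<bar>"
        using True r by (auto simp: mult_less_0_iff abs_if mult_nonneg_nonneg mult_nonneg_nonpos)
          (smt (verit) mult_nonneg_nonneg mult_nonneg_nonpos)+
      moreover have "(n - r * l) * p = (1 - r) * x" using np by (simp add: algebra_simps)
      then have "\<bar>n - r * l\<bar> * \<bar>p\<bar> = (1 - r) * \<bar>x\<bar>"
        using r by (metis abs_mult abs_of_nonneg diff_ge_0_iff_ge)
      ultimately have "\<bar>n\<bar> * \<bar>p\<bar> + r * \<bar>l\<bar> * \<bar>p\<bar> = (1 - r) * \<bar>x\<bar>" by (simp add: distrib_right)
      moreover have "r * \<bar>l\<bar> * \<bar>p\<bar> \<ge> 0" "(1 - r) * \<bar>x\<bar> \<le> \<bar>x\<bar>" using r by (auto simp: mult_left_le_one_le)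
      ultimately have np: "\<bar>n\<bar> * \<bar>p\<bar> \<le> \<bar>x\<bar>" by linarith
      have "(\<bar>l\<bar> - c * l) * (\<bar>l\<bar> + \<bar>n\<bar>) = 2 * \<bar>l\<bar> * \<bar>n\<bar>"
        using ln True by (auto simp: c_def field_simps mult_less_0_iff abs_if)
      then have "\<bar>\<bar>l\<bar> - c * l\<bar> * (\<bar>l\<bar> + \<bar>n\<bar>) = 2 * \<bar>l\<bar> * \<bar>n\<bar>"
        using ln by (metis abs_mult abs_of_pos abs_numeral abs_abs)
      also have "\<dots> \<le> (2 * \<bar>n\<bar>) * (\<bar>l\<bar> + \<bar>n\<bar>)" by (simp add: algebra_simps)
      finally have "\<bar>\<bar>l\<bar> - c * l\<bar> \<le> 2 * \<bar>n\<bar>" using ln by (simp only: mult_le_cancel_right_pos)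
      then have "\<bar>\<bar>l\<bar> - c * l\<bar> * \<bar>p\<bar> \<le> 2 * \<bar>n\<bar> * \<bar>p\<bar>" by (rule mult_right_mono) simp
      then show ?thesis using np by (simp add: abs_mult)
    qed
    have "T = (\<bar>l\<bar> - c * l) * p - x' + c * x" by (simp add: T_def algebra_simps)
    moreover have "\<bar>c * x\<bar> \<le> \<bar>x\<bar>" using c1 by (simp add: abs_mult mult_left_le_one_le)
    ultimately have "\<bar>T\<bar> \<le> 3 * \<bar>x\<bar> + \<bar>x'\<bar>" using first by linarith
    also have "\<dots> \<le> 4 * (4 / \<delta> * (r * H\<^sup>2))" using bx bx' by linarith
    finally show ?thesis by simp
  next
    case False
    then have ge: "\<bar>l\<bar> + \<bar>n\<bar> \<ge> \<delta> / 2" by auto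
    then have pos: "\<bar>l\<bar> + \<bar>n\<bar> > 0" using \<delta> by linarith
    have sq: "(AX *v u i) \<bullet> (AX *v w j) = (X *v u i) \<bullet> (X *v w j)"
    proof -
      have on: "orthonormal_family v" using X by (auto simp: eigenbasis_def)
      show ?thesis unfolding parseval[OF on, of "AX *v u i"] parseval[OF on, of "X *v u i"]
          eigenbasis_inner(1)[OF X(1)] eigenbasis_inner(1)[OF X(2)]
        by (intro sum.cong refl) (metis (no_types) abs_mult_self_eq comp_apply mult.assoc mult.left_commute)
    qed
    have sX: "(X *v a) \<bullet> b = a \<bullet> (X *v b)" "(AX *v a) \<bullet> b = a \<bullet> (AX *v b)" for a b
      using inner_symmetric_matrix eigenbasis_symmetric X by blast+
    have 1: "((AZ - AX) *v u i) \<bullet> ((AW - AX) *v w j)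
        = \<bar>l\<bar> * \<bar>n\<bar> * p - (\<bar>l\<bar> + \<bar>n\<bar>) * x' + (AX *v u i) \<bullet> (AX *v w j)"
      by (simp add: matrix_vector_mult_diff_rdistrib eig inner_diff_left inner_diff_right p_def x'_def sX algebra_simps)
    have 2: "((Z - X) *v u i) \<bullet> ((W - X) *v w j)
        = l * n * p - (l + n) * x + (X *v u i) \<bullet> (X *v w j)"
      by (simp add: matrix_vector_mult_diff_rdistrib eig inner_diff_left inner_diff_right p_def x_def sX algebra_simps)
    have "(\<bar>l\<bar> + \<bar>n\<bar>) * T = (\<bar>l\<bar> + \<bar>n\<bar>) * (\<bar>l\<bar> * p - x') - (l + n) * (l * p - x)"
      using pos by (simp add: T_def c_def right_diff_distrib)
    also have "\<dots> = ((AZ - AX) *v u i) \<bullet> ((AW - AX) *v w j) - ((Z - X) *v u i) \<bullet> ((W - X) *v w j)"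
      unfolding 1 2 sq by (simp add: algebra_simps)
    finally have eq: "(\<bar>l\<bar> + \<bar>n\<bar>) * T = \<dots>" .
    have "\<bar>((AZ - AX) *v u i) \<bullet> ((AW - AX) *v w j)\<bar> \<le> H * (r * H)"
      using lip WH by (intro inner_matrix_orthonormal_le[OF on]) (auto simp: H_def)
    moreover have "\<bar>((Z - X) *v u i) \<bullet> ((W - X) *v w j)\<bar> \<le> H * (r * H)"
      using WH by (intro inner_matrix_orthonormal_le[OF on]) (auto simp: H_def)
    ultimately have "\<bar>(\<bar>l\<bar> + \<bar>n\<bar>) * T\<bar> \<le> 2 * (r * H\<^sup>2)"
      unfolding eq power2_eq_square mult.left_commute[of r H H] by linarith
    moreover have "\<delta> / 2 * \<bar>T\<bar> \<le> (\<bar>l\<bar> + \<bar>n\<bar>) * \<bar>T\<bar>" using ge by (rule mult_right_mono) simp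
    ultimately have "\<delta> / 2 * \<bar>T\<bar> \<le> 2 * (r * H\<^sup>2)" using pos by (simp add: abs_mult)
    then have "\<bar>T\<bar> \<le> 4 / \<delta> * (r * H\<^sup>2)" using \<delta> by (simp add: field_simps)
    also have "\<dots> \<le> 16 / \<delta> * (r * H\<^sup>2)" using \<delta> r by (intro mult_right_mono divide_right_mono) auto
    finally show ?thesis .
  qed
  then have "(1 - r) * \<bar>T\<bar> \<le> (1 - r) * (16 / \<delta> * (r * H\<^sup>2))" using r by (intro mult_left_mono) auto
  moreover have "\<bar>(1 - r) * T\<bar> = (1 - r) * \<bar>T\<bar>" using r by (simp add: abs_mult)
  moreover have "(1 - r) * (16 / \<delta> * (r * H\<^sup>2)) = 16 / \<delta> * (r * (1 - r)) * H\<^sup>2" by (simp only: mult_ac)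
  ultimately show ?thesis unfolding entry H_def[symmetric] by linarith
qed

lemma norm_matrix_entries_le:
  fixes M :: "real^'m^'m" and u w :: "'m \<Rightarrow> real^'m"
  assumes u: "orthonormal_family u" and w: "orthonormal_family w"
    and b: "\<And>i j. \<bar>u i \<bullet> (M *v w j)\<bar> \<le> b"
  shows "norm M \<le> real CARD('m) * b"
proof -
  have "b \<ge> 0" using b[of undefined undefined] by linarith
  have "(norm M)\<^sup>2 \<le> (\<Sum>j\<in>(UNIV::'m set). \<Sum>i\<in>(UNIV::'m set). b\<^sup>2)"
    unfolding matrix_norm_orthonormal2[OF u w] using b \<open>b \<ge> 0\<close>
    by (intro sum_mono) (simp flip: abs_le_square_iff)
  also have "\<dots> = (real CARD('m) * b)\<^sup>2" by (simp add: power2_eq_square)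
  finally show ?thesis using \<open>b \<ge> 0\<close> by (simp add: power2_le_iff_abs_le)
qed

lemma ray_quadratic_spectral_abs:
  "ray_quadratic (\<lambda>A :: real^'m^'m. spectral_map abs (sym_part A))"
  unfolding ray_quadratic_def
proof
  fix X :: "real^'m^'m"
  obtain mu v where X: "eigenbasis (sym_part X) mu v" "\<And>f. eigenbasis (spectral_map f (sym_part X)) (f \<circ> mu) v"
    using spectral_map_eigenbasis[OF transpose_sym_part] by metis
  obtain \<delta> where \<delta>: "\<delta> > 0" and gap: "\<And>k. mu k = 0 \<or> \<delta> \<le> \<bar>mu k\<bar>"
  proof
    \<comment> \<open>The gap is the minimum of the nonzero moduli; \<open>1\<close> is inserted in case all eigenvalues vanish.\<close>
    let ?S = "insert 1 ((\<lambda>k. \<bar>mu k\<bar>) ` {k. mu k \<noteq> 0})"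
    show "Min ?S > 0" by (subst Min_gr_iff) auto
    show "mu k = 0 \<or> Min ?S \<le> \<bar>mu k\<bar>" for k by (cases "mu k = 0") (auto intro!: Min_le)
  qed
  define C where "C = real CARD('m) * (16 / \<delta>)"
  show "\<exists>C\<ge>0. \<forall>h. \<forall>r\<in>{0..1}.
     norm (spectral_map abs (sym_part (X + r *\<^sub>R h)) - spectral_map abs (sym_part X)
        - r *\<^sub>R (spectral_map abs (sym_part (X + h)) - spectral_map abs (sym_part X))) \<le> C * (r * (1 - r)) * (norm h)\<^sup>2"
  proof (intro exI[of _ C] conjI allI ballI)
    show "C \<ge> 0" using \<delta> by (simp add: C_def)
    fix h :: "real^'m^'m" and r :: real assume r: "r \<in> {0..1}"
    obtain lam u where Z: "eigenbasis (sym_part (X + h)) lam u"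
        "\<And>f. eigenbasis (spectral_map f (sym_part (X + h))) (f \<circ> lam) u"
      using spectral_map_eigenbasis[OF transpose_sym_part] by metis
    obtain nu w where W: "eigenbasis (sym_part (X + r *\<^sub>R h)) nu w"
        "\<And>f. eigenbasis (spectral_map f (sym_part (X + r *\<^sub>R h))) (f \<circ> nu) w"
      using spectral_map_eigenbasis[OF transpose_sym_part] by metis
    have on: "orthonormal_family u" "orthonormal_family w" using Z(1) W(1) by (auto simp: eigenbasis_def)
    let ?M = "spectral_map abs (sym_part (X + r *\<^sub>R h)) - spectral_map abs (sym_part X)
        - r *\<^sub>R (spectral_map abs (sym_part (X + h)) - spectral_map abs (sym_part X))"
    have line: "sym_part (X + r *\<^sub>R h) = sym_part X + r *\<^sub>R (sym_part (X + h) - sym_part X)"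
      by (simp add: linear_add[OF linear_sym_part] linear_scale[OF linear_sym_part])
    have "norm ?M \<le> real CARD('m) * (16 / \<delta> * (r * (1 - r)) * (norm (sym_part (X + h) - sym_part X))\<^sup>2)"
      using r gap \<delta> by (intro norm_matrix_entries_le[OF on] abs_ray_entry_bound[OF X Z W line] spectral_map_lipschitz) auto
    also have "\<dots> = C * (r * (1 - r)) * (norm (sym_part h))\<^sup>2"
      by (simp add: C_def linear_add[OF linear_sym_part])
    also have "\<dots> \<le> C * (r * (1 - r)) * (norm h)\<^sup>2"
      using r \<open>C \<ge> 0\<close> norm_sym_part_le[of h] by (intro mult_left_mono power_mono) auto
    finally show "norm ?M \<le> C * (r * (1 - r)) * (norm h)\<^sup>2" .
  qed
qed

text \<open>
  The positive and the negative part of a real number have the form \<open>a * x + b * \<bar>x\<bar>\<close>, so their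
  spectral maps inherit the chord condition from the absolute value.
\<close>
lemma spectral_map_affine_abs:
  fixes A :: "real^'m^'m"
  assumes "transpose A = A"
  shows "spectral_map (\<lambda>x. a * x + b * \<bar>x\<bar>) A = a *\<^sub>R A + b *\<^sub>R spectral_map abs A"
proof -
  obtain lam u where A: "eigenbasis A lam u" "\<And>f. eigenbasis (spectral_map f A) (f \<circ> lam) u"
    using spectral_map_eigenbasis[OF assms] by metis
  show ?thesis
  proof (rule matrix_eq_orthonormal)
    show "orthonormal_family u" using A(1) by (simp add: eigenbasis_def)
    fix j
    have "A *v u j = lam j *\<^sub>R u j" "spectral_map abs A *v u j = \<bar>lam j\<bar> *\<^sub>R u j"
      "spectral_map (\<lambda>x. a * x + b * \<bar>x\<bar>) A *v u j = (a * lam j + b * \<bar>lam j\<bar>) *\<^sub>R u j"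
      using A(1) A(2)[of abs] A(2)[of "\<lambda>x. a * x + b * \<bar>x\<bar>"] by (simp_all add: eigenbasis_def)
    then show "spectral_map (\<lambda>x. a * x + b * \<bar>x\<bar>) A *v u j = (a *\<^sub>R A + b *\<^sub>R spectral_map abs A) *v u j"
      by (simp add: matrix_vector_mult_add_rdistrib scaleR_matrix_vector_assoc[symmetric] scaleR_add_left)
  qed
qed

lemma ray_quadratic_spectral:
  "ray_quadratic (\<lambda>A :: real^'m^'m. spectral_map (\<lambda>x. a * x + b * \<bar>x\<bar>) (sym_part A))"
proof -
  have "linear (\<lambda>A :: real^'m^'m. a *\<^sub>R sym_part A)"
    using linear_compose_scale_right[OF linear_sym_part] .
  then have "ray_quadratic (\<lambda>A :: real^'m^'m. a *\<^sub>R sym_part A + 0)" by (rule ray_quadratic_affine)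
  from ray_quadratic_add[OF this ray_quadratic_linear_comp[OF ray_quadratic_spectral_abs
      bounded_linear_scaleR_right[of b] bounded_linear_ident]]
  show ?thesis by (simp add: spectral_map_affine_abs)
qed

text \<open>
  The upper and lower bounds on the scalar Taylor remainder of \<open>h\<close> are averaged with the weights
  of the mixed eigenbases.
\<close>
lemma tame_convex_spectral:
  assumes f: "\<And>x. f x = a * x + b * \<bar>x\<bar>" and flip: "\<And>x y. \<bar>f x - f y\<bar> \<le> \<bar>x - y\<bar>"
    and h: "\<And>x y. 0 \<le> h y - h x - 2 * f x * (y - x)"
      "\<And>x y. h y - h x - 2 * f x * (y - x) \<le> (y - x)\<^sup>2"
  shows "tame_convex 2 (\<lambda>A :: real^'m^'m. \<Sum>x\<in>#eigenvalues (sym_part A). h x)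
    (\<lambda>A. 2 *\<^sub>R spectral_map f (sym_part A))"
proof (rule tame_convexI)
  show "2-lipschitz_on UNIV (\<lambda>A :: real^'m^'m. 2 *\<^sub>R spectral_map f (sym_part A))"
  proof (rule lipschitz_onI)
    fix A B :: "real^'m^'m"
    have "norm (spectral_map f (sym_part A) - spectral_map f (sym_part B)) \<le> norm (sym_part A - sym_part B)"
      by (intro spectral_map_lipschitz flip) auto
    also have "\<dots> \<le> norm (A - B)" using norm_sym_part_le[of "A - B"] by (simp add: linear_diff[OF linear_sym_part])
    finally show "dist (2 *\<^sub>R spectral_map f (sym_part A)) (2 *\<^sub>R spectral_map f (sym_part B)) \<le> 2 * dist A B"
      by (simp add: dist_norm flip: scaleR_diff_right)
  qed simp
  have "f = (\<lambda>x. a * x + b * \<bar>x\<bar>)" using f by auto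
  then show "ray_quadratic (\<lambda>A :: real^'m^'m. 2 *\<^sub>R spectral_map f (sym_part A))"
    using ray_quadratic_linear_comp[OF ray_quadratic_spectral bounded_linear_scaleR_right[of 2] bounded_linear_ident]
    by simp
next
  fix A B :: "real^'m^'m"
  obtain lam u where A: "eigenbasis (sym_part A) lam u"
      "\<And>f. eigenbasis (spectral_map f (sym_part A)) (f \<circ> lam) u"
    using spectral_map_eigenbasis[OF transpose_sym_part] by metis
  obtain nu w where B: "eigenbasis (sym_part B) nu w"
    using spectral_theorem[OF transpose_sym_part] by metis
  let ?E = "(\<Sum>x\<in>#eigenvalues (sym_part B). h x) - (\<Sum>x\<in>#eigenvalues (sym_part A). h x)
       - (2 *\<^sub>R spectral_map f (sym_part A)) \<bullet> (B - A)"
  have "eigenbasis (2 *\<^sub>R spectral_map f (sym_part A)) ((\<lambda>x. 2 * f x) \<circ> lam) u"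
    using A(2)[of f] by (simp add: eigenbasis_def scaleR_matrix_vector_assoc[symmetric])
  note exp = spectral_sum_expansion[OF A(1) this B]
  have "transpose (2 *\<^sub>R spectral_map f (sym_part A)) = 2 *\<^sub>R spectral_map f (sym_part A)"
    using eigenbasis_symmetric[OF A(2)] by (simp add: transpose_linear)
  from inner_sym_part[OF this, of "B - A"]
  have E: "?E = (\<Sum>j\<in>UNIV. \<Sum>i\<in>UNIV. (u i \<bullet> w j)\<^sup>2 * (h (nu j) - h (lam i) - 2 * f (lam i) * (nu j - lam i)))"
    unfolding sum_eigenvalues[OF A(1)] sum_eigenvalues[OF B] exp(1)[symmetric]
    by (simp add: linear_diff[OF linear_sym_part])
  show "0 \<le> ?E" unfolding E using h(1) by (intro sum_nonneg mult_nonneg_nonneg) auto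
  have "?E \<le> (\<Sum>j\<in>UNIV. \<Sum>i\<in>UNIV. (u i \<bullet> w j)\<^sup>2 * (nu j - lam i)\<^sup>2)"
    unfolding E using h(2) by (intro sum_mono mult_left_mono) auto
  also have "\<dots> = (norm (sym_part (B - A)))\<^sup>2" unfolding exp(2)[symmetric] by (simp add: linear_diff[OF linear_sym_part])
  also have "\<dots> \<le> (norm (B - A))\<^sup>2" using norm_sym_part_le by (intro power_mono) auto
  also have "\<dots> \<le> 2 * (norm (B - A))\<^sup>2" by simp
  finally show "?E \<le> 2 * (norm (B - A))\<^sup>2" .
qed

lemma pos_part_square_expansion:
  fixes x y :: real
  shows "0 \<le> (max 0 y)\<^sup>2 - (max 0 x)\<^sup>2 - 2 * max 0 x * (y - x)"
    "(max 0 y)\<^sup>2 - (max 0 x)\<^sup>2 - 2 * max 0 x * (y - x) \<le> (y - x)\<^sup>2"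
proof -
  have "(max 0 y)\<^sup>2 - (max 0 x)\<^sup>2 - 2 * max 0 x * (y - x)
      = (max 0 y - max 0 x)\<^sup>2 + 2 * (max 0 x * (x - y + max 0 y - max 0 x))"
    by (simp add: power2_eq_square algebra_simps)
  moreover have "max 0 x * (x - y + max 0 y - max 0 x) \<ge> 0" by (auto simp: max_def)
  ultimately show "0 \<le> (max 0 y)\<^sup>2 - (max 0 x)\<^sup>2 - 2 * max 0 x * (y - x)" by simp
  have "(y - x)\<^sup>2 - ((max 0 y)\<^sup>2 - (max 0 x)\<^sup>2 - 2 * max 0 x * (y - x))
    = ((y - max 0 y) - (x - max 0 x))\<^sup>2 + 2 * (max 0 y * (max 0 x - x)) + 2 * (max 0 y * (y - max 0 y)) - 2 * (max 0 x * (max 0 x - x)) * 0 - 2 * (max 0 x * (x - max 0 x)) * 0 "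
    by (simp add: power2_eq_square max_def algebra_simps)
  moreover have "max 0 y * (max 0 x - x) \<ge> 0" "max 0 y * (y - max 0 y) = 0" by (auto simp: max_def)
  ultimately show "(max 0 y)\<^sup>2 - (max 0 x)\<^sup>2 - 2 * max 0 x * (y - x) \<le> (y - x)\<^sup>2"
    by (smt (verit) zero_le_power2)
qed

lemma neg_part_square_expansion:
  fixes x y :: real
  shows "0 \<le> (min 0 y)\<^sup>2 - (min 0 x)\<^sup>2 - 2 * min 0 x * (y - x)"
    "(min 0 y)\<^sup>2 - (min 0 x)\<^sup>2 - 2 * min 0 x * (y - x) \<le> (y - x)\<^sup>2"
proof -
  have "min 0 z = - max 0 (- z)" for z :: real by (simp add: min_def max_def)
  then show "0 \<le> (min 0 y)\<^sup>2 - (min 0 x)\<^sup>2 - 2 * min 0 x * (y - x)"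
    "(min 0 y)\<^sup>2 - (min 0 x)\<^sup>2 - 2 * min 0 x * (y - x) \<le> (y - x)\<^sup>2"
    using pos_part_square_expansion[of "- y" "- x"] by (simp_all add: power2_commute algebra_simps)
qed

lemma tame_convex_spectral_pos:
  "tame_convex 2 (\<lambda>A :: real^'m^'m. \<Sum>x\<in>#eigenvalues (sym_part A). (max 0 x)\<^sup>2)
    (\<lambda>A. 2 *\<^sub>R spectral_map (max 0) (sym_part A))"
  using pos_part_square_expansion
  by (intro tame_convex_spectral[where a="1/2" and b="1/2"]) (auto simp: max_def abs_if)

lemma tame_convex_spectral_neg:
  "tame_convex 2 (\<lambda>A :: real^'m^'m. \<Sum>x\<in>#eigenvalues (sym_part A). (min 0 x)\<^sup>2)
    (\<lambda>A. 2 *\<^sub>R spectral_map (min 0) (sym_part A))"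
  using neg_part_square_expansion
  by (intro tame_convex_spectral[where a="1/2" and b="-1/2"]) (auto simp: min_def abs_if)

section \<open>Split energy densities\<close>

text \<open>
  The densities \<open>\<psi>\<^sup>+\<close> and \<open>\<psi>\<^sup>-\<close> do not depend on the damage, so for them the mere existence of a
  constant and a gradient field already gives bounds that are uniform in the damage.
\<close>
definition tame :: "('a::euclidean_space \<Rightarrow> real) \<Rightarrow> bool" where
  "tame f \<longleftrightarrow> (\<exists>L F. tame_convex L f F)"

lemma tame_add: "tame f \<Longrightarrow> tame g \<Longrightarrow> tame (\<lambda>x. f x + g x)"
  unfolding tame_def using tame_convex_add by blast

lemma tame_scale: "tame f \<Longrightarrow> 0 \<le> a \<Longrightarrow> tame (\<lambda>x. a * f x)"
  unfolding tame_def using tame_convex_scale by blast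

lemma tame_linear_comp:
  fixes f :: "'b::euclidean_space \<Rightarrow> real" and B :: "'a::euclidean_space \<Rightarrow> 'b"
  shows "tame f \<Longrightarrow> linear B \<Longrightarrow> tame (\<lambda>x. f (B x))"
  unfolding tame_def using tame_convex_linear_comp by blast

lemma tame_zero: "tame (\<lambda>x :: 'a::euclidean_space. 0)"
  using tame_convex_affine[of "0 :: 'a" 0] unfolding tame_def by auto

lemma tame_quadratic:
  fixes S :: "'a::euclidean_space \<Rightarrow> 'a"
  assumes S: "linear S" and adj: "\<And>x y. S x \<bullet> y = x \<bullet> S y" and nonneg: "\<And>x. 0 \<le> x \<bullet> S x"
  shows "tame (\<lambda>x. x \<bullet> S x)"
proof -
  have bl: "bounded_linear S" using S by (simp add: linear_conv_bounded_linear)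
  have "tame_convex (2 * onorm S) (\<lambda>x. x \<bullet> S x) (\<lambda>x. 2 *\<^sub>R S x)"
  proof (rule tame_convexI)
    show "(2 * onorm S)-lipschitz_on UNIV (\<lambda>x. 2 *\<^sub>R S x)"
    proof (rule lipschitz_onI)
      fix x y
      have "dist (2 *\<^sub>R S x) (2 *\<^sub>R S y) = 2 * norm (S (x - y))"
        by (simp add: dist_norm linear_diff[OF S] flip: scaleR_diff_right)
      also have "\<dots> \<le> 2 * (onorm S * norm (x - y))" using onorm[OF bl] by simp
      finally show "dist (2 *\<^sub>R S x) (2 *\<^sub>R S y) \<le> 2 * onorm S * dist x y" by (simp add: dist_norm)
    qed (use onorm_pos_le[OF bl] in simp)
    have "linear (\<lambda>x. 2 *\<^sub>R S x)" using S by (rule linear_compose_scale_right)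
    from ray_quadratic_affine[OF this, of 0] show "ray_quadratic (\<lambda>x. 2 *\<^sub>R S x)" by simp
  next
    fix x y
    have eq: "y \<bullet> S y - x \<bullet> S x - (2 *\<^sub>R S x) \<bullet> (y - x) = (y - x) \<bullet> S (y - x)"
      using adj[of x y] by (simp add: linear_diff[OF S] inner_diff_left inner_diff_right inner_commute)
    show "0 \<le> y \<bullet> S y - x \<bullet> S x - (2 *\<^sub>R S x) \<bullet> (y - x)" unfolding eq by (rule nonneg)
    have "(y - x) \<bullet> S (y - x) \<le> norm (y - x) * norm (S (y - x))" by (rule norm_cauchy_schwarz)
    also have "\<dots> \<le> norm (y - x) * (onorm S * norm (y - x))" using onorm[OF bl] by (intro mult_left_mono) auto
    also have "\<dots> \<le> 2 * onorm S * (norm (y - x))\<^sup>2"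
      using onorm_pos_le[OF bl] by (simp add: power2_eq_square mult_ac)
    finally show "y \<bullet> S y - x \<bullet> S x - (2 *\<^sub>R S x) \<bullet> (y - x) \<le> 2 * onorm S * (norm (y - x))\<^sup>2"
      unfolding eq .
  qed
  then show ?thesis unfolding tame_def by blast
qed

lemma tame_inner_self: "tame (\<lambda>x :: 'a::euclidean_space. x \<bullet> x)"
  using tame_quadratic[of "\<lambda>x :: 'a. x"] by (simp add: linear_id[unfolded id_def])

lemma tame_square: "tame (\<lambda>x :: real. x\<^sup>2)"
  using tame_inner_self[where 'a=real] by (simp add: power2_eq_square)

lemma tame_pos_square: "tame (\<lambda>x :: real. (max 0 x)\<^sup>2)"
proof -
  have "tame_convex 2 (\<lambda>x :: real. (max 0 x)\<^sup>2) (\<lambda>x. 2 *\<^sub>R max 0 x)"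
  proof (rule tame_convexI)
    show "2-lipschitz_on UNIV (\<lambda>x :: real. 2 *\<^sub>R max 0 x)"
      by (rule lipschitz_onI) (auto simp: dist_real_def max_def abs_if)
    show "ray_quadratic (\<lambda>x :: real. 2 *\<^sub>R max 0 x)"
      by (rule ray_quadratic_linear_comp[OF ray_quadratic_max bounded_linear_scaleR_right bounded_linear_ident])
  next
    fix x y :: real
    show "0 \<le> (max 0 y)\<^sup>2 - (max 0 x)\<^sup>2 - (2 *\<^sub>R max 0 x) \<bullet> (y - x)"
      "(max 0 y)\<^sup>2 - (max 0 x)\<^sup>2 - (2 *\<^sub>R max 0 x) \<bullet> (y - x) \<le> 2 * (norm (y - x))\<^sup>2"
      using pos_part_square_expansion[where x=x and y=y] zero_le_power2[of "y - x"]
      by (simp_all only: real_scaleR_def inner_real_def real_norm_def power2_abs)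
  qed
  then show ?thesis unfolding tame_def by blast
qed

lemma tame_neg_square: "tame (\<lambda>x :: real. (min 0 x)\<^sup>2)"
proof -
  have "tame (\<lambda>x :: real. (max 0 (- x))\<^sup>2)"
    by (rule tame_linear_comp[OF tame_pos_square linear_uminus])
  moreover have "(max 0 (- x))\<^sup>2 = (min 0 x)\<^sup>2" for x :: real by (auto simp: max_def min_def)
  ultimately show ?thesis by simp
qed

lemma trace_inner_mat: "trace A = A \<bullet> mat 1" for A :: "real^'m^'m"
  by (simp add: trace_def inner_vec_def mat_def if_distrib[of "\<lambda>x. _ * x"] sum.delta cong: if_cong)

lemma linear_trace: "linear (trace :: real^'m^'m \<Rightarrow> real)"
  by (intro linearI) (simp_all add: trace_inner_mat inner_add_left)

lemma mat_scaleR: "mat a = a *\<^sub>R (mat 1 :: real^'m^'m)"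
  by (simp add: mat_def vec_eq_iff)

lemma dev_eq: "dev A = A - (trace A / real CARD('m)) *\<^sub>R mat 1" for A :: "real^'m^'m"
  unfolding dev_def by (subst mat_scaleR) simp

lemma linear_dev: "linear (dev :: real^'m^'m \<Rightarrow> real^'m^'m)"
proof (rule linearI)
  fix A B :: "real^'m^'m" and r :: real
  show "dev (A + B) = dev A + dev B"
    by (simp add: dev_eq linear_add[OF linear_trace] add_divide_distrib algebra_simps)
  show "dev (r *\<^sub>R A) = r *\<^sub>R dev A"
    by (simp add: dev_eq linear_scale[OF linear_trace] algebra_simps)
qed

lemma inner_mat_1: "(mat 1 :: real^'m^'m) \<bullet> mat 1 = real CARD('m)"
  by (metis trace_I trace_inner_mat)

lemma dev_inner: "dev A \<bullet> dev A = A \<bullet> A - (trace A)\<^sup>2 / real CARD('m)" for A :: "real^'m^'m"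
proof -
  have "dev A \<bullet> dev A = A \<bullet> A - 2 * (trace A / real CARD('m)) * trace A
      + (trace A / real CARD('m))\<^sup>2 * real CARD('m)"
    unfolding dev_eq
    by (simp add: inner_diff_left inner_diff_right trace_inner_mat inner_commute inner_mat_1 power2_eq_square)
  then show ?thesis by (simp add: power2_eq_square field_simps)
qed

lemma trace_mult_symmetric:
  fixes A :: "real^'m^'m"
  assumes "transpose A = A"
  shows "trace (A ** A) = A \<bullet> A"
proof -
  have "A $ i $ j = A $ j $ i" for i j using assms by (metis transpose_def vec_lambda_beta)
  then show ?thesis by (simp add: trace_def matrix_matrix_mult_def inner_vec_def)
qed

lemma trace_sym_part: "trace (sym_part A) = trace A"
  by (simp add: sym_part_def trace_def transpose_def)

lemma sum_eigenvalues_trace: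
  fixes A :: "real^'m^'m"
  assumes "transpose A = A"
  shows "(\<Sum>x\<in>#eigenvalues A. x) = trace A" "(\<Sum>x\<in>#eigenvalues A. x\<^sup>2) = A \<bullet> A"
proof -
  obtain lam u where A: "eigenbasis A lam u" using spectral_theorem[OF assms] by metis
  then have on: "orthonormal_family u" and eig: "\<And>i. A *v u i = lam i *\<^sub>R u i" by (auto simp: eigenbasis_def)
  have uu: "u i \<bullet> u i = 1" for i using on by (simp add: orthonormal_family_def)
  show "(\<Sum>x\<in>#eigenvalues A. x) = trace A"
    using sum_eigenvalues[OF A, of "\<lambda>x. x"]
    by (simp add: trace_inner_mat matrix_inner_orthonormal[OF on] eig uu)
  show "(\<Sum>x\<in>#eigenvalues A. x\<^sup>2) = A \<bullet> A"
    using sum_eigenvalues[OF A, of "\<lambda>x. x\<^sup>2"]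
    by (simp add: matrix_inner_orthonormal[OF on] eig uu power2_eq_square)
qed

lemma volumetric_deviatoric_identity:
  "(mu / m + lam / 2) * t + mu * (q - t / m) = lam / 2 * t + mu * q" for mu m lam t q :: real
  by (simp add: algebra_simps)

text \<open>
  Every split decomposes the same energy \<open>psi0\<close>. Hence the degraded density
  \<open>(g d + k) \<psi>\<^sup>+ + (1 + k) \<psi>\<^sup>-\<close> equals \<open>k \<psi>\<^sub>0 + g d \<psi>\<^sup>+ + \<psi>\<^sup>-\<close>, whose first term is strongly convex
  independently of the damage.
\<close>
lemma psi_sum:
  fixes A :: "real^'m^'m"
  assumes A: "transpose A = A"
  shows "psi_plus split lam mu A + psi_minus split lam mu A = psi0 lam mu A"
proof (cases split)
  case Isotropic
  then show ?thesis by simp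
next
  case Volumetric
  then show ?thesis
    using volumetric_deviatoric_identity[of mu "real CARD('m)" lam]
    by (simp only: psi_plus.simps psi_minus.simps psi0_def dev_inner trace_mult_symmetric[OF A])
next
  case Volumetric_Deviatoric
  have *: "(max 0 x)\<^sup>2 + (min 0 x)\<^sup>2 = x\<^sup>2" for x :: real by (auto simp: max_def min_def)
  have "(mu / real CARD('m) + lam / 2) * (max 0 (trace A))\<^sup>2 + (mu / real CARD('m) + lam / 2) * (min 0 (trace A))\<^sup>2
     = (mu / real CARD('m) + lam / 2) * (trace A)\<^sup>2" by (simp only: * flip: distrib_left)
  with volumetric_deviatoric_identity[of mu "real CARD('m)" lam "(trace A)\<^sup>2" "A \<bullet> A"] show ?thesis
    unfolding Volumetric_Deviatoric psi_plus.simps psi_minus.simps psi0_def dev_inner trace_mult_symmetric[OF A]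
    by linarith
next
  case Spectral
  have *: "(max 0 x)\<^sup>2 + (min 0 x)\<^sup>2 = x\<^sup>2" for x :: real by (auto simp: max_def min_def)
  have "(\<Sum>x\<in>#eigenvalues A. (max 0 x)\<^sup>2) + (\<Sum>x\<in>#eigenvalues A. (min 0 x)\<^sup>2) = (\<Sum>x\<in>#eigenvalues A. x\<^sup>2)"
    by (simp add: * flip: sum_mset.distrib)
  then have sq: "A \<bullet> A = (\<Sum>x\<in>#eigenvalues A. (max 0 x)\<^sup>2) + (\<Sum>x\<in>#eigenvalues A. (min 0 x)\<^sup>2)"
    using sum_eigenvalues_trace(2)[OF A] by simp
  have tr: "(trace A)\<^sup>2 = (max 0 (trace A))\<^sup>2 + (min 0 (trace A))\<^sup>2" by (rule *[symmetric])
  show ?thesis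
    unfolding Spectral psi_plus.simps psi_minus.simps psi0_def trace_mult_symmetric[OF A]
      sum_eigenvalues_trace(1)[OF A] sq tr
    by (simp only: distrib_left ac_simps)
qed

text \<open>
  Strong convexity is evaluated at the midpoint of \<open>A\<close> and \<open>0\<close>, and \<open>psi0\<close> is homogeneous of degree two.
\<close>
lemma strongly_convex_psi0_bound:
  assumes c: "strongly_convex_on c (sym_matrices :: (real^'m^'m) set) (psi0 lam mu)"
    and A: "transpose A = (A :: real^'m^'m)"
  shows "c / 2 * (norm A)\<^sup>2 \<le> psi0 lam mu A"
proof -
  have hom: "psi0 lam mu (r *\<^sub>R A) = r\<^sup>2 * psi0 lam mu A" for r
  proof -
    have "transpose (r *\<^sub>R A) = r *\<^sub>R A" using A by (simp add: transpose_linear)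
    then show ?thesis
      by (simp add: psi0_def trace_mult_symmetric A linear_scale[OF linear_trace] power_mult_distrib)
        (simp add: power2_eq_square algebra_simps)
  qed
  have "A \<in> sym_matrices" "0 \<in> sym_matrices" using A by (auto simp: sym_matrices_def transpose_def vec_eq_iff)
  then have "psi0 lam mu ((1 - 1/2) *\<^sub>R A + (1/2) *\<^sub>R 0)
      \<le> (1 - 1/2) * psi0 lam mu A + 1/2 * psi0 lam mu (0 :: real^'m^'m) - c / 2 * (1/2) * (1 - 1/2) * (norm (A - 0))\<^sup>2"
    using c unfolding strongly_convex_on_def by (elim conjE ballE[of _ _ A] ballE[of _ _ 0] ballE[of _ _ "1/2"]) auto
  moreover have "psi0 lam mu (0 :: real^'m^'m) = 0" using hom[of 0] by (simp add: psi0_def linear_0[OF linear_trace])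
  ultimately show ?thesis using hom[of "1/2"] by (simp add: power2_eq_square field_simps)
qed

text \<open>
  The coefficient \<open>lam\<close> may be negative, so the two terms of \<open>psi0\<close> are not separately convex; the
  quadratic form is handled as a whole.
\<close>
lemma tame_psi0:
  assumes nonneg: "\<And>A :: real^'m^'m. transpose A = A \<Longrightarrow> 0 \<le> psi0 lam mu A"
  shows "tame (\<lambda>A :: real^'m^'m. psi0 lam mu (sym_part A))"
proof -
  \<comment> \<open>The self-adjoint operator whose quadratic form is \<open>psi0\<close> of the symmetric part.\<close>
  define S where "S A = (lam / 2 * trace A) *\<^sub>R mat 1 + mu *\<^sub>R sym_part A" for A :: "real^'m^'m"
  have eq: "A \<bullet> S A = psi0 lam mu (sym_part A)" for A
  proof -
    have "sym_part A \<bullet> sym_part A = A \<bullet> sym_part A"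
      using inner_sym_part[of "sym_part A" A] by (simp add: inner_commute)
    then show ?thesis
      by (simp add: S_def psi0_def trace_mult_symmetric trace_sym_part inner_add_right power2_eq_square
          flip: trace_inner_mat)
  qed
  have "linear S" unfolding S_def
    by (intro linearI) (simp_all add: linear_add[OF linear_trace] linear_scale[OF linear_trace]
      linear_add[OF linear_sym_part] linear_scale[OF linear_sym_part] add_divide_distrib algebra_simps)
  moreover have "S A \<bullet> B = A \<bullet> S B" for A B
  proof -
    have "sym_part A \<bullet> B = A \<bullet> sym_part B"
      by (metis inner_commute inner_sym_part transpose_sym_part)
    then show ?thesis
      by (simp add: S_def inner_add_left inner_add_right inner_commute[of "mat 1"] flip: trace_inner_mat)
  qed
  moreover have "0 \<le> A \<bullet> S A" for A unfolding eq by (rule nonneg) simp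
  ultimately have "tame (\<lambda>A. A \<bullet> S A)" by (rule tame_quadratic)
  then show ?thesis by (simp add: eq)
qed

lemma volumetric_modulus_nonneg:
  assumes nonneg: "\<And>A :: real^'m^'m. transpose A = A \<Longrightarrow> 0 \<le> psi0 lam mu A"
  shows "0 \<le> mu / real CARD('m) + lam / 2"
proof -
  have t: "transpose (mat 1 :: real^'m^'m) = mat 1" by (simp add: transpose_mat)
  have "0 \<le> psi0 lam mu (mat 1 :: real^'m^'m)" using t by (rule nonneg)
  also have "\<dots> = (mu / real CARD('m) + lam / 2) * (real CARD('m))\<^sup>2"
    unfolding psi0_def trace_mult_symmetric[OF t]
    by (simp add: trace_inner_mat inner_mat_1 power2_eq_square field_simps)
  finally show ?thesis by (simp add: zero_le_mult_iff)
qed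

lemma psi_plus_nonneg:
  fixes A :: "real^'m^'m"
  assumes nonneg: "\<And>A :: real^'m^'m. transpose A = A \<Longrightarrow> 0 \<le> psi0 lam mu A"
    and mu: "0 \<le> mu" and lam: "split = Spectral \<Longrightarrow> 0 \<le> lam" and A: "transpose A = A"
  shows "0 \<le> psi_plus split lam mu A"
proof (cases split)
  case Spectral
  obtain l u where "eigenbasis A l u" using spectral_theorem[OF A] by metis
  from sum_eigenvalues[OF this, of "\<lambda>x. (max 0 x)\<^sup>2"] have "0 \<le> (\<Sum>x\<in>#eigenvalues A. (max 0 x)\<^sup>2)"
    by (simp add: sum_nonneg)
  then show ?thesis using Spectral mu lam by simp
qed (use nonneg[OF A] volumetric_modulus_nonneg[OF nonneg] in auto)

lemma tame_psi_parts:
  assumes nonneg: "\<And>A :: real^'m^'m. transpose A = A \<Longrightarrow> 0 \<le> psi0 lam mu A"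
    and mu: "0 \<le> mu" and lam: "split = Spectral \<Longrightarrow> 0 \<le> lam"
  shows "tame (\<lambda>A :: real^'m^'m. psi_plus split lam mu (sym_part A))"
    "tame (\<lambda>A :: real^'m^'m. psi_minus split lam mu (sym_part A))"
proof -
  define tr where "tr A = trace (sym_part A)" for A :: "real^'m^'m"
  have tr: "linear tr" unfolding tr_def by (simp add: trace_sym_part linear_trace)
  have sq: "tame (\<lambda>A. (tr A)\<^sup>2)" "tame (\<lambda>A. (max 0 (tr A))\<^sup>2)" "tame (\<lambda>A. (min 0 (tr A))\<^sup>2)"
    using tame_linear_comp[OF tame_square tr] tame_linear_comp[OF tame_pos_square tr]
      tame_linear_comp[OF tame_neg_square tr] .
  have dev: "tame (\<lambda>A :: real^'m^'m. dev (sym_part A) \<bullet> dev (sym_part A))"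
    using tame_linear_comp[OF tame_inner_self linear_compose[OF linear_sym_part linear_dev]] by (simp add: o_def)
  have spec: "tame (\<lambda>A :: real^'m^'m. \<Sum>x\<in>#eigenvalues (sym_part A). (max 0 x)\<^sup>2)"
     "tame (\<lambda>A :: real^'m^'m. \<Sum>x\<in>#eigenvalues (sym_part A). (min 0 x)\<^sup>2)"
    using tame_convex_spectral_pos tame_convex_spectral_neg unfolding tame_def by blast+
  have \<kappa>: "0 \<le> mu / real CARD('m) + lam / 2" by (rule volumetric_modulus_nonneg[OF nonneg])
  have ev: "\<Sum>\<^sub># (eigenvalues (sym_part A)) = tr A" for A :: "real^'m^'m"
    using sum_eigenvalues_trace(1)[of "sym_part A"] by (simp add: tr_def)
  show "tame (\<lambda>A :: real^'m^'m. psi_plus split lam mu (sym_part A))"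
    using tame_psi0[OF nonneg] \<kappa> mu lam
    by (cases split) (auto simp: ev simp del: times_divide_eq_left simp flip: tr_def intro!: tame_add tame_scale sq spec)
  show "tame (\<lambda>A :: real^'m^'m. psi_minus split lam mu (sym_part A))"
    using \<kappa> mu lam
    by (cases split) (auto simp: ev simp del: times_divide_eq_left simp flip: tr_def intro!: tame_add tame_scale tame_zero sq spec dev)
qed

section \<open>Lagrange elements\<close>

text \<open>
  The partial derivative with respect to \<open>x $ i\<close> of the multilinear polynomial with coefficients \<open>c\<close>.
\<close>
definition slope :: "('m::finite set \<Rightarrow> 'b::real_vector) \<Rightarrow> 'm \<Rightarrow> real^'m \<Rightarrow> 'b" where
  "slope c i x = (\<Sum>I\<in>UNIV. (if i \<in> I then \<Prod>j\<in>I - {i}. x $ j else 0) *\<^sub>R c I)"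

lemma multilinear_poly_line:
  assumes q: "\<And>x. q x = (\<Sum>I\<in>UNIV. (\<Prod>i\<in>I. x $ i) *\<^sub>R c I)"
  shows "q (x + s *\<^sub>R axis i 1) = q x + s *\<^sub>R slope c i x"
proof -
  have "(\<Prod>j\<in>I. (x + s *\<^sub>R axis i 1) $ j) = (\<Prod>j\<in>I. x $ j) + s * (if i \<in> I then \<Prod>j\<in>I - {i}. x $ j else 0)" for I
  proof (cases "i \<in> I")
    case True
    have "(\<Prod>j\<in>I. (x + s *\<^sub>R axis i 1) $ j) = (x $ i + s) * (\<Prod>j\<in>I - {i}. (x + s *\<^sub>R axis i 1) $ j)"
      using True by (subst prod.remove[of I i]) (auto simp: axis_def)
    also have "(\<Prod>j\<in>I - {i}. (x + s *\<^sub>R axis i 1) $ j) = (\<Prod>j\<in>I - {i}. x $ j)"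
      by (rule prod.cong) (auto simp: axis_def)
    also have "(x $ i + s) * (\<Prod>j\<in>I - {i}. x $ j) = (\<Prod>j\<in>I. x $ j) + s * (\<Prod>j\<in>I - {i}. x $ j)"
      using True by (subst prod.remove[of I i]) (auto simp: distrib_right)
    finally show ?thesis using True by simp
  next
    case False
    then have "(\<Prod>j\<in>I. (x + s *\<^sub>R axis i 1) $ j) = (\<Prod>j\<in>I. x $ j)"
      by (intro prod.cong) (auto simp: axis_def)
    then show ?thesis using False by simp
  qed
  then show ?thesis
    by (simp add: q slope_def scaleR_add_left sum.distrib scaleR_sum_right)
qed

lemma multilinear_poly_has_derivative:
  fixes q :: "real^'m \<Rightarrow> 'b::real_normed_vector"
  assumes q: "\<And>x. q x = (\<Sum>I\<in>UNIV. (\<Prod>i\<in>I. x $ i) *\<^sub>R c I)"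
  shows "(q has_derivative (\<lambda>h. \<Sum>i\<in>UNIV. h $ i *\<^sub>R slope c i x)) (at x)"
proof -
  have "((\<lambda>x. \<Sum>I\<in>UNIV. (\<Prod>i\<in>I. x $ i) *\<^sub>R c I) has_derivative
     (\<lambda>h. \<Sum>I\<in>UNIV. (\<Sum>i\<in>I. h $ i * (\<Prod>j\<in>I - {i}. x $ j)) *\<^sub>R c I)) (at x)"
    by (intro has_derivative_sum has_derivative_scaleR_left has_derivative_prod
        bounded_linear_imp_has_derivative bounded_linear_vec_nth)
  moreover have "(\<Sum>I\<in>UNIV. (\<Sum>i\<in>I. h $ i * (\<Prod>j\<in>I - {i}. x $ j)) *\<^sub>R c I)
      = (\<Sum>i\<in>UNIV. h $ i *\<^sub>R slope c i x)" for h :: "real^'m"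
  proof -
    have "(\<Sum>i\<in>UNIV. h $ i *\<^sub>R slope c i x)
        = (\<Sum>i\<in>UNIV. \<Sum>I\<in>UNIV. (if i \<in> I then h $ i * (\<Prod>j\<in>I - {i}. x $ j) else 0) *\<^sub>R c I)"
      unfolding slope_def scaleR_sum_right by (intro sum.cong refl) auto
    also have "\<dots> = (\<Sum>I\<in>UNIV. \<Sum>i\<in>UNIV. (if i \<in> I then h $ i * (\<Prod>j\<in>I - {i}. x $ j) else 0) *\<^sub>R c I)"
      by (rule sum.swap)
    also have "\<dots> = (\<Sum>I\<in>UNIV. (\<Sum>i\<in>I. h $ i * (\<Prod>j\<in>I - {i}. x $ j)) *\<^sub>R c I)"
      by (simp add: sum.inter_restrict[symmetric] flip: scaleR_sum_left)
    finally show ?thesis ..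
  qed
  ultimately show ?thesis by (simp add: q[abs_def])
qed

lemma continuous_on_slope:
  fixes c :: "'m::finite set \<Rightarrow> 'b::real_normed_vector"
  shows "continuous_on S (slope c i)"
proof -
  have "continuous_on S (\<lambda>x. (if i \<in> I then \<Prod>j\<in>I - {i}. x $ j else 0) *\<^sub>R c I)" for I
    by (cases "i \<in> I") (auto intro!: continuous_intros)
  then show ?thesis unfolding slope_def[abs_def] by (intro continuous_on_sum) auto
qed

lemma multilinear_poly_sum:
  assumes "finite K" "\<And>k. k \<in> K \<Longrightarrow> multilinear_poly (q k)"
  shows "multilinear_poly (\<lambda>x. \<Sum>k\<in>K. a k *\<^sub>R q k x)"
proof -
  obtain c where c: "\<And>k x. k \<in> K \<Longrightarrow> q k x = (\<Sum>I\<in>UNIV. (\<Prod>i\<in>I. x $ i) *\<^sub>R c k I)"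
    using assms(2) unfolding multilinear_poly_def by metis
  have "(\<Sum>k\<in>K. a k *\<^sub>R q k x) = (\<Sum>I\<in>UNIV. (\<Prod>i\<in>I. x $ i) *\<^sub>R (\<Sum>k\<in>K. a k *\<^sub>R c k I))" for x
  proof -
    have "(\<Sum>k\<in>K. a k *\<^sub>R q k x) = (\<Sum>k\<in>K. \<Sum>I\<in>UNIV. (\<Prod>i\<in>I. x $ i) *\<^sub>R (a k *\<^sub>R c k I))"
      by (intro sum.cong refl) (simp add: c scaleR_sum_right mult.commute)
    also have "\<dots> = (\<Sum>I\<in>UNIV. \<Sum>k\<in>K. (\<Prod>i\<in>I. x $ i) *\<^sub>R (a k *\<^sub>R c k I))" by (rule sum.swap)
    finally show ?thesis by (simp add: scaleR_sum_right)
  qed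
  then show ?thesis unfolding multilinear_poly_def by (intro exI allI)
qed

text \<open>
  A multilinear polynomial is affine in each coordinate, so each coordinate that is not yet \<open>0\<close> or
  \<open>1\<close> can be replaced by these end values: the value of the polynomial is a convex combination of the two
  results.
\<close>
lemma multilinear_poly_bounds:
  fixes q :: "real^'m \<Rightarrow> real"
  assumes q: "multilinear_poly q"
    and corner: "\<And>x. (\<And>i. x $ i \<in> {0, 1}) \<Longrightarrow> q x \<in> {l..u}"
    and x: "x \<in> cbox 0 1"
  shows "q x \<in> {l..u}"
  using x
proof (induction "card {i. x $ i \<notin> {0, 1}}" arbitrary: x)
  case 0
  then show ?case by (intro corner) auto
next
  case (Suc n)
  obtain c where c: "\<And>x. q x = (\<Sum>I\<in>UNIV. (\<Prod>i\<in>I. x $ i) *\<^sub>R c I)"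
    using q unfolding multilinear_poly_def by blast
  obtain i where i: "x $ i \<notin> {0, 1}"
  proof -
    have "{i. x $ i \<notin> {0, 1}} \<noteq> {}" using Suc.hyps(2) by (metis card.empty nat.distinct(2))
    then show ?thesis using that by blast
  qed
  define y where "y s = x + s *\<^sub>R axis i 1" for s :: real
  have yi: "y s $ j = (if j = i then x $ i + s else x $ j)" for s j by (simp add: y_def axis_def)
  have bounds: "q (y s) \<in> {l..u}" if "x $ i + s \<in> {0, 1}" for s
  proof (rule Suc.hyps(1))
    have "{j. y s $ j \<notin> {0, 1}} = {j. x $ j \<notin> {0, 1}} - {i}" using that by (auto simp: yi)
    then show "n = card {j. y s $ j \<notin> {0, 1}}" using i Suc.hyps(2) by (simp add: card_Diff_singleton)
    show "y s \<in> cbox 0 1" using Suc.prems that by (auto simp: mem_box_cart yi)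
  qed
  define t where "t = x $ i"
  have t: "0 \<le> t" "t \<le> 1" using Suc.prems by (auto simp: mem_box_cart t_def)
  have "q x = (1 - t) * q (y (- t)) + t * q (y (1 - t))"
    unfolding y_def multilinear_poly_line[of q, OF c] by (simp add: algebra_simps)
  moreover have "(1 - t) * l + t * l \<le> (1 - t) * q (y (- t)) + t * q (y (1 - t))"
    using bounds[of "- t"] bounds[of "1 - t"] t by (intro add_mono mult_left_mono) (auto simp: t_def)
  moreover have "(1 - t) * q (y (- t)) + t * q (y (1 - t)) \<le> (1 - t) * u + t * u"
    using bounds[of "- t"] bounds[of "1 - t"] t by (intro add_mono mult_left_mono) (auto simp: t_def)
  ultimately show ?case by (simp add: algebra_simps)
qed

lemma continuous_on_det:
  fixes A :: "'a::topological_space \<Rightarrow> real^'m^'m"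
  assumes "\<And>i j. continuous_on S (\<lambda>x. A x $ i $ j)"
  shows "continuous_on S (\<lambda>x. det (A x))"
  unfolding det_def by (intro continuous_intros assms)

text \<open>
  Cramer's rule expresses the solution through determinants of continuous matrices.
\<close>
lemma continuous_on_linear_solution:
  fixes A :: "'a::topological_space \<Rightarrow> real^'m^'m" and b :: "'a \<Rightarrow> real^'m"
  assumes A: "\<And>i j. continuous_on S (\<lambda>x. A x $ i $ j)" and b: "\<And>i. continuous_on S (\<lambda>x. b x $ i)"
    and det: "\<And>x. x \<in> S \<Longrightarrow> det (A x) \<noteq> 0"
  obtains w where "continuous_on S w" "\<And>x. x \<in> S \<Longrightarrow> A x *v w x = b x"
proof
  define w where "w x = (\<chi> k. det (\<chi> i j. if j = k then b x $ i else A x $ i $ j) / det (A x))" for x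
  show "A x *v w x = b x" if "x \<in> S" for x
    using cramer[OF det[OF that], of "w x" "b x"] by (simp add: w_def)
  have "continuous_on S (\<lambda>x. w x $ k)" for k
  proof -
    have "continuous_on S (\<lambda>x. (\<chi> i j. if j = k then b x $ i else A x $ i $ j) $ i $ j)" for i j
      using A b by (cases "j = k") auto
    then show ?thesis
      unfolding w_def by (auto intro!: continuous_intros continuous_on_det A det)
  qed
  then show "continuous_on S w" by (rule continuous_on_vec_lambda[of S "\<lambda>k x. w x $ k", unfolded vec_nth_inverse])
qed

text \<open>
  The cell \<open>F ` cbox 0 1\<close> of a mapped multilinear element, with a left inverse \<open>G\<close> of its regular
  chart \<open>F\<close>.
\<close>
locale multilinear_chart =
  fixes F :: "real^'m \<Rightarrow> real^'m" and c :: "'m set \<Rightarrow> real^'m" and G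
  assumes F: "\<And>x. F x = (\<Sum>I\<in>UNIV. (\<Prod>i\<in>I. x $ i) *\<^sub>R c I)"
    and inj: "inj_on F (cbox 0 1)"
    and reg: "\<And>x. x \<in> cbox 0 1 \<Longrightarrow> \<exists>F'. (F has_derivative F') (at x) \<and> bij F'"
    and poly: "polytope (F ` cbox 0 1)"
    and G: "\<And>x. x \<in> cbox 0 1 \<Longrightarrow> G (F x) = x"
begin

definition "DF x h = (\<Sum>i\<in>UNIV. h $ i *\<^sub>R slope c i x)"

lemma DF: "(F has_derivative DF x) (at x)"
  unfolding DF_def using multilinear_poly_has_derivative[of F, OF F] .

lemma bij_DF: "x \<in> cbox 0 1 \<Longrightarrow> bij (DF x)"
  using reg[of x] has_derivative_unique[OF DF] by metis

lemma linear_DF: "linear (DF x)"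
  using DF has_derivative_linear by blast

lemma continuous_F: "continuous_on S F"
  using DF by (meson continuous_at_imp_continuous_on has_derivative_continuous)

lemma continuous_G: "continuous_on (F ` cbox 0 1) G"
  using continuous_on_inv[OF continuous_F compact_cbox] G by blast

lemma G_in: "y \<in> F ` cbox 0 1 \<Longrightarrow> G y \<in> cbox 0 1 \<and> F (G y) = y"
  using G by auto

lemma G_derivative:
  assumes "x \<in> cbox 0 1"
  shows "(G has_derivative inv (DF x)) (at (F x) within F ` cbox 0 1)"
proof (rule has_derivative_inverse_within)
  show "(F has_derivative DF x) (at x within cbox 0 1)" using DF by (rule has_derivative_at_withinI)
  show "continuous (at (F x) within F ` cbox 0 1) G"
    using continuous_G assms by (auto simp: continuous_on_eq_continuous_within)
  show "linear (inv (DF x))"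
    using linear_DF bij_DF[OF assms] by (simp add: inj_linear_imp_inv_linear bij_is_inj)
  show "inv (DF x) \<circ> DF x = id" using bij_DF[OF assms] by (simp add: bij_is_inj)
qed (use assms G in auto)

lemma interior_nonempty: "interior (F ` cbox 0 1) \<noteq> {}"
proof -
  have "open (F ` box 0 1)"
    using inj_on_subset[OF inj box_subset_cbox] by (intro invariance_of_domain continuous_F open_box)
  moreover have "F ` box 0 1 \<subseteq> F ` cbox 0 1" using box_subset_cbox by blast
  moreover have "box (0 :: real^'m) 1 \<noteq> {}" by (simp add: interval_ne_empty_cart)
  moreover from calculation have "F ` box 0 1 \<subseteq> interior (F ` cbox 0 1)"
    by (intro interior_maximal)
  ultimately show ?thesis by blast
qed

text \<open>
  If the image of a corner were an inner point of a segment in the cell, the preimage of this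
  segment would be a curve in the cube through the corner. Each coordinate of the curve is extremal
  at the corner, so its derivative vanishes there; but this derivative is the image of a nonzero
  vector under an invertible map.
\<close>
lemma corner_extreme:
  assumes x: "\<And>i. x $ i \<in> {0, 1}"
  shows "F x extreme_point_of (F ` cbox 0 1)"
proof -
  let ?e = "F ` cbox 0 1"
  have xin: "x \<in> cbox 0 1" using x by (auto simp: mem_box_cart) (metis insertE order.refl singletonD zero_le_one)+
  have False if ab: "a \<in> ?e" "b \<in> ?e" and seg: "F x \<in> open_segment a b" for a b
  proof -
    obtain \<tau> where \<tau>: "0 < \<tau>" "\<tau> < 1" "F x = (1 - \<tau>) *\<^sub>R a + \<tau> *\<^sub>R b" and "a \<noteq> b"
      using seg by (auto simp: in_segment)
    define w where "w = b - a"
    define S where "S = {-\<tau><..<1 - \<tau>}"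
    have conv: "convex ?e" using poly by (rule polytope_imp_convex)
    have line: "F x + t *\<^sub>R w \<in> ?e" if "t \<in> S" for t
    proof -
      have "F x + t *\<^sub>R w = (1 - (\<tau> + t)) *\<^sub>R a + (\<tau> + t) *\<^sub>R b" by (simp add: \<tau>(3) w_def algebra_simps)
      then show ?thesis using convexD_alt[OF conv ab, of "\<tau> + t"] that by (simp add: S_def)
    qed
    have "((\<lambda>t. F x + t *\<^sub>R w) has_derivative (\<lambda>t. t *\<^sub>R w)) (at 0 within S)"
      by (auto intro!: derivative_eq_intros)
    moreover have "(G has_derivative inv (DF x)) (at (F x + 0 *\<^sub>R w) within (\<lambda>t. F x + t *\<^sub>R w) ` S)"
      using G_derivative[OF xin] line by (auto intro: has_derivative_subset)
    ultimately have "(G \<circ> (\<lambda>t. F x + t *\<^sub>R w) has_derivative inv (DF x) \<circ> (\<lambda>t. t *\<^sub>R w)) (at 0 within S)"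
      by (rule diff_chain_within)
    moreover have S0: "open S" "0 \<in> S" using \<tau> by (auto simp: S_def)
    ultimately have d: "((\<lambda>t. G (F x + t *\<^sub>R w)) has_derivative (\<lambda>t. inv (DF x) (t *\<^sub>R w))) (at 0)"
      using at_within_open[OF S0(2,1)] by (simp add: o_def)
    have "inv (DF x) w $ i = 0" for i
    proof -
      have "((\<lambda>t. G (F x + t *\<^sub>R w) $ i) has_derivative (\<lambda>t. inv (DF x) (t *\<^sub>R w) $ i)) (at 0)"
        using d by (rule bounded_linear.has_derivative[OF bounded_linear_vec_nth])
      moreover have "G (F x + t *\<^sub>R w) $ i \<in> {0..1}" if "t \<in> S" for t
        using G_in[OF line[OF that]] by (auto simp: mem_box_cart)
      moreover have "G (F x) = x" using G xin by simp
      ultimately have "(\<lambda>t. inv (DF x) (t *\<^sub>R w) $ i) = (\<lambda>v. 0)"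
        using x[of i] S0 by (intro differential_zero_maxmin[of 0 S "\<lambda>t. G (F x + t *\<^sub>R w) $ i"]) auto
      from fun_cong[OF this, of 1] show ?thesis by simp
    qed
    then have "inv (DF x) w = 0" by (simp add: vec_eq_iff)
    then have "w = DF x 0" using bij_DF[OF xin] by (metis bij_inv_eq_iff)
    then have "w = 0" using linear_0[OF linear_DF] by simp
    then show False using \<open>a \<noteq> b\<close> by (simp add: w_def)
  qed
  then show ?thesis using xin unfolding extreme_point_of_def by blast
qed

text \<open>
  The shape function is \<open>q \<circ> G\<close> on the cell, so its gradient solves a linear system with the
  transposed derivative of the chart, which is invertible up to the boundary of the cube.
\<close>
lemma shape_gradient:
  assumes q: "multilinear_poly q" and v: "\<And>x. x \<in> cbox 0 1 \<Longrightarrow> v (F x) = (q x :: real)"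
  obtains v' where "continuous_on (F ` cbox 0 1) v'"
    "\<And>y. y \<in> F ` cbox 0 1 \<Longrightarrow> (v has_derivative (\<lambda>h. v' y \<bullet> h)) (at y within F ` cbox 0 1)"
proof -
  let ?e = "F ` cbox 0 1"
  obtain b where b: "\<And>x. q x = (\<Sum>I\<in>UNIV. (\<Prod>i\<in>I. x $ i) *\<^sub>R b I)"
    using q unfolding multilinear_poly_def by blast
  define A where "A x = (\<chi> i. slope c i x)" for x
  have A: "A x *v w = (\<chi> i. w \<bullet> slope c i x)" for x w
    by (simp add: A_def matrix_vector_mult_def inner_vec_def mult.commute)
  have At: "transpose (A x) = matrix (DF x)" for x
    by (simp add: A_def DF_def matrix_def transpose_def vec_eq_iff axis_def if_distrib[of "\<lambda>x. x * _"] sum.delta cong: if_cong)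
  have det: "det (A x) \<noteq> 0" if "x \<in> cbox 0 1" for x
  proof -
    have "det (matrix (DF x)) \<noteq> 0" using det_nz_iff_inj[OF linear_DF] bij_DF[OF that] by (simp add: bij_is_inj)
    then show ?thesis using det_transpose[of "A x"] by (simp add: At)
  qed
  have Gc: "continuous_on ?e (\<lambda>y. slope d i (G y))" for d :: "'m set \<Rightarrow> 'b::real_normed_vector" and i
    by (rule continuous_on_compose2[OF continuous_on_slope continuous_G]) auto
  obtain v' where v': "continuous_on ?e v'"
    "\<And>y. y \<in> ?e \<Longrightarrow> A (G y) *v v' y = (\<chi> i. slope b i (G y))"
  proof (rule continuous_on_linear_solution[of ?e "\<lambda>y. A (G y)" "\<lambda>y. \<chi> i. slope b i (G y)"], goal_cases)
    case (1 i j)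
    show ?case unfolding A_def by (simp, intro continuous_intros Gc)
  next
    case (2 i)
    show ?case by (simp add: Gc)
  next
    case (3 y)
    then show ?case using G_in[of y] det by blast
  next
    case (4 w)
    show ?case by (rule 4(1)[OF 4(2,3)])
  qed
  have "(v has_derivative (\<lambda>h. v' y \<bullet> h)) (at y within ?e)" if y: "y \<in> ?e" for y
  proof -
    define x where "x = G y"
    have x: "x \<in> cbox 0 1" "F x = y" using G_in[OF y] by (auto simp: x_def)
    let ?Dq = "\<lambda>h. \<Sum>i\<in>UNIV. h $ i *\<^sub>R slope b i x"
    have "(G has_derivative inv (DF x)) (at y within ?e)" using G_derivative[OF x(1)] x(2) by simp
    moreover have "(q has_derivative ?Dq) (at (G y) within G ` ?e)"
      using multilinear_poly_has_derivative[of q, OF b] x_def has_derivative_at_withinI by blast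
    ultimately have "(q \<circ> G has_derivative ?Dq \<circ> inv (DF x)) (at y within ?e)"
      by (rule diff_chain_within)
    then have "(v has_derivative ?Dq \<circ> inv (DF x)) (at y within ?e)"
    proof (rule has_derivative_transform[OF y, rotated])
      show "v z = (q \<circ> G) z" if "z \<in> ?e" for z using G_in[OF that] v by (metis comp_apply)
    qed
    moreover have "?Dq \<circ> inv (DF x) = (\<lambda>h. v' y \<bullet> h)"
    proof
      fix h
      define k where "k = inv (DF x) h"
      have h: "h = DF x k" using bij_DF[OF x(1)] by (simp add: k_def bij_is_surj surj_f_inv_f)
      have "slope b i x = v' y \<bullet> slope c i x" for i
        using v'(2)[OF y] unfolding A x_def[symmetric] by (simp add: vec_eq_iff)
      then have "?Dq k = (\<Sum>i\<in>UNIV. k $ i * (v' y \<bullet> slope c i x))" by simp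
      also have "\<dots> = v' y \<bullet> h" by (simp add: h DF_def inner_sum_right)
      finally show "(?Dq \<circ> inv (DF x)) h = v' y \<bullet> h" by (simp add: k_def)
    qed
    ultimately show ?thesis by simp
  qed
  with v'(1) show ?thesis by (rule that)
qed

end

lemma lagrange_element_cases:
  fixes e :: "(real^'m) set"
  assumes "lagrange_element e V"
  obtains (simplex) "int CARD('m) simplex e" "V = {v. \<exists>a b. \<forall>x\<in>e. v x = a \<bullet> x + b}"
  | (cube) F c G where "multilinear_chart F c G" "e = F ` cbox 0 1"
      "V = {v. \<exists>q. multilinear_poly q \<and> (\<forall>x\<in>cbox 0 1. v (F x) = q x)}"
  using assms unfolding lagrange_element_def
proof (elim disjE exE conjE)
  fix F :: "real^'m \<Rightarrow> real^'m"
  assume F: "multilinear_poly F" "inj_on F (cbox 0 1)"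
        "\<forall>x\<in>cbox 0 1. \<exists>F'. (F has_derivative F') (at x) \<and> bij F'"
        "e = F ` cbox 0 1" "polytope e"
        "V = {v. \<exists>q. multilinear_poly q \<and> (\<forall>x\<in>cbox 0 1. v (F x) = q x)}"
  obtain c where "\<And>x. F x = (\<Sum>I\<in>UNIV. (\<Prod>i\<in>I. x $ i) *\<^sub>R c I)"
    using F(1) unfolding multilinear_poly_def by blast
  moreover have "inv_into (cbox 0 1) F (F x) = x" if "x \<in> cbox 0 1" for x
    using F(2) that by (rule inv_into_f_f)
  ultimately have "multilinear_chart F c (inv_into (cbox 0 1) F)"
    using F(2,3,5) unfolding F(4) multilinear_chart_def by blast
  from this F(4,6) show ?thesis by (rule cube)
qed (rule simplex)

lemma lagrange_element_polytope:
  fixes e :: "(real^'m) set"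
  assumes "lagrange_element e V"
  shows "polytope e" "interior e \<noteq> {}"
proof -
  have "polytope e \<and> interior e \<noteq> {}"
    using assms
  proof (cases rule: lagrange_element_cases)
    case simplex
    then obtain C where C: "\<not> affine_dependent C" "int (card C) = int CARD('m) + 1" "e = convex hull C"
      unfolding simplex_def by blast
    have "aff_dim e = int CARD('m)" using aff_dim_affine_independent[OF C(1)] C by (simp add: aff_dim_convex_hull)
    then have "affine hull e = UNIV" using aff_dim_eq_full[of e] by simp
    moreover have "convex e" "e \<noteq> {}" using C by (auto simp: convex_convex_hull)
    ultimately have "interior e \<noteq> {}" using rel_interior_eq_empty rel_interior_interior by metis
    then show ?thesis using simplex simplex_imp_polytope by blast
  next
    case (cube F c G)
    then interpret multilinear_chart F c G by simp
    show ?thesis using cube poly interior_nonempty by simp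
  qed
  then show "polytope e" "interior e \<noteq> {}" by auto
qed

lemma lagrange_element_gradient:
  fixes e :: "(real^'m) set"
  assumes "lagrange_element e V" "v \<in> V"
  obtains v' where "continuous_on e v'"
    "\<And>x. x \<in> e \<Longrightarrow> (v has_derivative (\<lambda>h. v' x \<bullet> h)) (at x within e)"
  using assms(1)
proof (cases rule: lagrange_element_cases)
  case simplex
  then obtain a b where ab: "\<And>x. x \<in> e \<Longrightarrow> v x = a \<bullet> x + b" using assms(2) by blast
  have d: "((\<lambda>x. a \<bullet> x + b) has_derivative (\<lambda>h. a \<bullet> h)) (at x within e)" for x
    by (auto intro!: derivative_eq_intros)
  have "(v has_derivative (\<lambda>h. a \<bullet> h)) (at x within e)" if "x \<in> e" for x
    by (rule has_derivative_transform[OF that ab d])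
  then show ?thesis using that[of "\<lambda>_. a"] by (simp add: continuous_on_const)
next
  case (cube F c G)
  then interpret multilinear_chart F c G by simp
  obtain q where q: "multilinear_poly q" "\<And>x. x \<in> cbox 0 1 \<Longrightarrow> v (F x) = q x" using cube assms(2) by blast
  show ?thesis using shape_gradient[OF q] that unfolding cube(2) by metis
qed

lemma lagrange_element_sum:
  fixes v :: "'k \<Rightarrow> real^'m \<Rightarrow> real"
  assumes "lagrange_element e V" "finite K" "\<And>k. k \<in> K \<Longrightarrow> v k \<in> V"
  shows "(\<lambda>x. \<Sum>k\<in>K. a k * v k x) \<in> V"
  using assms(1)
proof (cases rule: lagrange_element_cases)
  case simplex
  have "\<forall>k\<in>K. \<exists>c d. \<forall>x\<in>e. v k x = c \<bullet> x + d" using assms(3) simplex by blast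
  then obtain c d where cd: "\<And>k x. k \<in> K \<Longrightarrow> x \<in> e \<Longrightarrow> v k x = c k \<bullet> x + d k" by metis
  have "(\<Sum>k\<in>K. a k * v k x) = (\<Sum>k\<in>K. a k *\<^sub>R c k) \<bullet> x + (\<Sum>k\<in>K. a k * d k)" if "x \<in> e" for x
    by (simp add: inner_sum_left cd[OF _ that] distrib_left sum.distrib)
  then show ?thesis using simplex by blast
next
  case (cube F c G)
  have "\<forall>k\<in>K. \<exists>q. multilinear_poly q \<and> (\<forall>x\<in>cbox 0 1. v k (F x) = q x)" using assms(3) cube by blast
  then obtain q where q: "\<And>k. k \<in> K \<Longrightarrow> multilinear_poly (q k)"
    "\<And>k x. k \<in> K \<Longrightarrow> x \<in> cbox 0 1 \<Longrightarrow> v k (F x) = q k x" by metis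
  have "multilinear_poly (\<lambda>x. \<Sum>k\<in>K. a k *\<^sub>R q k x)" using multilinear_poly_sum assms(2) q(1) by blast
  moreover have "\<forall>x\<in>cbox 0 1. (\<Sum>k\<in>K. a k * v k (F x)) = (\<Sum>k\<in>K. a k *\<^sub>R q k x)" using q(2) by simp
  ultimately show ?thesis unfolding cube(3) by blast
qed

text \<open>
  A shape function is bounded by its vertex values. For mapped cells this relies on the corners of
  the cube being mapped to extreme points, where the nodes are.
\<close>
lemma lagrange_element_bounds:
  fixes e :: "(real^'m) set"
  assumes "lagrange_element e V" "v \<in> V"
    and ext: "\<And>x. x extreme_point_of e \<Longrightarrow> v x \<in> {l..u}" and x: "x \<in> e"
  shows "v x \<in> {l..u}"
  using assms(1)
proof (cases rule: lagrange_element_cases)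
  case simplex
  then obtain a b where ab: "\<And>x. x \<in> e \<Longrightarrow> v x = a \<bullet> x + b" using assms(2) by blast
  have "convex {x. a \<bullet> x + b \<in> {l..u}}"
  proof -
    have "{x. a \<bullet> x + b \<in> {l..u}} = {x. a \<bullet> x \<le> u - b} \<inter> {x. a \<bullet> x \<ge> l - b}" by auto
    then show ?thesis by (simp add: convex_Int convex_halfspace_le convex_halfspace_ge)
  qed
  moreover have "{x. x extreme_point_of e} \<subseteq> {x. a \<bullet> x + b \<in> {l..u}}"
    using ext ab by (force simp: extreme_point_of_def)
  ultimately have "convex hull {x. x extreme_point_of e} \<subseteq> {x. a \<bullet> x + b \<in> {l..u}}"
    by (rule hull_minimal[rotated])
  moreover have "e = convex hull {x. x extreme_point_of e}"
    using lagrange_element_polytope(1)[OF assms(1)]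
    by (intro Krein_Milman_Minkowski) (auto simp: polytope_imp_compact polytope_imp_convex)
  ultimately have "a \<bullet> x + b \<in> {l..u}" using x by auto
  then show ?thesis using x by (simp add: ab)
next
  case (cube F c G)
  then interpret multilinear_chart F c G by simp
  obtain q where q: "multilinear_poly q" "\<And>x. x \<in> cbox 0 1 \<Longrightarrow> v (F x) = q x" using cube assms(2) by blast
  obtain z where z: "z \<in> cbox 0 1" "x = F z" using x cube by blast
  have "q z \<in> {l..u}"
  proof (rule multilinear_poly_bounds[OF q(1) _ z(1)])
    fix y :: "real^'m" assume y: "\<And>i. y $ i \<in> {0, 1}"
    then have "y \<in> cbox 0 1" by (auto simp: mem_box_cart) (metis insertE order.refl singletonD zero_le_one)+
    then show "q y \<in> {l..u}" using ext[OF corner_extreme[OF y, folded cube(2)]] q(2) by simp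
  qed
  then show ?thesis using q(2) z by simp
qed

section \<open>Finite element functions on a grid\<close>

text \<open>
  Quadrature points may lie on the boundary of an element. One-sided derivatives are still unique
  there: along the segment to any \<open>z\<close> in \<open>e\<close> the derivative is determined, and the directions
  \<open>z - x\<close> contain an open set.
\<close>
lemma has_derivative_unique_convex_body:
  fixes f :: "'a::euclidean_space \<Rightarrow> 'b::real_normed_vector"
  assumes e: "convex e" "interior e \<noteq> {}" and x: "x \<in> e"
    and D: "(f has_derivative D) (at x within e)" and D': "(f has_derivative D') (at x within e)"
  shows "D = D'"
proof -
  have lin: "linear D" "linear D'" using D D' by (auto dest: has_derivative_linear)
  have eq: "D (z - x) = D' (z - x)" if z: "z \<in> e" for z
  proof -
    have sub: "(\<lambda>t. x + t *\<^sub>R (z - x)) ` cbox 0 1 \<subseteq> e"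
    proof safe
      fix t :: real assume "t \<in> cbox 0 1"
      then have "(1 - t) *\<^sub>R x + t *\<^sub>R z \<in> e" using convexD_alt[OF e(1) x z] by auto
      then show "x + t *\<^sub>R (z - x) \<in> e" by (simp add: algebra_simps)
    qed
    have *: "((\<lambda>t. f (x + t *\<^sub>R (z - x))) has_vector_derivative E (z - x)) (at 0 within cbox 0 1)"
      if E: "(f has_derivative E) (at x within e)" for E
    proof -
      have "((\<lambda>t. x + t *\<^sub>R (z - x)) has_derivative (\<lambda>t. t *\<^sub>R (z - x))) (at 0 within cbox 0 1)"
        by (auto intro!: derivative_eq_intros)
      moreover have "(f has_derivative E) (at (x + 0 *\<^sub>R (z - x)) within (\<lambda>t. x + t *\<^sub>R (z - x)) ` cbox 0 1)"
        using has_derivative_subset[OF E sub] by simp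
      ultimately have "(f \<circ> (\<lambda>t. x + t *\<^sub>R (z - x)) has_derivative E \<circ> (\<lambda>t. t *\<^sub>R (z - x))) (at 0 within cbox 0 1)"
        by (rule diff_chain_within)
      moreover have "E (t *\<^sub>R (z - x)) = t *\<^sub>R E (z - x)" for t
        using has_derivative_linear[OF E] by (rule linear_scale)
      ultimately show ?thesis by (simp add: has_vector_derivative_def o_def)
    qed
    show ?thesis
      by (rule vector_derivative_unique_within_closed_interval[OF _ _ *[OF D] *[OF D']]) auto
  qed
  obtain y r where r: "r > 0" "ball y r \<subseteq> e"
    using e(2) mem_interior by blast
  show ?thesis
  proof
    fix h :: 'a
    obtain s where s: "s > 0" "s * norm h < r" using small_scaling[OF r(1)] by metis
    then have "y + s *\<^sub>R h \<in> e" "y \<in> e" using r s by (auto simp: dist_norm intro!: subsetD[OF r(2)])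
    then have "D (y + s *\<^sub>R h - x) - D (y - x) = D' (y + s *\<^sub>R h - x) - D' (y - x)" by (simp add: eq)
    then have "s *\<^sub>R D h = s *\<^sub>R D' h"
      by (simp add: linear_diff[OF lin(1), symmetric] linear_diff[OF lin(2), symmetric]
          linear_scale[OF lin(1), symmetric] linear_scale[OF lin(2), symmetric])
    then show "D h = D' h" using s by simp
  qed
qed

definition fe_jacobian :: "('n::finite \<Rightarrow> real^'m) \<Rightarrow> real^'k^'n \<Rightarrow> real^'m^'k" where
  "fe_jacobian D u = (\<chi> a b. \<Sum>i\<in>UNIV. D i $ b * u $ i $ a)"

lemma fe_jacobian_mult: "fe_jacobian D u *v h = (\<Sum>i\<in>UNIV. (D i \<bullet> h) *\<^sub>R u $ i)"
proof -
  have "(\<Sum>b\<in>UNIV. (\<Sum>i\<in>UNIV. D i $ b * u $ i $ a) * h $ b) = (\<Sum>i\<in>UNIV. (D i \<bullet> h) * u $ i $ a)" for a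
  proof -
    have "(\<Sum>b\<in>UNIV. (\<Sum>i\<in>UNIV. D i $ b * u $ i $ a) * h $ b)
        = (\<Sum>b\<in>UNIV. \<Sum>i\<in>UNIV. D i $ b * h $ b * u $ i $ a)"
      unfolding sum_distrib_right by (intro sum.cong refl) (simp add: mult_ac)
    also have "\<dots> = (\<Sum>i\<in>UNIV. \<Sum>b\<in>UNIV. D i $ b * h $ b * u $ i $ a)" by (rule sum.swap)
    finally show ?thesis by (simp add: inner_vec_def sum_distrib_right)
  qed
  then show ?thesis by (simp add: fe_jacobian_def matrix_vector_mult_def vec_eq_iff)
qed

lemma linear_fe_jacobian: "linear (fe_jacobian D)"
  by (intro linearI) (simp_all add: fe_jacobian_def vec_eq_iff distrib_left sum.distrib sum_distrib_left mult_ac)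

locale lagrange_grid =
  fixes \<Omega> :: "(real^'m) set" and \<G> :: "(real^'m) set set"
    and V :: "(real^'m) set \<Rightarrow> (real^'m \<Rightarrow> real) set"
    and p :: "'n::finite \<Rightarrow> real^'m" and \<theta> :: "'n \<Rightarrow> real^'m \<Rightarrow> real"
  assumes domain: "polyhedral_domain \<Omega>"
    and grid: "conforming_grid \<Omega> \<G> V"
    and basis: "nodal_basis \<G> V p \<theta>"
begin

lemma finite_grid: "finite \<G>" and closure_domain: "closure \<Omega> = \<Union>\<G>"
  and lagrange: "e \<in> \<G> \<Longrightarrow> lagrange_element e (V e)"
  using grid by (auto simp: conforming_grid_def)

lemma open_domain: "open \<Omega>" and connected_domain: "connected \<Omega>"
  and nonempty_domain: "\<Omega> \<noteq> {}"
  using domain by (auto simp: polyhedral_domain_def)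

lemma element:
  assumes "e \<in> \<G>"
  shows "polytope e" "convex e" "compact e" "closed e" "interior e \<noteq> {}" "closure (interior e) = e"
proof -
  show e: "polytope e" "interior e \<noteq> {}" using lagrange_element_polytope lagrange assms by blast+
  then show "convex e" "compact e" "closed e"
    by (auto simp: polytope_imp_convex polytope_imp_compact compact_imp_closed)
  then show "closure (interior e) = e" using e convex_closure_interior by (metis closure_closed)
qed

definition shape_grad :: "(real^'m) set \<Rightarrow> 'n \<Rightarrow> real^'m \<Rightarrow> real^'m" where
  "shape_grad e i = (SOME v'. continuous_on e v' \<and>
     (\<forall>x\<in>e. (\<theta> i has_derivative (\<lambda>h. v' x \<bullet> h)) (at x within e)))"

lemma shape_grad:
  assumes e: "e \<in> \<G>"
  shows "continuous_on e (shape_grad e i)"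
    "x \<in> e \<Longrightarrow> (\<theta> i has_derivative (\<lambda>h. shape_grad e i x \<bullet> h)) (at x within e)"
proof -
  have "\<theta> i \<in> V e" using basis e by (auto simp: nodal_basis_def)
  then have "\<exists>v'. continuous_on e v' \<and> (\<forall>x\<in>e. (\<theta> i has_derivative (\<lambda>h. v' x \<bullet> h)) (at x within e))"
    using lagrange_element_gradient[OF lagrange[OF e]] by metis
  from someI_ex[OF this, folded shape_grad_def] show "continuous_on e (shape_grad e i)"
    "x \<in> e \<Longrightarrow> (\<theta> i has_derivative (\<lambda>h. shape_grad e i x \<bullet> h)) (at x within e)"
    by auto
qed

lemma fe_fun_derivative:
  fixes c :: "'b::real_normed_vector^'n"
  assumes "e \<in> \<G>" "x \<in> e"
  shows "(fe_fun \<theta> c has_derivative (\<lambda>h. \<Sum>i\<in>UNIV. (shape_grad e i x \<bullet> h) *\<^sub>R c $ i)) (at x within e)"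
  unfolding fe_fun_def[abs_def]
  by (intro has_derivative_sum has_derivative_scaleR_left shape_grad(2) assms)

lemma strain_fe_fun:
  fixes u :: "real^'m^'n"
  assumes e: "e \<in> \<G>" "x \<in> e"
  shows "strain e (fe_fun \<theta> u) x = sym_part (fe_jacobian (\<lambda>i. shape_grad e i x) u)"
proof -
  let ?D = "\<lambda>h. \<Sum>i\<in>UNIV. (shape_grad e i x \<bullet> h) *\<^sub>R u $ i"
  have "frechet_derivative (fe_fun \<theta> u) (at x within e) = ?D"
    using has_derivative_unique_convex_body[OF element(2,5)[OF e(1)] e(2) _ fe_fun_derivative[OF e]]
      fe_fun_derivative[OF e] frechet_derivative_works differentiableI by blast
  also have "?D = (*v) (fe_jacobian (\<lambda>i. shape_grad e i x) u)" by (rule ext) (simp add: fe_jacobian_mult)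
  finally show ?thesis by (simp add: strain_def Let_def sym_part_def)
qed

lemma linear_strain:
  assumes "e \<in> \<G>" "x \<in> e"
  shows "linear (\<lambda>u :: real^'m^'n. strain e (fe_fun \<theta> u) x)"
  unfolding strain_fe_fun[OF assms]
  using linear_compose[OF linear_fe_jacobian linear_sym_part] by (simp add: o_def)

lemma transpose_strain: "transpose (strain e f x) = strain e f x"
  by (simp add: strain_def Let_def transpose_linear add.commute)

lemma continuous_on_strain:
  fixes u :: "real^'m^'n"
  assumes e: "e \<in> \<G>"
  shows "continuous_on e (strain e (fe_fun \<theta> u))"
proof -
  have "continuous_on e (\<lambda>x. sym_part (fe_jacobian (\<lambda>i. shape_grad e i x) u))"
    unfolding fe_jacobian_def sym_part_def transpose_def
    by (intro continuous_intros continuous_on_vec_lambda shape_grad(1)[OF e])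
  then show ?thesis by (rule continuous_on_eq) (simp add: strain_fe_fun[OF e])
qed

lemma grad_fe_fun:
  fixes d :: "real^'n"
  assumes e: "e \<in> \<G>" "x \<in> interior e"
  shows "grad (fe_fun \<theta> d) x = (\<Sum>i\<in>UNIV. d $ i *\<^sub>R shape_grad e i x)"
proof (rule grad_eqI)
  have "(fe_fun \<theta> d has_derivative (\<lambda>h. \<Sum>i\<in>UNIV. (shape_grad e i x \<bullet> h) *\<^sub>R d $ i)) (at x)"
    using fe_fun_derivative[OF e(1), of x d] e(2) interior_subset at_within_interior[OF e(2)] by auto
  then show "GDERIV (fe_fun \<theta> d) x :> (\<Sum>i\<in>UNIV. d $ i *\<^sub>R shape_grad e i x)"
    unfolding gderiv_def by (simp add: inner_sum_right inner_commute mult.commute)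
qed

lemma grad_shape_fun:
  assumes e: "e \<in> \<G>" "x \<in> interior e"
  shows "grad (\<theta> i) x = shape_grad e i x"
proof (rule grad_eqI)
  have "(\<theta> i has_derivative (\<lambda>h. shape_grad e i x \<bullet> h)) (at x)"
    using shape_grad(2)[OF e(1), of x i] e(2) interior_subset at_within_interior[OF e(2)] by auto
  then show "GDERIV (\<theta> i) x :> shape_grad e i x"
    unfolding gderiv_def by (simp add: inner_commute)
qed

lemma continuous_on_fe_fun:
  fixes c :: "'b::real_normed_vector^'n"
  shows "continuous_on (closure \<Omega>) (fe_fun \<theta> c)"
  unfolding fe_fun_def[abs_def] closure_domain
  using basis by (intro continuous_intros) (auto simp: nodal_basis_def)

lemma fe_fun_node:
  fixes c :: "'b::real_vector^'n"
  shows "fe_fun \<theta> c (p j) = c $ j"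
proof -
  have "\<theta> i (p j) = (if i = j then 1 else 0)" for i using basis by (auto simp: nodal_basis_def)
  then show ?thesis by (simp add: fe_fun_def if_distrib[of "\<lambda>x. x *\<^sub>R _"] sum.delta cong: if_cong)
qed

lemma fe_fun_bounds:
  fixes d :: "real^'n"
  assumes d: "\<And>i. d $ i \<in> {a..b}" and e: "e \<in> \<G>" "x \<in> e"
  shows "fe_fun \<theta> d x \<in> {a..b}"
proof (rule lagrange_element_bounds[OF lagrange[OF e(1)] _ _ e(2)])
  have "(\<lambda>x. \<Sum>i\<in>UNIV. d $ i * \<theta> i x) \<in> V e"
    using basis e by (intro lagrange_element_sum[OF lagrange[OF e(1)]]) (auto simp: nodal_basis_def)
  then show "fe_fun \<theta> d \<in> V e" by (simp add: fe_fun_def[abs_def] mult.commute)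
  fix y assume "y extreme_point_of e"
  then have "y \<in> range p" using basis e(1) by (auto simp: nodal_basis_def)
  then show "fe_fun \<theta> d y \<in> {a..b}" using d by (auto simp: fe_fun_node)
qed

end

section \<open>Crack energy\<close>

lemma absolutely_integrable_compact:
  fixes f :: "'a::euclidean_space \<Rightarrow> 'b::euclidean_space"
  assumes "compact e" "continuous_on e f"
  shows "f absolutely_integrable_on e"
proof -
  have int: "integrable lborel (\<lambda>x. indicator e x *\<^sub>R f x)" using assms by (rule borel_integrable_compact)
  show ?thesis
    unfolding set_integrable_def using integrable_completion[OF borel_measurable_integrable[OF int]] int by blast
qed

context lagrange_grid
begin

text \<open>
  Each point of the domain lies in an element, and boundaries of convex sets are null sets.
\<close>
lemma negligible_skeleton: "negligible (\<Omega> - (\<Union>e\<in>\<G>. interior e))"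
proof (rule negligible_subset)
  show "negligible (\<Union>e\<in>\<G>. frontier e)"
    using finite_grid negligible_convex_frontier element(2) by (intro negligible_Union) auto
  show "\<Omega> - (\<Union>e\<in>\<G>. interior e) \<subseteq> (\<Union>e\<in>\<G>. frontier e)"
  proof
    fix x assume x: "x \<in> \<Omega> - (\<Union>e\<in>\<G>. interior e)"
    then have "x \<in> \<Union>\<G>" using closure_subset closure_domain by blast
    then obtain e where "e \<in> \<G>" "x \<in> e" by blast
    then show "x \<in> (\<Union>e\<in>\<G>. frontier e)" using x by (auto simp: frontier_def element(4))
  qed
qed

text \<open>
  The gradient of a finite element function jumps across element boundaries, so integrability is
  obtained element by element.
\<close>
lemma piecewise_continuous_integrable:
  fixes f :: "real^'m \<Rightarrow> real"
  assumes "\<And>e. e \<in> \<G> \<Longrightarrow> \<exists>g. continuous_on e g \<and> (\<forall>x\<in>interior e. f x = g x)"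
  shows "f integrable_on \<Omega>"
proof -
  have meas: "\<Omega> \<inter> interior e \<in> sets lebesgue" for e
    using borel_open[OF open_Int[OF open_domain open_interior[of e]]] by simp
  have 1: "f absolutely_integrable_on (\<Omega> \<inter> interior e)" if e: "e \<in> \<G>" for e
  proof -
    obtain g where g: "continuous_on e g" "\<And>x. x \<in> interior e \<Longrightarrow> f x = g x" using assms[OF e] by blast
    have "g absolutely_integrable_on e" by (rule absolutely_integrable_compact[OF element(3)[OF e] g(1)])
    then have "g absolutely_integrable_on (\<Omega> \<inter> interior e)"
      by (rule set_integrable_subset[OF _ meas]) (use interior_subset in blast)
    then show ?thesis
      by (rule set_integrable_cong[THEN iffD1, rotated -1]) (auto simp: g(2))
  qed
  have "f absolutely_integrable_on (\<Union>e\<in>\<G>. \<Omega> \<inter> interior e)"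
    by (intro set_integrable_UN finite_grid 1 meas)
  then have "f absolutely_integrable_on \<Omega>"
  proof (rule absolutely_integrable_spike_set)
    show "negligible {x \<in> (\<Union>e\<in>\<G>. \<Omega> \<inter> interior e) - \<Omega>. f x \<noteq> 0}"
      by (rule negligible_subset[of "{}"]) auto
    show "negligible {x \<in> \<Omega> - (\<Union>e\<in>\<G>. \<Omega> \<inter> interior e). f x \<noteq> 0}"
      by (rule negligible_subset[OF negligible_skeleton]) auto
  qed
  then show ?thesis by (rule set_lebesgue_integral_eq_integral(1))
qed

text \<open>
  The crack density is a polynomial of degree two in the damage and its gradient, so its integral
  is a linear plus a quadratic form of the nodal values. The form is positive semidefinite because
  \<open>w\<close> has the leading coefficient \<open>- \<beta>\<close> and the gradient enters through its squared norm.
\<close>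
lemma crack_energy_quadratic:
  assumes "0 \<le> gc" "0 < l" "\<beta> \<in> {-1..0}"
  obtains b :: "real^'n" and A :: "real^'n^'n" where
    "\<And>d. integral \<Omega> (\<lambda>x. gc * crack_density \<beta> l (fe_fun \<theta> d x) (grad (fe_fun \<theta> d) x)) = b \<bullet> d + d \<bullet> (A *v d)"
    "\<And>h. 0 \<le> h \<bullet> (A *v h)"
proof -
  \<comment> \<open>Nonnegativity suffices: if the constant were \<open>0\<close>, its reciprocal would be \<open>0\<close> as well.\<close>
  have c0: "crack_c \<beta> \<ge> 0"
    unfolding crack_c_def
  proof (cases "(\<lambda>s. sqrt (crack_w \<beta> s)) integrable_on {0..1}")
    case True
    have "crack_w \<beta> s \<ge> 0" if s: "s \<in> {0..1}" for s
    proof -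
      have "\<bar>\<beta> * (1 - s)\<bar> \<le> 1 * 1" unfolding abs_mult using assms s by (intro mult_mono) auto
      then show ?thesis using s unfolding crack_w_def by (intro mult_nonneg_nonneg) auto
    qed
    then show "0 \<le> integral {0..1} (\<lambda>s. sqrt (crack_w \<beta> s))" using True by (intro integral_nonneg) auto
  qed (simp add: not_integrable_integral)
  define K where "K = gc * (1 / (4 * crack_c \<beta>))"
  have K: "K \<ge> 0" using assms c0 by (simp add: K_def)
  define c1 where "c1 = K * (1 + \<beta>) / l"
  define c2 where "c2 = K * (- \<beta>) / l"
  define c3 where "c3 = K * l"
  have c: "c2 \<ge> 0" "c3 \<ge> 0" using K assms by (auto simp: c2_def c3_def divide_nonpos_pos mult_nonneg_nonpos)
  define m where "m i j x = c2 * (\<theta> i x * \<theta> j x) + c3 * (grad (\<theta> i) x \<bullet> grad (\<theta> j) x)" for i j x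
  have \<theta>_cont: "continuous_on e (\<theta> i)" if "e \<in> \<G>" for e i
    using basis that by (auto simp: nodal_basis_def intro: continuous_on_subset)
  have int1: "(\<lambda>x. c1 * \<theta> i x) integrable_on \<Omega>" for i
    by (intro piecewise_continuous_integrable exI[of _ "\<lambda>x. c1 * \<theta> i x"])
      (auto intro!: continuous_intros \<theta>_cont)
  have int2: "m i j integrable_on \<Omega>" for i j
  proof (rule piecewise_continuous_integrable)
    fix e assume e: "e \<in> \<G>"
    show "\<exists>g. continuous_on e g \<and> (\<forall>x\<in>interior e. m i j x = g x)"
      by (intro exI[of _ "\<lambda>x. c2 * (\<theta> i x * \<theta> j x) + c3 * (shape_grad e i x \<bullet> shape_grad e j x)"] conjI ballI
          continuous_intros \<theta>_cont e shape_grad(1)) (simp add: m_def grad_shape_fun[OF e])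
  qed
  define b where "b = (\<chi> i. integral \<Omega> (\<lambda>x. c1 * \<theta> i x))"
  define A where "A = (\<chi> i j. integral \<Omega> (m i j))"
  have quad: "((\<lambda>x. \<Sum>i\<in>UNIV. h $ i * (\<Sum>j\<in>UNIV. h $ j * m i j x)) has_integral (h \<bullet> (A *v h))) \<Omega>" for h :: "real^'n"
  proof -
    have "((\<lambda>x. \<Sum>i\<in>UNIV. h $ i * (\<Sum>j\<in>UNIV. h $ j * m i j x)) has_integral
        (\<Sum>i\<in>UNIV. h $ i * (\<Sum>j\<in>UNIV. h $ j * integral \<Omega> (m i j)))) \<Omega>"
      by (intro has_integral_sum has_integral_mult_right integrable_integral int2) auto
    then show ?thesis by (simp add: inner_vec_def matrix_vector_mult_def A_def mult.commute)
  qed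
  have sums: "(\<Sum>i\<in>UNIV. h $ i * (\<Sum>j\<in>UNIV. h $ j * m i j x))
      = c2 * (fe_fun \<theta> h x)\<^sup>2 + c3 * (norm (\<Sum>i\<in>UNIV. h $ i *\<^sub>R grad (\<theta> i) x))\<^sup>2" for h :: "real^'n" and x
  proof -
    have sq: "(fe_fun \<theta> h x)\<^sup>2 = (\<Sum>i\<in>UNIV. h $ i * (\<Sum>j\<in>UNIV. h $ j * (\<theta> i x * \<theta> j x)))"
      by (simp add: fe_fun_def power2_eq_square sum_product sum_distrib_left mult_ac)
    have gr: "(norm (\<Sum>i\<in>UNIV. h $ i *\<^sub>R grad (\<theta> i) x))\<^sup>2
        = (\<Sum>i\<in>UNIV. h $ i * (\<Sum>j\<in>UNIV. h $ j * (grad (\<theta> i) x \<bullet> grad (\<theta> j) x)))"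
    proof -
      define z where "z = (\<Sum>i\<in>UNIV. h $ i *\<^sub>R grad (\<theta> i) x)"
      have 1: "z \<bullet> y = (\<Sum>i\<in>UNIV. h $ i * (grad (\<theta> i) x \<bullet> y))" for y
        by (simp add: z_def inner_sum_left)
      have 2: "y \<bullet> z = (\<Sum>j\<in>UNIV. h $ j * (y \<bullet> grad (\<theta> j) x))" for y
        by (simp add: z_def inner_sum_right)
      show ?thesis unfolding z_def[symmetric] power2_norm_eq_inner by (subst 1) (simp only: 2)
    qed
    show ?thesis
      unfolding sq gr m_def distrib_left sum.distrib sum_distrib_left by (simp only: mult_ac)
  qed
  show ?thesis
  proof
    fix h :: "real^'n"
    show "0 \<le> h \<bullet> (A *v h)"
      by (rule has_integral_nonneg[OF quad]) (simp add: sums c)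
  next
    fix d :: "real^'n"
    have "((\<lambda>x. \<Sum>i\<in>UNIV. d $ i * (c1 * \<theta> i x)) has_integral (\<Sum>i\<in>UNIV. d $ i * integral \<Omega> (\<lambda>x. c1 * \<theta> i x))) \<Omega>"
      by (intro has_integral_sum has_integral_mult_right integrable_integral int1) auto
    then have lin: "((\<lambda>x. c1 * fe_fun \<theta> d x) has_integral (b \<bullet> d)) \<Omega>"
      by (simp add: fe_fun_def b_def inner_vec_def sum_distrib_left mult_ac)
    have "integral \<Omega> (\<lambda>x. gc * crack_density \<beta> l (fe_fun \<theta> d x) (grad (fe_fun \<theta> d) x))
      = integral \<Omega> (\<lambda>x. c1 * fe_fun \<theta> d x + (\<Sum>i\<in>UNIV. d $ i * (\<Sum>j\<in>UNIV. d $ j * m i j x)))"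
    proof (rule integral_spike[OF negligible_skeleton])
      fix x assume "x \<in> \<Omega> - (\<Omega> - (\<Union>e\<in>\<G>. interior e))"
      then obtain e where e: "e \<in> \<G>" "x \<in> interior e" by blast
      have g: "grad (fe_fun \<theta> d) x = (\<Sum>i\<in>UNIV. d $ i *\<^sub>R grad (\<theta> i) x)"
        by (simp add: grad_fe_fun[OF e] grad_shape_fun[OF e])
      have "gc * crack_density \<beta> l s z = c1 * s + (c2 * s\<^sup>2 + c3 * (norm z)\<^sup>2)" for s and z :: "real^'m"
        unfolding crack_density_def crack_w_def c1_def c2_def c3_def K_def
        by (simp add: algebra_simps add_divide_distrib diff_divide_distrib power2_eq_square)
      then show "c1 * fe_fun \<theta> d x + (\<Sum>i\<in>UNIV. d $ i * (\<Sum>j\<in>UNIV. d $ j * m i j x))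
          = gc * crack_density \<beta> l (fe_fun \<theta> d x) (grad (fe_fun \<theta> d) x)"
        unfolding sums g by simp
    qed
    also have "\<dots> = b \<bullet> d + d \<bullet> (A *v d)"
      by (rule integral_unique[OF has_integral_add[OF lin quad]])
    finally show "integral \<Omega> (\<lambda>x. gc * crack_density \<beta> l (fe_fun \<theta> d x) (grad (fe_fun \<theta> d) x)) = b \<bullet> d + d \<bullet> (A *v d)" .
  qed
qed

end

section \<open>Displacements with zero strain\<close>

lemma sym_part_quadratic: "v \<bullet> (sym_part M *v v) = v \<bullet> (M *v v)"
proof -
  have "v \<bullet> (transpose M *v v) = v \<bullet> (M *v v)"
    by (metis dot_lmul_matrix inner_commute transpose_matrix_vector)
  then show ?thesis
    by (simp add: sym_part_def scaleR_matrix_vector_assoc[symmetric] matrix_vector_mult_add_rdistrib inner_add_right)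
qed

text \<open>
  Polarization of \<open>w z \<bullet> z = 0\<close> yields \<open>w z \<bullet> y = - (w y \<bullet> z)\<close>; with multiples of the unit vectors
  for \<open>y\<close> this shows that all components of the displacement are affine.
\<close>
lemma rigid_on_ball:
  fixes U :: "real^'m \<Rightarrow> real^'m"
  assumes r: "r > 0" and U: "\<And>x y. x \<in> ball a r \<Longrightarrow> y \<in> ball a r \<Longrightarrow> (U y - U x) \<bullet> (y - x) = 0"
  obtains A c where "\<And>x. x \<in> ball a r \<Longrightarrow> U x = A *v x + c" "\<And>z. z \<bullet> (A *v z) = 0"
proof -
  define w where "w z = U (a + z) - U a" for z
  have w0: "w z \<bullet> z = 0" if "norm z < r" for z
    using U[of a "a + z"] that r by (simp add: w_def dist_norm)
  have w1: "w z \<bullet> y = - (w y \<bullet> z)" if "norm z < r" "norm y < r" for z y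
  proof -
    have "(w z - w y) \<bullet> (z - y) = 0" using U[of "a + y" "a + z"] that by (simp add: w_def dist_norm)
    then show ?thesis using w0[OF that(1)] w0[OF that(2)] by (simp add: inner_diff_left inner_diff_right)
  qed
  \<comment> \<open>The unit vectors are scaled by \<open>\<delta>\<close> to fit into the ball.\<close>
  define \<delta> where "\<delta> = r / 2"
  have \<delta>: "\<delta> > 0" "\<delta> < r" using r by (auto simp: \<delta>_def)
  define A where "A = (\<chi> i. - (1 / \<delta>) *\<^sub>R w (\<delta> *\<^sub>R axis i 1))"
  have Aw: "A *v z = w z" if z: "norm z < r" for z
  proof -
    have "(A *v z) $ i = w z $ i" for i
    proof -
      have "norm (\<delta> *\<^sub>R axis i (1::real) :: real^'m) < r" using \<delta> by (simp add: norm_axis_1)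
      from w1[OF z this] have "w z \<bullet> (\<delta> *\<^sub>R axis i 1) = - (w (\<delta> *\<^sub>R axis i 1) \<bullet> z)" .
      then have "w z $ i = - (1 / \<delta>) * (w (\<delta> *\<^sub>R axis i 1) \<bullet> z)"
        using \<delta> by (simp add: inner_axis field_simps)
      then show ?thesis by (simp add: A_def matrix_vector_mul_component)
    qed
    then show ?thesis by (simp add: vec_eq_iff)
  qed
  show ?thesis
  proof
    fix x assume "x \<in> ball a r"
    then have "A *v (x - a) = U x - U a" using Aw[of "x - a"] by (simp add: w_def dist_norm norm_minus_commute)
    then show "U x = A *v x + (U a - A *v a)"
      by (simp add: matrix_vector_mult_diff_distrib algebra_simps)
  next
    fix z :: "real^'m"
    obtain s where s: "s > 0" "s * norm z < r" using small_scaling[OF r] by metis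
    then have "norm (s *\<^sub>R z) < r" by simp
    from w0[OF this] have "(s *\<^sub>R z) \<bullet> (A *v (s *\<^sub>R z)) = 0" using Aw[OF \<open>norm (s *\<^sub>R z) < r\<close>] by (simp add: inner_commute)
    then show "z \<bullet> (A *v z) = 0" using s by (simp add: matrix_vector_mult_scaleR)
  qed
qed

lemma affine_map_unique_on_ball:
  fixes A A' :: "real^'m^'k"
  assumes r: "r > 0" and eq: "\<And>y. y \<in> ball a r \<Longrightarrow> A *v y + c = A' *v y + c'"
  shows "A = A' \<and> c = c'"
proof -
  have a: "A *v a + c = A' *v a + c'" using eq[of a] r by simp
  have "A *v h = A' *v h" for h
  proof -
    obtain s where s: "s > 0" "s * norm h < r" using small_scaling[OF r] by metis
    then have "a + s *\<^sub>R h \<in> ball a r" using s by (simp add: dist_norm)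
    from eq[OF this] have "A *v a + s *\<^sub>R (A *v h) + c = A' *v a + s *\<^sub>R (A' *v h) + c'"
      by (simp add: matrix_vector_right_distrib matrix_vector_mult_scaleR)
    moreover have "s *\<^sub>R (A *v h) = (A *v a + s *\<^sub>R (A *v h) + c) - (A *v a + c)"
      "s *\<^sub>R (A' *v h) = (A' *v a + s *\<^sub>R (A' *v h) + c') - (A' *v a + c')" by simp_all
    ultimately have "s *\<^sub>R (A *v h) = s *\<^sub>R (A' *v h)" using a by metis
    then show ?thesis using s by simp
  qed
  then have "A = A'" by (simp add: matrix_eq)
  then show ?thesis using a by simp
qed

text \<open>
  The range of a skew map is orthogonal to its kernel. If the kernel contains a hyperplane with
  normal \<open>n\<close>, the value at \<open>n\<close>, which is orthogonal to \<open>n\<close> by skewness, lies in this kernel; being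
  also in the range, it is orthogonal to itself.
\<close>
lemma skew_zero_on_hyperplane:
  fixes A :: "real^'m^'m"
  assumes skew: "\<And>z. z \<bullet> (A *v z) = 0"
    and n: "n \<noteq> 0" and zero: "\<And>x. n \<bullet> x = b \<Longrightarrow> A *v x + c = 0"
  shows "A = 0 \<and> c = 0"
proof -
  have sk: "x \<bullet> (A *v y) = - (y \<bullet> (A *v x))" for x y
    using skew[of "x + y"] skew[of x] skew[of y]
    by (simp add: matrix_vector_right_distrib inner_add_left inner_add_right)
  define x0 where "x0 = (b / (n \<bullet> n)) *\<^sub>R n"
  have x0: "n \<bullet> x0 = b" using n by (simp add: x0_def)
  have ker: "A *v y = 0" if "n \<bullet> y = 0" for y
  proof -
    have "A *v (x0 + y) + c = 0" "A *v x0 + c = 0"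
      using zero[of "x0 + y"] zero[of x0] x0 that by (auto simp: inner_add_right)
    moreover have "A *v y = (A *v (x0 + y) + c) - (A *v x0 + c)"
      by (simp add: matrix_vector_right_distrib)
    ultimately show ?thesis by simp
  qed
  have An: "A *v n = 0"
  proof -
    define z where "z = A *v n"
    have "n \<bullet> z = 0" using skew[of n] by (simp add: z_def)
    then have "A *v z = 0" by (rule ker)
    then have "z \<bullet> (A *v n) = 0" using sk[of z n] by simp
    then show ?thesis by (simp add: z_def)
  qed
  have "A *v x = 0" for x
  proof -
    define s where "s = (n \<bullet> x) / (n \<bullet> n)"
    have "n \<bullet> (x - s *\<^sub>R n) = 0" using n by (simp add: s_def inner_diff_right)
    from ker[OF this] show ?thesis using An
      by (simp add: matrix_vector_mult_diff_distrib matrix_vector_mult_scaleR)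
  qed
  then have "A = 0" by (simp add: matrix_eq)
  then show ?thesis using zero[OF x0] by simp
qed

context lagrange_grid
begin

text \<open>
  Along the segment from \<open>x\<close> to \<open>y\<close>, with \<open>v = y - x\<close>, the derivative of the displacement component in
  direction \<open>v\<close> is the quadratic form of the strain at \<open>v\<close>.
\<close>
lemma zero_strain_element:
  fixes u :: "real^'m^'n"
  assumes e: "e \<in> \<G>" and zero: "\<And>x. x \<in> e \<Longrightarrow> strain e (fe_fun \<theta> u) x = 0"
    and x: "x \<in> e" and y: "y \<in> e"
  shows "(fe_fun \<theta> u y - fe_fun \<theta> u x) \<bullet> (y - x) = 0"
proof -
  define v where "v = y - x"
  define \<phi> where "\<phi> t = fe_fun \<theta> u (x + t *\<^sub>R v) \<bullet> v" for t
  have line: "x + t *\<^sub>R v \<in> e" if "t \<in> {0..1}" for t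
    using convexD_alt[OF element(2)[OF e] x y, of t] that by (simp add: v_def algebra_simps)
  have "(\<phi> has_derivative (\<lambda>h. 0)) (at t within {0..1})" if t: "t \<in> {0..1}" for t
  proof -
    let ?z = "x + t *\<^sub>R v"
    let ?J = "fe_jacobian (\<lambda>i. shape_grad e i ?z) u"
    have "((\<lambda>t. x + t *\<^sub>R v) has_derivative (\<lambda>h. h *\<^sub>R v)) (at t within {0..1})"
      by (auto intro!: derivative_eq_intros)
    moreover have "(fe_fun \<theta> u has_derivative (*v) ?J) (at ?z within (\<lambda>t. x + t *\<^sub>R v) ` {0..1})"
      using has_derivative_subset[OF fe_fun_derivative[OF e line[OF t], of u]] line
      by (simp add: fe_jacobian_mult[abs_def] image_subset_iff)
    ultimately have "(fe_fun \<theta> u \<circ> (\<lambda>t. x + t *\<^sub>R v) has_derivative (*v) ?J \<circ> (\<lambda>h. h *\<^sub>R v)) (at t within {0..1})"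
      by (rule diff_chain_within)
    then have "(\<phi> has_derivative (\<lambda>h. (?J *v (h *\<^sub>R v)) \<bullet> v)) (at t within {0..1})"
      unfolding \<phi>_def[abs_def] o_def by (rule has_derivative_inner_left)
    moreover have "v \<bullet> (?J *v v) = 0"
      using zero[OF line[OF t]] strain_fe_fun[OF e line[OF t], of u] sym_part_quadratic[of v ?J] by simp
    then have "(?J *v (h *\<^sub>R v)) \<bullet> v = 0" for h by (simp add: matrix_vector_mult_scaleR inner_commute)
    ultimately show ?thesis by simp
  qed
  then obtain c where "\<And>t. t \<in> {0..1} \<Longrightarrow> \<phi> t = c"
    using has_derivative_zero_constant[of "{0..1}" \<phi>] convex_real_interval by blast
  from this[of 0] this[of 1] show ?thesis
    by (simp add: \<phi>_def inner_diff_left v_def)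
qed

text \<open>
  The component of the displacement in the direction of the segment is constant on the part of the
  segment inside each element. So on the whole segment it is a continuous function with finitely
  many values. This replaces an argument about chains of elements that share facets.
\<close>
lemma zero_strain_segment:
  fixes u :: "real^'m^'n"
  assumes zero: "\<And>e x. e \<in> \<G> \<Longrightarrow> x \<in> e \<Longrightarrow> strain e (fe_fun \<theta> u) x = 0"
    and seg: "closed_segment a b \<subseteq> closure \<Omega>"
  shows "(fe_fun \<theta> u b - fe_fun \<theta> u a) \<bullet> (b - a) = 0"
proof -
  define v where "v = b - a"
  define \<phi> where "\<phi> t = fe_fun \<theta> u (a + t *\<^sub>R v) \<bullet> v" for t
  have line: "a + t *\<^sub>R v \<in> closure \<Omega>" if "t \<in> {0..1}" for t
  proof -
    have "a + t *\<^sub>R v = (1 - t) *\<^sub>R a + t *\<^sub>R b" by (simp add: v_def algebra_simps)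
    moreover have "(1 - t) *\<^sub>R a + t *\<^sub>R b \<in> closed_segment a b" using that by (auto simp: in_segment)
    ultimately show ?thesis using seg by auto
  qed
  have "continuous_on {0..1} (\<lambda>t. fe_fun \<theta> u (a + t *\<^sub>R v))"
    by (rule continuous_on_compose2[OF continuous_on_fe_fun]) (auto intro!: continuous_intros line)
  then have "continuous_on {0..1} \<phi>" unfolding \<phi>_def[abs_def] by (intro continuous_intros)
  moreover have "finite (\<phi> ` {0..1})"
  proof -
    define T where "T e = {t \<in> {0..1}. a + t *\<^sub>R v \<in> e}" for e
    have "\<phi> ` {0..1} \<subseteq> (\<Union>e\<in>\<G>. \<phi> ` T e)"
      using line unfolding closure_domain T_def by blast
    moreover have "finite (\<phi> ` T e)" if "e \<in> \<G>" for e
    proof -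
      have eq: "\<phi> t = \<phi> s" if "t \<in> T e" "s \<in> T e" for s t
      proof (cases "t = s")
        case False
        have "(fe_fun \<theta> u (a + t *\<^sub>R v) - fe_fun \<theta> u (a + s *\<^sub>R v)) \<bullet> ((t - s) *\<^sub>R v) = 0"
          using zero_strain_element[OF \<open>e \<in> \<G>\<close> zero[OF \<open>e \<in> \<G>\<close>], of "a + s *\<^sub>R v" "a + t *\<^sub>R v"] that
          by (simp add: T_def algebra_simps)
        then have "(t - s) * (\<phi> t - \<phi> s) = 0" by (simp add: \<phi>_def inner_diff_left)
        then show ?thesis using False by simp
      qed simp
      show ?thesis
      proof (cases "T e = {}")
        case False
        then obtain s where "s \<in> T e" by blast
        then have "\<phi> ` T e \<subseteq> {\<phi> s}" using eq by blast
        then show ?thesis using finite_subset by blast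
      qed simp
    qed
    ultimately show ?thesis by (rule finite_subset[OF _ finite_UN_I[OF finite_grid]])
  qed
  ultimately have "\<phi> constant_on {0..1}"
    by (intro continuous_finite_range_constant) (auto simp: connected_Icc)
  then have "\<phi> 0 = \<phi> 1" unfolding constant_on_def by force
  then show ?thesis by (simp add: \<phi>_def v_def inner_diff_left)
qed

text \<open>
  On each ball in the domain the displacement is a rigid motion. Rigid motions that agree on a ball
  are equal, so the germ of the displacement is locally constant, and the domain is connected.
\<close>
lemma zero_strain_rigid:
  fixes u :: "real^'m^'n"
  assumes zero: "\<And>e x. e \<in> \<G> \<Longrightarrow> x \<in> e \<Longrightarrow> strain e (fe_fun \<theta> u) x = 0"
  obtains A c where "\<And>x. x \<in> closure \<Omega> \<Longrightarrow> fe_fun \<theta> u x = A *v x + c" "\<And>z. z \<bullet> (A *v z) = 0"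
proof -
  let ?U = "fe_fun \<theta> u"
  define germ where "germ a A c \<longleftrightarrow> (\<exists>r>0. \<forall>y\<in>ball a r. ?U y = A *v y + c)" for a and A :: "real^'m^'m" and c
  have ball: "\<exists>r A c. 0 < r \<and> ball a r \<subseteq> \<Omega> \<and> (\<forall>y\<in>ball a r. ?U y = A *v y + c) \<and> (\<forall>z. z \<bullet> (A *v z) = 0)"
    if a: "a \<in> \<Omega>" for a
  proof -
    obtain r where r: "r > 0" "ball a r \<subseteq> \<Omega>" using open_domain a unfolding open_contains_ball by blast
    have "(?U y - ?U x) \<bullet> (y - x) = 0" if "x \<in> ball a r" "y \<in> ball a r" for x y
    proof -
      have "closed_segment x y \<subseteq> ball a r" using that by (intro closed_segment_subset convex_ball)
      then have "closed_segment x y \<subseteq> closure \<Omega>" using r(2) closure_subset by blast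
      with zero show ?thesis by (intro zero_strain_segment) auto
    qed
    from rigid_on_ball[OF r(1) this] obtain A c
      where "\<And>x. x \<in> ball a r \<Longrightarrow> ?U x = A *v x + c" "\<And>z. z \<bullet> (A *v z) = 0" by blast
    with r show ?thesis by blast
  qed
  have uniq: "A = A' \<and> c = c'" if g: "germ a A c" "germ a A' c'" for a A c A' c'
  proof -
    obtain r s where rs: "r > 0" "s > 0"
        "\<forall>y\<in>ball a r. ?U y = A *v y + c" "\<forall>y\<in>ball a s. ?U y = A' *v y + c'"
      using g unfolding germ_def by blast
    show ?thesis
    proof (rule affine_map_unique_on_ball)
      show "min r s > 0" using rs by simp
      fix y assume "y \<in> ball a (min r s)"
      then have "y \<in> ball a r" "y \<in> ball a s" by auto
      then show "A *v y + c = A' *v y + c'" using rs(3,4) by metis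
    qed
  qed
  obtain a where a: "a \<in> \<Omega>" using nonempty_domain by blast
  obtain A c where Ac: "germ a A c" "\<And>z. z \<bullet> (A *v z) = 0" using ball[OF a] unfolding germ_def by metis
  have const: "\<forall>A c. germ a A c \<longleftrightarrow> germ b A c" if b: "b \<in> \<Omega>" for b
  proof (rule connected_equivalence_relation[OF connected_domain a b, where R="\<lambda>a b. \<forall>A c. germ a A c \<longleftrightarrow> germ b A c"])
    fix x assume "x \<in> \<Omega>"
    then obtain r A c where r: "0 < r" "ball x r \<subseteq> \<Omega>" "\<forall>y\<in>ball x r. ?U y = A *v y + c"
      using ball by blast
    have "germ y A c" if y: "y \<in> ball x r" for y
    proof -
      obtain s where "s > 0" "ball y s \<subseteq> ball x r" using open_ball[of x r] y unfolding open_contains_ball by blast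
      then show ?thesis using r(3) unfolding germ_def by blast
    qed
    then have "\<forall>A' c'. germ x A' c' \<longleftrightarrow> germ y A' c'" if "y \<in> ball x r" for y
      using uniq that r(1) by (metis centre_in_ball)
    moreover have "openin (top_of_set \<Omega>) (ball x r)"
      using r(2) by (simp add: open_domain openin_open_eq)
    ultimately show "\<exists>T. openin (top_of_set \<Omega>) T \<and> x \<in> T \<and> (\<forall>y\<in>T. \<forall>A c. germ x A c \<longleftrightarrow> germ y A c)"
      using r(1) by (intro exI[of _ "ball x r"]) auto
  qed auto
  have U: "?U b = A *v b + c" if "b \<in> \<Omega>" for b
  proof -
    have "germ b A c" using const[OF that] Ac(1) by blast
    then show ?thesis unfolding germ_def by auto
  qed
  have "?U x - (A *v x + c) = 0" if "x \<in> closure \<Omega>" for x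
  proof (rule continuous_constant_on_closure[OF _ _ that])
    show "continuous_on (closure \<Omega>) (\<lambda>x. ?U x - (A *v x + c))"
      by (intro continuous_intros continuous_on_fe_fun matrix_vector_mult_linear_continuous_on)
  qed (simp add: U)
  then show ?thesis using that[of A c] Ac(2) by simp
qed

text \<open>
  A rigid motion that vanishes at the vertices of a facet vanishes on a hyperplane, hence
  everywhere. This qualitative form of Korn's inequality is enough in finite dimension.
\<close>
theorem zero_strain_dirichlet:
  fixes u :: "real^'m^'n"
  assumes zero: "\<And>e x. e \<in> \<G> \<Longrightarrow> x \<in> interior e \<Longrightarrow> strain e (fe_fun \<theta> u) x = 0"
    and e: "e \<in> \<G>" and F: "F facet_of e"
    and bc: "\<And>i. p i extreme_point_of F \<Longrightarrow> u $ i = 0"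
    and nodes: "{x. x extreme_point_of F} \<subseteq> range p"
  shows "u = 0"
proof -
  have "strain e (fe_fun \<theta> u) x = 0" if e: "e \<in> \<G>" and x: "x \<in> e" for e x
  proof (rule continuous_constant_on_closure[where S="interior e"])
    show "continuous_on (closure (interior e)) (strain e (fe_fun \<theta> u))"
      unfolding element(6)[OF e] by (rule continuous_on_strain[OF e])
    show "x \<in> closure (interior e)" using x element(6)[OF e] by simp
  qed (rule zero[OF e])
  from zero_strain_rigid[OF this] obtain A c where
    U: "\<And>x. x \<in> closure \<Omega> \<Longrightarrow> fe_fun \<theta> u x = A *v x + c" and skew: "\<And>z. z \<bullet> (A *v z) = 0" by metis
  have node: "p i \<in> closure \<Omega>" for i
    using basis unfolding nodal_basis_def closure_domain extreme_point_of_def by blast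
  have "polytope F" using F element(1)[OF e] face_of_polytope_polytope by (auto simp: facet_of_def)
  then have FK: "F = convex hull {x. x extreme_point_of F}"
    by (intro Krein_Milman_Minkowski) (auto simp: polytope_imp_compact polytope_imp_convex)
  let ?Z = "{x. A *v x + c = 0}"
  have "affine ?Z"
    unfolding affine_def
  proof safe
    fix x y :: "real^'m" and s t :: real
    assume h: "A *v x + c = 0" "A *v y + c = 0" "s + t = 1"
    have "A *v (s *\<^sub>R x + t *\<^sub>R y) + c = s *\<^sub>R (A *v x) + t *\<^sub>R (A *v y) + (s + t) *\<^sub>R c"
      by (simp add: matrix_vector_right_distrib matrix_vector_mult_scaleR h(3))
    also have "\<dots> = s *\<^sub>R (A *v x + c) + t *\<^sub>R (A *v y + c)" by (simp add: algebra_simps)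
    finally show "A *v (s *\<^sub>R x + t *\<^sub>R y) + c = 0" by (simp add: h)
  qed
  have "{x. x extreme_point_of F} \<subseteq> ?Z"
  proof safe
    fix x assume x: "x extreme_point_of F"
    then obtain i where i: "x = p i" using nodes by blast
    show "A *v x + c = 0" using U[OF node[of i]] bc[of i] x by (simp add: i fe_fun_node)
  qed
  then have "F \<subseteq> ?Z" using FK \<open>affine ?Z\<close> hull_minimal affine_imp_convex by metis
  then have sub: "affine hull F \<subseteq> ?Z" using \<open>affine ?Z\<close> by (rule hull_minimal)
  have "aff_dim e = int CARD('m)"
    using aff_dim_nonempty_interior[OF element(5)[OF e]] by simp
  then have "aff_dim F = DIM(real^'m) - 1" using F by (simp add: facet_of_def)
  then obtain n b where n: "n \<noteq> 0" "affine hull F = {x. n \<bullet> x = b}"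
    unfolding aff_dim_eq_hyperplane by blast
  have "A = 0 \<and> c = 0" using skew n(1) sub[unfolded n(2)] by (intro skew_zero_on_hyperplane) auto
  then have "fe_fun \<theta> u (p i) = 0" for i using U[OF node] by simp
  then show ?thesis by (simp add: fe_fun_node vec_eq_iff)
qed

end

section \<open>Twice differentiable and coercive functions\<close>

lemma C2_on_add: "C2_on S f \<Longrightarrow> C2_on S g \<Longrightarrow> C2_on S (\<lambda>x. f x + g x)"
proof -
  assume "C2_on S f" "C2_on S g"
  then obtain f' f'' g' g'' where
    "\<forall>x\<in>S. (f has_derivative blinfun_apply (f' x)) (at x within S)"
    "\<forall>x\<in>S. (f' has_derivative blinfun_apply (f'' x)) (at x within S)" "continuous_on S f''"
    "\<forall>x\<in>S. (g has_derivative blinfun_apply (g' x)) (at x within S)"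
    "\<forall>x\<in>S. (g' has_derivative blinfun_apply (g'' x)) (at x within S)" "continuous_on S g''"
    unfolding C2_on_def by blast
  then show ?thesis
    unfolding C2_on_def
    by (intro exI[of _ "\<lambda>x. f' x + g' x"] exI[of _ "\<lambda>x. f'' x + g'' x"])
      (auto simp: plus_blinfun.rep_eq intro!: has_derivative_add continuous_on_add)
qed

lemma C2_on_cmult: "C2_on S f \<Longrightarrow> C2_on S (\<lambda>x. a * f x)"
proof -
  assume "C2_on S f"
  then obtain f' f'' where
    "\<forall>x\<in>S. (f has_derivative blinfun_apply (f' x)) (at x within S)"
    "\<forall>x\<in>S. (f' has_derivative blinfun_apply (f'' x)) (at x within S)" "continuous_on S f''"
    unfolding C2_on_def by blast
  then show ?thesis
    unfolding C2_on_def
    by (intro exI[of _ "\<lambda>x. a *\<^sub>R f' x"] exI[of _ "\<lambda>x. a *\<^sub>R f'' x"])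
      (auto simp: scaleR_blinfun.rep_eq real_scaleR_def intro!: has_derivative_mult_right has_derivative_scaleR_right continuous_intros)
qed

lemma C2_on_const: "C2_on S (\<lambda>x. c)"
  unfolding C2_on_def by (intro exI[of _ "\<lambda>x. 0"]) (auto simp: zero_blinfun.rep_eq)

lemma C2_on_sum:
  assumes "finite I" "\<And>i. i \<in> I \<Longrightarrow> C2_on S (f i)"
  shows "C2_on S (\<lambda>x. \<Sum>i\<in>I. f i x)"
  using assms by (induction I rule: finite_induct) (auto intro: C2_on_const C2_on_add)

lemma C2_on_compose_linear:
  fixes g :: "'b::real_normed_vector \<Rightarrow> real" and \<phi> :: "'a::real_normed_vector \<Rightarrow> 'b"
  assumes g: "C2_on T g" and \<phi>: "bounded_linear \<phi>" and sub: "\<phi> ` S \<subseteq> T"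
  shows "C2_on S (\<lambda>x. g (\<phi> x))"
proof -
  obtain g' g'' where g':
    "\<And>x. x \<in> T \<Longrightarrow> (g has_derivative blinfun_apply (g' x)) (at x within T)"
    "\<And>x. x \<in> T \<Longrightarrow> (g' has_derivative blinfun_apply (g'' x)) (at x within T)" "continuous_on T g''"
    using g unfolding C2_on_def by blast
  define L where "L = Blinfun \<phi>"
  have L: "blinfun_apply L = \<phi>" unfolding L_def using \<phi> by (rule bounded_linear_Blinfun_apply)
  have R_bl: "bounded_linear (\<lambda>A :: 'b \<Rightarrow>\<^sub>L real. A o\<^sub>L L)"
    by (rule bounded_bilinear.bounded_linear_left[OF bounded_bilinear_blinfun_compose])
  define R where "R = Blinfun (\<lambda>A :: 'b \<Rightarrow>\<^sub>L real. A o\<^sub>L L)"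
  have R: "blinfun_apply R A = A o\<^sub>L L" for A unfolding R_def by (simp add: bounded_linear_Blinfun_apply R_bl)
  have d\<phi>: "(\<phi> has_derivative \<phi>) (at x within S)" for x using \<phi> by (rule bounded_linear_imp_has_derivative)
  show ?thesis
    unfolding C2_on_def
  proof (intro exI[of _ "\<lambda>x. g' (\<phi> x) o\<^sub>L L"] exI[of _ "\<lambda>x. R o\<^sub>L (g'' (\<phi> x) o\<^sub>L L)"] conjI ballI)
    fix x assume x: "x \<in> S"
    then have Tx: "\<phi> x \<in> T" using sub by blast
    have "(g \<circ> \<phi> has_derivative blinfun_apply (g' (\<phi> x)) \<circ> \<phi>) (at x within S)"
      using d\<phi> has_derivative_subset[OF g'(1)[OF Tx] sub] by (rule diff_chain_within)
    moreover have "blinfun_apply (g' (\<phi> x) o\<^sub>L L) = blinfun_apply (g' (\<phi> x)) \<circ> \<phi>"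
      by (rule ext) (simp add: L)
    ultimately show "((\<lambda>x. g (\<phi> x)) has_derivative blinfun_apply (g' (\<phi> x) o\<^sub>L L)) (at x within S)"
      by (simp add: o_def)
    have "(g' \<circ> \<phi> has_derivative blinfun_apply (g'' (\<phi> x)) \<circ> \<phi>) (at x within S)"
      using d\<phi> has_derivative_subset[OF g'(2)[OF Tx] sub] by (rule diff_chain_within)
    from bounded_linear.has_derivative[OF R_bl this]
    have "((\<lambda>x. g' (\<phi> x) o\<^sub>L L) has_derivative (\<lambda>h. blinfun_apply (g'' (\<phi> x)) (\<phi> h) o\<^sub>L L)) (at x within S)"
      by (simp add: o_def)
    moreover have "blinfun_apply (R o\<^sub>L (g'' (\<phi> x) o\<^sub>L L)) = (\<lambda>h. blinfun_apply (g'' (\<phi> x)) (\<phi> h) o\<^sub>L L)"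
      by (rule ext) (simp add: L R)
    ultimately show "((\<lambda>x. g' (\<phi> x) o\<^sub>L L) has_derivative blinfun_apply (R o\<^sub>L (g'' (\<phi> x) o\<^sub>L L))) (at x within S)"
      by simp
  next
    have "continuous_on S (\<lambda>x. g'' (\<phi> x))"
      using sub by (intro continuous_on_compose2[OF g'(3)] linear_continuous_on \<phi>) auto
    then show "continuous_on S (\<lambda>x. R o\<^sub>L (g'' (\<phi> x) o\<^sub>L L))"
      by (intro bounded_bilinear.continuous_on[OF bounded_bilinear_blinfun_compose] continuous_on_const)
  qed
qed

lemma C2_on_quadratic:
  fixes b :: "real^'n" and A :: "real^'n^'n"
  shows "C2_on S (\<lambda>d. b \<bullet> d + d \<bullet> (A *v d))"
proof -
  \<comment> \<open>The matrix \<open>M\<close> of the gradient of \<open>d \<mapsto> d \<bullet> (A *v d)\<close>.\<close>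
  define M where "M = A + transpose A"
  have bl: "bounded_linear (\<lambda>h. blinfun_inner_left (M *v h))"
    by (intro bounded_linear_compose[OF bounded_linear_blinfun_inner_left] matrix_vector_mul_bounded_linear)
  have M: "(M *v x) \<bullet> h = x \<bullet> (A *v h) + h \<bullet> (A *v x)" for x h
    using dot_lmul_matrix[of x A h]
    by (simp add: M_def matrix_vector_mult_add_rdistrib inner_add_left inner_add_right inner_commute transpose_matrix_vector)
  show ?thesis
    unfolding C2_on_def
  proof (intro exI[of _ "\<lambda>x. blinfun_inner_left (b + M *v x)"] exI[of _ "\<lambda>x. Blinfun (\<lambda>h. blinfun_inner_left (M *v h))"] conjI ballI)
    fix x
    have "((\<lambda>d. b \<bullet> d + d \<bullet> (A *v d)) has_derivative (\<lambda>h. b \<bullet> h + (x \<bullet> (A *v h) + h \<bullet> (A *v x)))) (at x within S)"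
      by (intro has_derivative_add has_derivative_inner has_derivative_inner_right has_derivative_ident
          bounded_linear_imp_has_derivative matrix_vector_mul_bounded_linear)
    moreover have "(\<lambda>h. b \<bullet> h + (x \<bullet> (A *v h) + h \<bullet> (A *v x))) = blinfun_apply (blinfun_inner_left (b + M *v x))"
      by (rule ext) (simp add: inner_commute[of _ "b + M *v x"] inner_add_left M)
    ultimately show "((\<lambda>d. b \<bullet> d + d \<bullet> (A *v d)) has_derivative blinfun_apply (blinfun_inner_left (b + M *v x))) (at x within S)"
      by simp
    have "((\<lambda>x. blinfun_inner_left b + blinfun_inner_left (M *v x)) has_derivative (\<lambda>h. 0 + blinfun_inner_left (M *v h))) (at x within S)"
      by (intro has_derivative_add has_derivative_const bounded_linear_imp_has_derivative bl)
    then show "((\<lambda>x. blinfun_inner_left (b + M *v x)) has_derivative blinfun_apply (Blinfun (\<lambda>h. blinfun_inner_left (M *v h)))) (at x within S)"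
      by (simp add: bounded_linear_Blinfun_apply[OF bl] bounded_linear.linear[OF bounded_linear_blinfun_inner_left] linear_add)
  qed simp
qed

lemma convex_on_quadratic:
  fixes b :: "real^'n" and A :: "real^'n^'n"
  assumes "\<And>h. 0 \<le> h \<bullet> (A *v h)" "convex S"
  shows "convex_on S (\<lambda>d. b \<bullet> d + d \<bullet> (A *v d))"
proof (rule convex_onI)
  fix t :: real and x y
  assume t: "0 < t" "t < 1"
  have "(1 - t) * (b \<bullet> x + x \<bullet> (A *v x)) + t * (b \<bullet> y + y \<bullet> (A *v y))
      - (b \<bullet> ((1 - t) *\<^sub>R x + t *\<^sub>R y) + ((1 - t) *\<^sub>R x + t *\<^sub>R y) \<bullet> (A *v ((1 - t) *\<^sub>R x + t *\<^sub>R y)))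
      = t * (1 - t) * ((x - y) \<bullet> (A *v (x - y)))"
    by (simp add: matrix_vector_right_distrib matrix_vector_mult_diff_distrib matrix_vector_mult_scaleR
        inner_add_left inner_add_right inner_diff_left inner_diff_right algebra_simps)
  moreover have "t * (1 - t) * ((x - y) \<bullet> (A *v (x - y))) \<ge> 0" using t assms(1) by simp
  ultimately show "b \<bullet> ((1 - t) *\<^sub>R x + t *\<^sub>R y) + ((1 - t) *\<^sub>R x + t *\<^sub>R y) \<bullet> (A *v ((1 - t) *\<^sub>R x + t *\<^sub>R y))
      \<le> (1 - t) * (b \<bullet> x + x \<bullet> (A *v x)) + t * (b \<bullet> y + y \<bullet> (A *v y))" by linarith
qed (rule assms(2))

text \<open>
  A sum of squares of linear maps that have no common zero on the unit sphere of the subspace attains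
  a positive minimum there, because this sphere is compact.
\<close>
lemma coercive_on_subspace:
  fixes B :: "'i \<Rightarrow> 'a::euclidean_space \<Rightarrow> 'b::euclidean_space"
  assumes S: "subspace S" and I: "finite I" and B: "\<And>i. i \<in> I \<Longrightarrow> linear (B i)"
    and \<omega>: "\<And>i. i \<in> I \<Longrightarrow> 0 < \<omega> i"
    and inj: "\<And>u. u \<in> S \<Longrightarrow> (\<And>i. i \<in> I \<Longrightarrow> B i u = 0) \<Longrightarrow> u = 0"
  obtains c where "c > 0" "\<And>u. u \<in> S \<Longrightarrow> c * (norm u)\<^sup>2 \<le> (\<Sum>i\<in>I. \<omega> i * (norm (B i u))\<^sup>2)"
proof -
  define Q where "Q u = (\<Sum>i\<in>I. \<omega> i * (norm (B i u))\<^sup>2)" for u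
  define K where "K = S \<inter> sphere 0 1"
  have hom: "Q (r *\<^sub>R u) = r\<^sup>2 * Q u" for r u
    unfolding Q_def sum_distrib_left by (intro sum.cong refl) (simp add: linear_scale[OF B] power_mult_distrib)
  have pos: "Q u > 0" if u: "u \<in> S" "u \<noteq> 0" for u
  proof -
    obtain i where i: "i \<in> I" "B i u \<noteq> 0" using inj[OF u(1)] u(2) by blast
    show ?thesis unfolding Q_def
      using i I \<omega> by (intro sum_pos2[of I i]) (auto simp: less_imp_le)
  qed
  have cont: "continuous_on K Q" unfolding Q_def
    by (intro continuous_intros linear_continuous_on) (simp add: B flip: linear_conv_bounded_linear)
  have comp: "compact K" unfolding K_def
    by (rule closed_Int_compact[OF closed_subspace[OF S] compact_sphere])
  obtain c where c: "c > 0" "\<And>u. u \<in> K \<Longrightarrow> c \<le> Q u"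
  proof (cases "K = {}")
    case True
    then show ?thesis using that[of 1] by auto
  next
    case False
    obtain v where v: "v \<in> K" "\<And>u. u \<in> K \<Longrightarrow> Q v \<le> Q u" using continuous_attains_inf[OF comp False cont] by blast
    have "v \<in> S" "v \<noteq> 0" using v(1) by (auto simp: K_def)
    then show ?thesis using that[of "Q v"] pos v(2) by blast
  qed
  show ?thesis
  proof
    show "c > 0" by fact
    fix u assume u: "u \<in> S"
    show "c * (norm u)\<^sup>2 \<le> (\<Sum>i\<in>I. \<omega> i * (norm (B i u))\<^sup>2)"
    proof (cases "u = 0")
      case True
      then show ?thesis using \<omega> by (auto intro!: sum_nonneg simp: less_imp_le)
    next
      case False
      then have "(1 / norm u) *\<^sub>R u \<in> K" using u S by (simp add: K_def subspace_scale)
      from c(2)[OF this] have "c \<le> (1 / norm u)\<^sup>2 * Q u" by (simp only: hom)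
      then show ?thesis using False by (simp add: field_simps flip: Q_def)
    qed
  qed
qed

context lagrange_grid
begin

text \<open>
  The squared strain is continuous and nonnegative, so it vanishes on every box inside the element
  when its integral does.
\<close>
lemma zero_strain_energy:
  fixes u :: "real^'m^'n"
  assumes e: "e \<in> \<G>" and int: "integral e (\<lambda>x. (norm (strain e (fe_fun \<theta> u) x))\<^sup>2) = 0"
    and x: "x \<in> interior e"
  shows "strain e (fe_fun \<theta> u) x = 0"
proof -
  define f where "f x = (norm (strain e (fe_fun \<theta> u) x))\<^sup>2" for x
  have cont: "continuous_on e f" unfolding f_def[abs_def]
    by (intro continuous_intros continuous_on_strain[OF e])
  have "f integrable_on e"
    by (rule set_lebesgue_integral_eq_integral(1)[OF absolutely_integrable_compact[OF element(3)[OF e] cont]])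
  obtain a b where ab: "x \<in> box a b" "cbox a b \<subseteq> interior e"
    using open_contains_cbox[OF open_interior x] by metis
  then have sub: "cbox a b \<subseteq> e" using interior_subset by blast
  have fi: "f integrable_on cbox a b"
    by (rule integrable_continuous[OF continuous_on_subset[OF cont sub]])
  have "integral (cbox a b) f \<le> integral e f"
    by (rule integral_subset_le[OF sub fi \<open>f integrable_on e\<close>]) (simp add: f_def)
  moreover have "integral (cbox a b) f \<ge> 0" by (rule integral_nonneg[OF fi]) (simp add: f_def)
  ultimately have "(f has_integral 0) (cbox a b)"
    using int fi by (simp add: has_integral_integral f_def[abs_def])
  then have "f x = 0"
  proof (rule has_integral_0_cbox_imp_0[OF continuous_on_subset[OF cont sub], rotated])
    show "x \<in> cbox a b" using ab(1) box_subset_cbox by blast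
    show "box a b \<noteq> {}" using ab(1) by blast
  qed (simp add: f_def)
  then show ?thesis by (simp add: f_def)
qed

end

section \<open>The discrete energy\<close>

lemma linear_functional_inner:
  fixes P :: "'a::euclidean_space \<Rightarrow> real"
  assumes "linear P"
  obtains a where "\<And>u. P u = a \<bullet> u"
proof
  show "P u = adjoint P 1 \<bullet> u" for u
    using adjoint_works[OF assms, of u 1] by (simp add: inner_commute)
qed

text \<open>
  The degradation factors enter as nonnegative coefficients that are at most \<open>1 + k\<close>, and the constant
  computed with \<open>1 + k\<close> serves them all.
\<close>
lemma tame_convex_energy_sum:
  fixes B :: "'i \<Rightarrow> 'u::euclidean_space \<Rightarrow> 'a::euclidean_space"
  assumes I: "finite I" and B: "\<And>z. z \<in> I \<Longrightarrow> linear (B z)"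
    and w: "\<And>z. z \<in> I \<Longrightarrow> 0 < w z" and k: "0 < k"
    and tame: "tame f1" "tame f2" and P: "linear P"
  obtains L where "\<And>s c. (\<And>z. z \<in> I \<Longrightarrow> s z \<in> {0..1}) \<Longrightarrow>
    \<exists>F. tame_convex L (\<lambda>u. (\<Sum>z\<in>I. w z * ((s z + k) * f1 (B z u) + (1 + k) * f2 (B z u))) + c + P u) F"
proof -
  obtain L1 F1 L2 F2 where f: "tame_convex L1 f1 F1" "tame_convex L2 f2 F2"
    using tame unfolding tame_def by blast
  obtain a where a: "\<And>u. P u = a \<bullet> u" using linear_functional_inner[OF P] by blast
  define M1 where "M1 z = (onorm (B z))\<^sup>2 * L1" for z
  define M2 where "M2 z = (onorm (B z))\<^sup>2 * L2" for z
  have M: "tame_convex (M1 z) (\<lambda>u. f1 (B z u)) (\<lambda>u. adjoint (B z) (F1 (B z u)))"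
    "tame_convex (M2 z) (\<lambda>u. f2 (B z u)) (\<lambda>u. adjoint (B z) (F2 (B z u)))" if "z \<in> I" for z
    unfolding M1_def M2_def using tame_convex_linear_comp f B[OF that] by blast+
  define L where "L = (\<Sum>z\<in>I. w z * ((1 + k) * M1 z + (1 + k) * M2 z))"
  show ?thesis
  proof (rule that[of L])
    fix s c assume s: "\<And>z. z \<in> I \<Longrightarrow> s z \<in> {0..1::real}"
    define F where "F z u = w z *\<^sub>R ((s z + k) *\<^sub>R adjoint (B z) (F1 (B z u)) + (1 + k) *\<^sub>R adjoint (B z) (F2 (B z u)))" for z u
    have "tame_convex (w z * ((1 + k) * M1 z + (1 + k) * M2 z))
        (\<lambda>u. w z * ((s z + k) * f1 (B z u) + (1 + k) * f2 (B z u))) (F z)" if z: "z \<in> I" for z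
    proof (rule tame_convex_mono)
      show "tame_convex (w z * ((s z + k) * M1 z + (1 + k) * M2 z))
          (\<lambda>u. w z * ((s z + k) * f1 (B z u) + (1 + k) * f2 (B z u))) (F z)"
        unfolding F_def using s[OF z] k w[OF z]
        by (intro tame_convex_scale tame_convex_add M z) auto
      show "w z * ((s z + k) * M1 z + (1 + k) * M2 z) \<le> w z * ((1 + k) * M1 z + (1 + k) * M2 z)"
        using s[OF z] w[OF z] tame_convex_nonneg[OF M(1)[OF z]]
        by (intro mult_left_mono add_right_mono mult_right_mono) auto
    qed
    then have "tame_convex L (\<lambda>u. \<Sum>z\<in>I. w z * ((s z + k) * f1 (B z u) + (1 + k) * f2 (B z u))) (\<lambda>u. \<Sum>z\<in>I. F z u)"
      unfolding L_def by (rule tame_convex_sum[OF I])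
    from tame_convex_add[OF this tame_convex_affine[of a c]]
    show "\<exists>F. tame_convex L (\<lambda>u. (\<Sum>z\<in>I. w z * ((s z + k) * f1 (B z u) + (1 + k) * f2 (B z u))) + c + P u) F"
      by (auto simp: a add_ac)
  qed
qed

lemma split_energy_strongly_convex:
  fixes A B :: "real^'m^'m"
  assumes conv: "convex_on UNIV (\<lambda>A :: real^'m^'m. psi_plus split lam mu (sym_part A))"
      "convex_on UNIV (\<lambda>A :: real^'m^'m. psi_minus split lam mu (sym_part A))"
    and c: "strongly_convex_on c (sym_matrices :: (real^'m^'m) set) (psi0 lam mu)"
    and A: "transpose A = A" and B: "transpose B = B" and t: "t \<in> {0..1}" and s: "0 \<le> s" and k: "0 < k"
  defines "f \<equiv> (\<lambda>A :: real^'m^'m. (s + k) * psi_plus split lam mu A + (1 + k) * psi_minus split lam mu A)"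
  shows "f ((1 - t) *\<^sub>R A + t *\<^sub>R B) \<le> (1 - t) * f A + t * f B - k * c / 2 * t * (1 - t) * (norm (A - B))\<^sup>2"
proof -
  define C where "C = (1 - t) *\<^sub>R A + t *\<^sub>R B"
  have C: "transpose C = C" using A B by (simp add: C_def transpose_linear)
  have f: "f X = k * psi0 lam mu X + (s * psi_plus split lam mu X + psi_minus split lam mu X)"
    if "transpose X = X" for X
    unfolding f_def psi_sum[OF that, symmetric, of lam mu split] by (simp add: algebra_simps)
  have p: "psi_plus split lam mu C \<le> (1 - t) * psi_plus split lam mu A + t * psi_plus split lam mu B"
    using convex_onD[OF conv(1), of t A B] t by (simp add: C_def[symmetric] sym_part_id A B C)
  have m: "psi_minus split lam mu C \<le> (1 - t) * psi_minus split lam mu A + t * psi_minus split lam mu B"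
    using convex_onD[OF conv(2), of t A B] t by (simp add: C_def[symmetric] sym_part_id A B C)
  have z: "psi0 lam mu C \<le> (1 - t) * psi0 lam mu A + t * psi0 lam mu B - c / 2 * t * (1 - t) * (norm (A - B))\<^sup>2"
    using c A B t unfolding strongly_convex_on_def C_def sym_matrices_def by blast
  have "f C \<le> k * ((1 - t) * psi0 lam mu A + t * psi0 lam mu B - c / 2 * t * (1 - t) * (norm (A - B))\<^sup>2)
      + (s * ((1 - t) * psi_plus split lam mu A + t * psi_plus split lam mu B)
         + ((1 - t) * psi_minus split lam mu A + t * psi_minus split lam mu B))"
    unfolding f[OF C] using p m z s k by (intro add_mono mult_left_mono) auto
  also have "\<dots> = (1 - t) * f A + t * f B - k * c / 2 * t * (1 - t) * (norm (A - B))\<^sup>2"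
    unfolding f[OF A] f[OF B] by (simp add: algebra_simps)
  finally show ?thesis by (simp add: C_def)
qed

lemma convex_on_linear_comp:
  assumes g: "convex_on T g" and lin: "linear \<phi>" and S: "convex S" and sub: "\<phi> ` S \<subseteq> T"
  shows "convex_on S (\<lambda>x. g (\<phi> x))"
proof (rule convex_onI[OF _ S])
  fix t :: real and x y
  assume "0 < t" "t < 1" "x \<in> S" "y \<in> S"
  then show "g (\<phi> ((1 - t) *\<^sub>R x + t *\<^sub>R y)) \<le> (1 - t) * g (\<phi> x) + t * g (\<phi> y)"
    using convex_onD[OF g, of t "\<phi> x" "\<phi> y"] sub
    by (simp add: linear_add[OF lin] linear_scale[OF lin] image_subset_iff)
qed

lemma convex_on_sum_functions:
  assumes "finite I" "\<And>i. i \<in> I \<Longrightarrow> convex_on S (f i)" "convex S"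
  shows "convex_on S (\<lambda>x. \<Sum>i\<in>I. f i x)"
  using assms by (induction I rule: finite_induct) (auto intro: convex_on_add simp: convex_on_const)

lemma convex_admissible_damage: "convex (admissible_damage dn)"
proof -
  have "admissible_damage dn = cbox dn 1"
    by (auto simp: admissible_damage_def mem_box_cart)
  then show ?thesis by simp
qed

lemma convex_dirichlet_space: "convex (dirichlet_space p \<Gamma> u0)"
  unfolding convex_def dirichlet_space_def by (auto simp flip: scaleR_left_distrib)

lemma linear_fe_fun_eval: "linear (\<lambda>d :: real^'n. fe_fun \<theta> d x)"
  by (intro linearI) (simp_all add: fe_fun_def distrib_left sum.distrib sum_distrib_left mult.left_commute)

theorem lemma3p4:
  fixes lam mu k gc l \<beta> :: real
    and split :: energy_split
    and g :: "real \<Rightarrow> real"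
    and \<Omega> \<Gamma> :: "(real^'m) set"
    and \<G> :: "(real^'m) set set"
    and V :: "(real^'m) set \<Rightarrow> (real^'m \<Rightarrow> real) set"
    and p :: "'n::finite \<Rightarrow> real^'m"
    and \<theta> :: "'n \<Rightarrow> real^'m \<Rightarrow> real"
    and N :: nat
    and q :: "(real^'m) set \<Rightarrow> nat \<Rightarrow> real^'m"
    and \<omega> :: "(real^'m) set \<Rightarrow> nat \<Rightarrow> real"
    and Pext :: "real^'m^'n \<Rightarrow> real"
    and dn :: "real^'n"
    and u0 :: "real^'m \<Rightarrow> real^'m"
    and J :: "real^'m^'n \<Rightarrow> real^'n \<Rightarrow> real"
  assumes mu: "mu > 0" and lam: "lam > - (2 / 3) * mu"
    and psi0: "\<exists>c>0. strongly_convex_on c (sym_matrices :: (real^'m^'m) set) (psi0 lam mu)"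
    and spectral: "split = Spectral \<Longrightarrow> lam \<ge> 0"
    and g: "g \<in> {0..1} \<rightarrow> {0..1}" "convex_on {0..1} g" "C2_on {0..1} g"
      "antimono_on {0..1} g" "g 0 = 1" "g 1 = 0"
    and k: "k > 0"
    and gc: "gc > 0" and l: "l > 0" and \<beta>: "\<beta> \<in> {-1..0}"
    and domain: "polyhedral_domain \<Omega>"
    and grid: "conforming_grid \<Omega> \<G> V"
    and basis: "nodal_basis \<G> V p \<theta>"
    and quad: "\<And>e \<alpha>. e \<in> \<G> \<Longrightarrow> \<alpha> \<in> {1..N} \<Longrightarrow> q e \<alpha> \<in> e \<and> \<omega> e \<alpha> > 0"
    and quad_exact: "\<And>e (u :: real^'m^'n). e \<in> \<G> \<Longrightarrow>
      (\<Sum>\<alpha>=1..N. (norm (strain e (fe_fun \<theta> u) (q e \<alpha>)))\<^sup>2 * \<omega> e \<alpha>) =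
      integral e (\<lambda>x. (norm (strain e (fe_fun \<theta> u) x))\<^sup>2)"
    and Pext: "linear Pext"
    and dn: "\<And>i. dn $ i \<in> {0..1}"
    and \<Gamma>: "\<Gamma> \<subseteq> frontier \<Omega>"
      "\<exists>e\<in>\<G>. \<exists>F. F facet_of e \<and> F \<subseteq> frontier \<Omega> \<and> {x. x extreme_point_of F} \<subseteq> range p \<inter> \<Gamma>"
    and J: "\<And>u d. J u d =
      quadrature \<G> N q \<omega>
        (\<lambda>e x. psi split lam mu k g (strain e (fe_fun \<theta> u) x) (fe_fun \<theta> d x))
      + integral \<Omega> (\<lambda>x. gc * crack_density \<beta> l (fe_fun \<theta> d x) (grad (fe_fun \<theta> d) x))
      + Pext u"
  shows "((\<forall>d\<in>admissible_damage dn. C11 (\<lambda>u. J u d)) \<and>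
           (\<forall>u. C2_on (admissible_damage dn) (J u)))
       \<and> (\<forall>d\<in>admissible_damage dn. semismooth (grad (\<lambda>u. J u d)))
       \<and> (\<exists>L. \<forall>d\<in>admissible_damage dn. L-lipschitz_on UNIV (grad (\<lambda>u. J u d)))
       \<and> (\<exists>c>0. \<forall>d\<in>admissible_damage dn.
             strongly_convex_on c (dirichlet_space p \<Gamma> u0) (\<lambda>u. J u d))
       \<and> (\<forall>u. convex_on (admissible_damage dn) (J u))"
proof -
  interpret lagrange_grid \<Omega> \<G> V p \<theta> using domain grid basis by unfold_locales
  let ?K = "admissible_damage dn"
  \<comment> \<open>A quadrature point is indexed by its element and its number there; \<open>B\<close>, \<open>D\<close> and \<open>w\<close> are its
    strain map, damage value and weight.\<close>
  define I where "I = \<G> \<times> {1..N}"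
  define B where "B z u = strain (fst z) (fe_fun \<theta> u) (q (fst z) (snd z))" for z and u :: "real^'m^'n"
  define D where "D z d = fe_fun \<theta> d (q (fst z) (snd z))" for z and d :: "real^'n"
  define w where "w z = \<omega> (fst z) (snd z)" for z
  let ?p = "psi_plus split lam mu :: real^'m^'m \<Rightarrow> real"
  let ?m = "psi_minus split lam mu :: real^'m^'m \<Rightarrow> real"
  have I: "finite I" using finite_grid by (simp add: I_def)
  have B: "linear (B z)" if "z \<in> I" for z
    unfolding B_def using that quad by (intro linear_strain) (auto simp: I_def)
  have symB: "transpose (B z u) = B z u" for z u unfolding B_def by (rule transpose_strain)
  have w: "w z > 0" if "z \<in> I" for z using that quad by (auto simp: I_def w_def)
  have D: "linear (D z)" for z unfolding D_def by (rule linear_fe_fun_eval)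
  have D01: "D z d \<in> {0..1}" if "d \<in> ?K" "z \<in> I" for z d
    unfolding D_def
  proof (rule fe_fun_bounds)
    show "d $ i \<in> {0..1}" for i using that(1) dn[of i] by (auto simp: admissible_damage_def intro: order_trans)
    show "fst z \<in> \<G>" "q (fst z) (snd z) \<in> fst z" using that(2) quad by (auto simp: I_def)
  qed
  then have Dsub: "D z ` ?K \<subseteq> {0..1}" if "z \<in> I" for z using that by blast
  have g01: "g (D z d) \<in> {0..1}" if "d \<in> ?K" "z \<in> I" for z d
    using g(1) D01[OF that] by (auto simp: Pi_iff)
  obtain b :: "real^'n" and A :: "real^'n^'n" where crack:
      "\<And>d. integral \<Omega> (\<lambda>x. gc * crack_density \<beta> l (fe_fun \<theta> d x) (grad (fe_fun \<theta> d) x)) = b \<bullet> d + d \<bullet> (A *v d)"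
      "\<And>h. 0 \<le> h \<bullet> (A *v h)"
    using crack_energy_quadratic[of gc l \<beta>] gc l \<beta> by auto
  have J_eq: "J u d = (\<Sum>z\<in>I. w z * ((g (D z d) + k) * ?p (B z u) + (1 + k) * ?m (B z u)))
      + (b \<bullet> d + d \<bullet> (A *v d)) + Pext u" for u d
    unfolding J crack quadrature_def psi_def I_def B_def D_def w_def sum.cartesian_product
    by (simp add: case_prod_beta mult.commute)
  obtain c0 where c0: "c0 > 0" "strongly_convex_on c0 (sym_matrices :: (real^'m^'m) set) (psi0 lam mu)"
    using psi0 by blast
  have psi0_nonneg: "0 \<le> psi0 lam mu A" if "transpose A = A" for A :: "real^'m^'m"
  proof -
    have "0 \<le> c0 / 2 * (norm A)\<^sup>2" using c0(1) by simp
    then show ?thesis using strongly_convex_psi0_bound[OF c0(2) that] by linarith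
  qed
  have tame: "tame (\<lambda>A :: real^'m^'m. ?p (sym_part A))" "tame (\<lambda>A :: real^'m^'m. ?m (sym_part A))"
    using tame_psi_parts[where 'm='m and split=split and lam=lam and mu=mu] psi0_nonneg mu spectral by auto
  have conv: "convex_on UNIV (\<lambda>A :: real^'m^'m. ?p (sym_part A))" "convex_on UNIV (\<lambda>A :: real^'m^'m. ?m (sym_part A))"
    using tame tame_convex_convex unfolding tame_def by blast+

  obtain L where L: "\<And>d. d \<in> ?K \<Longrightarrow> \<exists>F. tame_convex L (\<lambda>u. J u d) F"
  proof -
    obtain L where L: "\<And>s c. (\<And>z. z \<in> I \<Longrightarrow> s z \<in> {0..1}) \<Longrightarrow> \<exists>F. tame_convex L
        (\<lambda>u. (\<Sum>z\<in>I. w z * ((s z + k) * ?p (sym_part (B z u)) + (1 + k) * ?m (sym_part (B z u)))) + c + Pext u) F"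
      by (rule tame_convex_energy_sum[of I B w k "\<lambda>A. ?p (sym_part A)" "\<lambda>A. ?m (sym_part A)" Pext])
        (use I B w k tame Pext in auto)
    show ?thesis
    proof (rule that)
      fix d assume d: "d \<in> ?K"
      show "\<exists>F. tame_convex L (\<lambda>u. J u d) F"
        using L[of "\<lambda>z. g (D z d)" "b \<bullet> d + d \<bullet> (A *v d)", OF g01[OF d]]
        unfolding J_eq sym_part_id[OF symB] .
    qed
  qed
  have part1a: "C11 (\<lambda>u. J u d)" if "d \<in> ?K" for d using L[OF that] tame_convex_C11 by blast
  have part2: "semismooth (grad (\<lambda>u. J u d))" if "d \<in> ?K" for d
    using L[OF that] tame_convex_semismooth by blast
  have part3: "L-lipschitz_on UNIV (grad (\<lambda>u. J u d))" if "d \<in> ?K" for d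
    using L[OF that] tame_convex_grad unfolding tame_convex_def by metis

  define R where "R d = b \<bullet> d + d \<bullet> (A *v d)" for d
  have R: "C2_on ?K R" "convex_on ?K R"
    unfolding R_def by (intro C2_on_quadratic convex_on_quadratic crack(2) convex_admissible_damage)+
  \<comment> \<open>In the damage variable only \<open>g (D z d)\<close> and the quadratic crack energy \<open>R\<close> are not constant.\<close>
  define E where "E u = (\<Sum>z\<in>I. w z * (k * ?p (B z u) + (1 + k) * ?m (B z u))) + Pext u" for u
  have J_damage: "J u = (\<lambda>d. (\<Sum>z\<in>I. (w z * ?p (B z u)) * g (D z d))
      + (R d + E u))" for u
    by (rule ext) (simp add: J_eq R_def E_def algebra_simps sum.distrib)
  have part1b: "C2_on ?K (J u)" for u
    unfolding J_damage
  proof (intro C2_on_add C2_on_sum I C2_on_cmult R C2_on_const)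
    fix z assume z: "z \<in> I"
    have "bounded_linear (D z)" using D by (simp add: linear_conv_bounded_linear)
    then show "C2_on ?K (\<lambda>d. g (D z d))" by (rule C2_on_compose_linear[OF g(3) _ Dsub[OF z]])
  qed
  have part5: "convex_on ?K (J u)" for u
    unfolding J_damage
  proof (intro convex_on_add convex_on_sum_functions I R convex_admissible_damage convex_on_cmul)
    fix z assume z: "z \<in> I"
    show "0 \<le> w z * ?p (B z u)"
      using w[OF z] psi_plus_nonneg[OF psi0_nonneg less_imp_le[OF mu] spectral symB] by simp
    show "convex_on ?K (\<lambda>d. g (D z d))"
      by (rule convex_on_linear_comp[OF g(2) D convex_admissible_damage Dsub[OF z]])
  qed (simp add: convex_on_const convex_admissible_damage)

  \<comment> \<open>Differences of displacements with the same Dirichlet data.\<close>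
  define S where "S = {u :: real^'m^'n. \<forall>i. p i \<in> \<Gamma> \<longrightarrow> u $ i = 0}"
  have "subspace S" by (auto simp: S_def subspace_def)
  moreover have "u = 0" if u: "u \<in> S" and zero: "\<And>z. z \<in> I \<Longrightarrow> B z u = 0" for u
  proof -
    obtain e F where eF: "e \<in> \<G>" "F facet_of e" "{x. x extreme_point_of F} \<subseteq> range p \<inter> \<Gamma>" using \<Gamma>(2) by blast
    show ?thesis
    proof (rule zero_strain_dirichlet[OF _ eF(1,2)])
      fix e x assume e: "e \<in> \<G>" and x: "x \<in> interior e"
      have "strain e (fe_fun \<theta> u) (q e \<alpha>) = 0" if "\<alpha> \<in> {1..N}" for \<alpha>
        using zero[of "(e, \<alpha>)"] that e by (simp add: B_def I_def)
      then have "integral e (\<lambda>x. (norm (strain e (fe_fun \<theta> u) x))\<^sup>2) = 0"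
        unfolding quad_exact[OF e, symmetric] by simp
      then show "strain e (fe_fun \<theta> u) x = 0" by (rule zero_strain_energy[OF e _ x])
    next
      show "u $ i = 0" if "p i extreme_point_of F" for i using u eF(3) that by (auto simp: S_def)
    qed (use eF(3) in blast)
  qed
  ultimately obtain c where c: "c > 0" "\<And>u. u \<in> S \<Longrightarrow> c * (norm u)\<^sup>2 \<le> (\<Sum>z\<in>I. w z * (norm (B z u))\<^sup>2)"
    using coercive_on_subspace[of S I B w] I B w by blast
  \<comment> \<open>The modulus is a product of three: \<open>k\<close> bounds the degradation from below, \<open>c0\<close> belongs to \<open>psi0\<close>
    and \<open>c\<close> is the coercivity constant of the strain.\<close>
  have part4: "strongly_convex_on (k * c0 * c) (dirichlet_space p \<Gamma> u0) (\<lambda>u. J u d)" if d: "d \<in> ?K" for d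
    unfolding strongly_convex_on_def
  proof (intro conjI ballI convex_dirichlet_space)
    fix x y and t :: real
    assume x: "x \<in> dirichlet_space p \<Gamma> u0" and y: "y \<in> dirichlet_space p \<Gamma> u0" and t: "t \<in> {0..1}"
    define f where "f z X = (g (D z d) + k) * ?p X + (1 + k) * ?m X" for z X
    define v where "v = (1 - t) *\<^sub>R x + t *\<^sub>R y"
    define Q where "Q = (\<Sum>z\<in>I. w z * (norm (B z (x - y)))\<^sup>2)"
    have "x - y \<in> S" using x y by (auto simp: S_def dirichlet_space_def)
    then have Q: "c * (norm (x - y))\<^sup>2 \<le> Q" unfolding Q_def by (rule c(2))
    have "f z (B z v) \<le> (1 - t) * f z (B z x) + t * f z (B z y) - k * c0 / 2 * t * (1 - t) * (norm (B z (x - y)))\<^sup>2"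
      if z: "z \<in> I" for z
      using split_energy_strongly_convex[OF conv c0(2) symB[of z x] symB[of z y] t _ k, of "g (D z d)"] g01[OF d z]
      by (simp add: f_def v_def linear_add[OF B[OF z]] linear_scale[OF B[OF z]] linear_diff[OF B[OF z]])
    then have "(\<Sum>z\<in>I. w z * f z (B z v)) \<le> (\<Sum>z\<in>I. w z * ((1 - t) * f z (B z x) + t * f z (B z y)
        - k * c0 / 2 * t * (1 - t) * (norm (B z (x - y)))\<^sup>2))"
      using w by (intro sum_mono mult_left_mono) (auto simp: less_imp_le)
    also have "\<dots> = (1 - t) * (\<Sum>z\<in>I. w z * f z (B z x)) + t * (\<Sum>z\<in>I. w z * f z (B z y))
        - k * c0 / 2 * t * (1 - t) * Q"
      unfolding Q_def sum_distrib_left sum.distrib[symmetric] sum_subtractf[symmetric]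
      by (intro sum.cong refl) (simp add: algebra_simps)
    also have "\<dots> \<le> (1 - t) * (\<Sum>z\<in>I. w z * f z (B z x)) + t * (\<Sum>z\<in>I. w z * f z (B z y))
        - k * c0 / 2 * t * (1 - t) * (c * (norm (x - y))\<^sup>2)"
      using Q k c0(1) t by (intro diff_left_mono mult_left_mono) auto
    finally have main: "(\<Sum>z\<in>I. w z * f z (B z v)) \<le> (1 - t) * (\<Sum>z\<in>I. w z * f z (B z x))
        + t * (\<Sum>z\<in>I. w z * f z (B z y)) - k * c0 / 2 * t * (1 - t) * (c * (norm (x - y))\<^sup>2)" .
    have Jf: "J u d = (\<Sum>z\<in>I. w z * f z (B z u)) + (b \<bullet> d + d \<bullet> (A *v d)) + Pext u" for u
      by (simp add: J_eq f_def)
    have "Pext v = (1 - t) * Pext x + t * Pext y"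
      by (simp add: v_def linear_add[OF Pext] linear_scale[OF Pext])
    with main have "J v d \<le> (1 - t) * J x d + t * J y d - k * c0 / 2 * t * (1 - t) * (c * (norm (x - y))\<^sup>2)"
      unfolding Jf by (simp add: algebra_simps)
    then show "J ((1 - t) *\<^sub>R x + t *\<^sub>R y) d \<le> (1 - t) * J x d + t * J y d
        - k * c0 * c / 2 * t * (1 - t) * (norm (x - y))\<^sup>2"
      by (simp add: v_def mult_ac)
  qed
  have "k * c0 * c > 0" using k c0(1) c(1) by simp
  with part1a part1b part2 part3 part4 part5 show ?thesis by blast
qed

end
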